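(* Let $\varphi\in\mathcal{S}_r\cap\mathcal{C}$ be real-valued. (1) If $\varphi(0^+)>0$, then for any $N\in\mathbb{N}$ and any $N$ distinct primes $p_1,\dots,p_N$, $$2\varphi(0^+)>\sum_{1\le i\le N}J_\varphi(\tfrac{2}{p_i})-\sum_{1\le i<j\le N}J_\varphi(\tfrac{2}{p_ip_j})+\cdots+(-1)^{N+1}J_\varphi\Big(\tfrac{2}{\prod_{i=1}^Np_i}\Big).$$ (2) If $\varphi(0^+)=0$, then either $J_\varphi(\frac2p)\ge0$ for every prime $p$, or $J_\varphi(\frac2p)\le0$ for every prime $p$. (3) Let $p$ be a prime with $p\equiv3\pmod 4$ and $k$ a positive integer. Then $J_\varphi(\frac{m}{p^k})=J_\varphi(\frac{n}{p^k})$ for all $1\le m,n\le p^k-1$ such that $p\nmid mn$ and $m-n$ is even.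
   Context: $L^2=L^2(0,1)$; each $\varphi\in L^2$ is identified with its odd $2$-periodic extension to $\mathbb{R}$. $\mathcal{C}$ is the set of $\varphi\in L^2$ such that the span of $\{\varphi(kx):k\in\mathbb{N}\}$ is dense in $L^2$. $\mathcal{S}_r$ is the class of step functions on $(0,1)$ (finitely many jumps) all of whose jump discontinuities in $(0,1)$ are rational. $J_\varphi(x)=\varphi(x^+)-\varphi(x^-)$ for $x\in\mathbb{R}$, computed for the odd $2$-periodic extension. *)

theory Defs
  imports "HOL-Analysis.Analysis" "HOL-Computational_Algebra.Primes"
begin

text \<open>Odd 2-periodic extension of a function given on (0,1).  Values at the
  integers (a null set) are set to 0.\<close>
definition oext :: "(real \<Rightarrow> real) \<Rightarrow> real \<Rightarrow> real" where
  "oext \<phi> x = (let y = x - 2 * of_int \<lfloor>x / 2\<rfloor> in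
      if 0 < y \<and> y < 1 then \<phi> y
      else if 1 < y \<and> y < 2 then - \<phi> (2 - y) else 0)"

definition jump :: "(real \<Rightarrow> real) \<Rightarrow> real \<Rightarrow> real" where
  "jump \<phi> x = Lim (at_right x) (oext \<phi>) - Lim (at_left x) (oext \<phi>)"

definition rlim0 :: "(real \<Rightarrow> real) \<Rightarrow> real" where
  "rlim0 \<phi> = Lim (at_right 0) \<phi>"

definition L2_01 :: "(real \<Rightarrow> real) \<Rightarrow> bool" where
  "L2_01 f \<longleftrightarrow> f \<in> borel_measurable lborel \<and>
     set_integrable lborel {0<..<1} (\<lambda>x. (f x)\<^sup>2)"

definition complete_dilates :: "(real \<Rightarrow> real) \<Rightarrow> bool" where
  "complete_dilates \<phi> \<longleftrightarrow> L2_01 \<phi> \<and>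
     (\<forall>f. L2_01 f \<longrightarrow> (\<forall>\<epsilon>>0. \<exists>K c. finite K \<and> K \<subseteq> {1..} \<and>
        (let g = (\<lambda>x. f x - (\<Sum>k\<in>K. c k * oext \<phi> (real k * x))) in
          set_integrable lborel {0<..<1} (\<lambda>x. (g x)\<^sup>2) \<and>
          (LINT x:{0<..<1}|lborel. (g x)\<^sup>2) < \<epsilon>)))"

text \<open>Step functions on (0,1) with finitely many jumps (locally constant off a
  finite subset of (0,1)) all of whose jump discontinuities in (0,1) are rational:
  at every irrational point of (0,1) the function is constant on a punctured
  neighbourhood.\<close>
definition step_rat :: "(real \<Rightarrow> real) \<Rightarrow> bool" where
  "step_rat \<phi> \<longleftrightarrow>
     (\<exists>S. finite S \<and> S \<subseteq> {0<..<1} \<and>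
        (\<forall>x\<in>{0<..<1} - S. \<exists>e>0. \<forall>y. \<bar>y - x\<bar> < e \<longrightarrow> \<phi> y = \<phi> x)) \<and>
     (\<forall>x\<in>{0<..<1} - \<rat>. \<exists>c. \<exists>e>0. \<forall>y. y \<noteq> x \<and> \<bar>y - x\<bar> < e \<longrightarrow> \<phi> y = c)"

end

theory Submission
  imports "HOL-Computational_Algebra.Fundamental_Theorem_Algebra"
    "HOL-Complex_Analysis.Complex_Analysis" "HOL-Number_Theory.Number_Theory" Defs
begin

text \<open>
  Choose \<open>q\<close> so that the jumps of \<open>\<phi>\<close> lie at multiples of \<open>1 / q\<close>. Up to a constant, the \<open>n\<close>-th sine
  coefficient of \<open>\<phi>\<close> is \<open>f n / n\<close>, where \<open>f\<close> has period \<open>2 q\<close> and is the discrete cosine transform of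
  the jumps. If \<open>z\<close> is completely multiplicative and absolutely summable, then pairing with \<open>\<Sum>n. z n sin (n \<pi> x)\<close> is an eigenfunctional
  for all dilations, hence completeness forces \<open>\<Sum>n. f n z n / n \<noteq> 0\<close>. Perturbing \<open>z\<close> at primes
  of one residue class, as in the Gleason--Kahane--Zelazko theorem, this gives \<open>f (u n) f 1 = f u f n\<close> for all
  \<open>u\<close> coprime to \<open>2 q\<close>, so \<open>f u / f 1\<close> is a real character and the jumps transform by it.

  Part (3) follows since modulo \<open>p ^ k\<close> with \<open>p \<equiv> 3 (mod 4)\<close> every unit is a square up to sign, and
  the jumps are even. In parts (1) and (2) the character may be taken trivial; then \<open>f\<close> is a divisor sum
  over \<open>d dvd 2 q\<close> with weights \<open>h d\<close>, the alternating sums of jumps are boundary values of the polynomial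
  \<open>\<Sum>d. h d / d z d\<close>, and this has no zeros in the open polydisc.
\<close>

section \<open>Residue classes avoiding a sparse set of primes\<close>

text \<open>Completeness gives nonvanishing on an open polydisc only, and this shapes the argument
  twice. Multiplicativity comes from comparing growth: if many primes of one class share a variable,
  the Euler sum grows at most like \<open>exp (2 * S)\<close> with \<open>S\<close> the sum of
  \<open>1 / p\<close>, while a failure of multiplicativity would put a term of size
  \<open>S ^ 2\<close> into its logarithm. This needs classes with unbounded \<open>S\<close>;
  primes of the other classes are avoided altogether. Second, the alternating sums of jumps sit at
  boundary points, where a zero is not excluded. For a polynomial of degree at most \<open>N\<close>
  without zeros in the disc, the value at 0 controls the value at 1 up to a factor
  \<open>2 ^ N\<close>; this keeps the inequality of part (1) strict in the limit. The character is
  trivial in (1) because 0 is fixed by all units and carries the nonzero jump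
  \<open>2 * rlim0 \<phi>\<close>; in (2), a nonzero jump at \<open>2 / p\<close> makes it trivial
  on units congruent to 1 modulo \<open>p\<close>, and two such primes suffice. In (3) it may be
  nontrivial, but being real it is 1 on squares of units.\<close>

lemma sum_reciprocals_progression_multiples_le:
  fixes L a p X :: nat
  assumes L: "L > 0" and a: "1 \<le> a" "a \<le> L" and p: "p > 0" "coprime p L"
  shows "(\<Sum>j\<in>{j\<in>{..<X}. p dvd a + j * L}. 1 / real (a + j * L))
    \<le> (1 / real p) * (1 + (\<Sum>i<X. 1 / real (Suc i)) / real L)"
proof -
  define J where "J = {j\<in>{..<X}. p dvd a + j * L}"
  \<comment> \<open>The multiples of \<open>p\<close> in the progression are \<open>p * m j\<close>.
    As \<open>p\<close> is a unit modulo \<open>L\<close>, all cofactors \<open>m j\<close> lie in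
    one residue class modulo \<open>L\<close>; hence \<open>i j\<close>, the block of length
    \<open>L\<close> containing \<open>m j\<close>, determines \<open>j\<close>.\<close>
  define m where "m = (\<lambda>j. (a + j * L) div p)"
  define i where "i = (\<lambda>j. (m j - 1) div L)"
  define g where "g = (\<lambda>k. if k = 0 then 1 else 1 / (real k * real L))"
  have m: "p * m j = a + j * L" "m j > 0" if "j \<in> J" for j
  proof -
    show "p * m j = a + j * L" using that by (simp add: J_def m_def)
    then show "m j > 0" using a by (cases "m j = 0") auto
  qed
  have inj: "inj_on i J"
  proof (rule inj_onI)
    fix j k assume jk: "j \<in> J" "k \<in> J" "i j = i k"
    have "[p * m j = p * m k] (mod L)"
      using m[OF jk(1)] m[OF jk(2)] by (simp add: cong_def)
    then have "[m j = m k] (mod L)"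
      using p(2) by (simp add: cong_mult_lcancel_nat coprime_commute)
    moreover have "m j = Suc (m j - 1)" "m k = Suc (m k - 1)"
      using m jk by simp_all
    ultimately have "[Suc (m j - 1) = Suc (m k - 1)] (mod L)" by simp
    then have "[m j - 1 = m k - 1] (mod L)"
      using cong_add_rcancel_nat[of "m j - 1" 1 "m k - 1" L] by simp
    then have "(m j - 1) mod L = (m k - 1) mod L" by (simp add: cong_def)
    with jk(3) have "m j - 1 = m k - 1"
      unfolding i_def by (metis div_mult_mod_eq)
    with m jk have "m j = m k" by (metis \<open>m j = Suc (m j - 1)\<close> \<open>m k = Suc (m k - 1)\<close>)
    then have "a + j * L = a + k * L" using m jk by metis
    then show "j = k" using L by simp
  qed
  have iX: "i ` J \<subseteq> {..<X}"
  proof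
    fix y assume "y \<in> i ` J"
    then obtain j where j: "j \<in> J" "y = i j" by auto
    have "m j \<le> p * m j" using p(1) by simp
    also have "p * m j = a + j * L" by (rule m(1)[OF j(1)])
    also have "\<dots> \<le> Suc j * L" using a by simp
    also have "\<dots> \<le> X * L" using j(1) by (intro mult_le_mono1) (simp add: J_def Suc_le_eq)
    finally have "m j - 1 < X * L" using m(2)[OF j(1)] by linarith
    then show "y \<in> {..<X}" unfolding j(2) i_def
      by (simp add: less_mult_imp_div_less)
  qed
  have pointwise: "1 / real (a + j * L) \<le> (1 / real p) * g (i j)" if "j \<in> J" for j
  proof -
    have "1 / real (a + j * L) = (1 / real p) * (1 / real (m j))"
      using m(1)[OF that] by (metis divide_divide_eq_left mult.commute mult_1 of_nat_mult times_divide_eq_left)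
    moreover have "1 / real (m j) \<le> g (i j)"
    proof (cases "i j = 0")
      case True then show ?thesis using m(2)[OF that] by (simp add: g_def)
    next
      case False
      have "i j * L \<le> m j" unfolding i_def
        by (metis diff_le_self div_times_less_eq_dividend le_trans)
      then have "real (i j) * real L \<le> real (m j)"
        by (metis of_nat_le_iff of_nat_mult)
      then show ?thesis using False L m(2)[OF that] by (simp add: g_def field_simps)
    qed
    ultimately show ?thesis by (metis mult_left_mono of_nat_0_le_iff zero_le_divide_1_iff)
  qed
  have "(\<Sum>j\<in>J. 1 / real (a + j * L)) \<le> (\<Sum>j\<in>J. (1 / real p) * g (i j))"
    by (rule sum_mono) (rule pointwise)
  also have "\<dots> = (1 / real p) * (\<Sum>k\<in>i ` J. g k)"
    by (simp add: sum.reindex[OF inj] sum_distrib_left)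
  also have "\<dots> \<le> (1 / real p) * (\<Sum>k<Suc X. g k)"
    using iX by (intro mult_left_mono sum_mono2) (auto simp: g_def)
  also have "(\<Sum>k<Suc X. g k) = 1 + (\<Sum>k<X. 1 / real (Suc k)) / real L"
    by (simp only: sum.lessThan_Suc_shift) (simp add: g_def sum_divide_distrib)
  finally show ?thesis unfolding J_def .
qed

text \<open>If every term had a divisor in \<open>V\<close>, counting each term once per divisor
  would give \<open>H / L \<le> (1 / 2) * (1 + H / L)\<close> for the harmonic sum \<open>H\<close>,
  so \<open>H \<le> L\<close> at every length, against the divergence of the harmonic
  series.\<close>

lemma exists_progression_member_avoiding_sparse:
  fixes L a :: nat and V :: "nat set"
  assumes L: "L > 0" and a: "1 \<le> a" "a \<le> L"
    and V: "\<And>p. p \<in> V \<Longrightarrow> p > 0 \<and> coprime p L"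
    and small: "\<And>W. finite W \<Longrightarrow> W \<subseteq> V \<Longrightarrow> (\<Sum>p\<in>W. 1 / real p) \<le> 1 / 2"
  shows "\<exists>j. \<forall>p\<in>V. \<not> p dvd a + j * L"
proof (rule ccontr)
  assume "\<not> ?thesis"
  then have ex: "\<exists>p\<in>V. p dvd a + j * L" for j by blast
  have bound: "(\<Sum>i<X. 1 / real (Suc i)) \<le> real L" for X
  proof -
    define H where "H = (\<Sum>i<X. 1 / real (Suc i))"
    define W where "W = {p\<in>V. p \<le> Suc X * L}"
    have finW: "finite W" unfolding W_def
      by (rule finite_subset[of _ "{..Suc X * L}"]) auto
    have "H / real L = (\<Sum>j<X. 1 / real (Suc j * L))"
      unfolding H_def sum_divide_distrib by (rule sum.cong) (auto simp: algebra_simps)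
    also have "\<dots> \<le> (\<Sum>j<X. 1 / real (a + j * L))"
    proof (rule sum_mono)
      fix j
      have "a + j * L \<le> Suc j * L" using a by simp
      then have "real (a + j * L) \<le> real (Suc j * L)" by (rule of_nat_mono)
      then show "1 / real (Suc j * L) \<le> 1 / real (a + j * L)"
        using a L by (intro divide_left_mono mult_pos_pos) (auto intro!: add_pos_nonneg)
    qed
    also have "\<dots> \<le> (\<Sum>j<X. \<Sum>p\<in>{p\<in>W. p dvd a + j * L}. 1 / real (a + j * L))"
    proof (rule sum_mono)
      fix j assume j: "j \<in> {..<X}"
      obtain p where p: "p \<in> V" "p dvd a + j * L" using ex by blast
      have "p \<le> a + j * L" using p(2) a by (intro dvd_imp_le) auto
      also have "\<dots> \<le> Suc j * L" using a by simp
      also have "\<dots> \<le> Suc X * L" using j by (intro mult_le_mono1) auto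
      finally have "p \<in> {p\<in>W. p dvd a + j * L}" using p by (simp add: W_def)
      then have "card {p\<in>W. p dvd a + j * L} \<ge> 1"
        using finW by (metis One_nat_def Suc_leI card_gt_0_iff empty_iff finite_Collect_conjI Collect_mem_eq)
      then have "1 * (1 / real (a + j * L)) \<le> real (card {p\<in>W. p dvd a + j * L}) * (1 / real (a + j * L))"
        by (intro mult_right_mono) auto
      then show "1 / real (a + j * L) \<le> (\<Sum>p\<in>{p\<in>W. p dvd a + j * L}. 1 / real (a + j * L))"
        by simp
    qed
    also have "\<dots> = (\<Sum>p\<in>W. \<Sum>j\<in>{j\<in>{..<X}. p dvd a + j * L}. 1 / real (a + j * L))"
      by (rule sum.swap_restrict) (use finW in auto)
    also have "\<dots> \<le> (\<Sum>p\<in>W. (1 / real p) * (1 + H / real L))"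
      unfolding H_def
      by (intro sum_mono sum_reciprocals_progression_multiples_le L a) (use V in \<open>auto simp: W_def\<close>)
    also have "\<dots> = (\<Sum>p\<in>W. 1 / real p) * (1 + H / real L)"
      by (simp add: sum_distrib_right)
    also have "\<dots> \<le> (1 / 2) * (1 + H / real L)"
    proof (rule mult_right_mono)
      show "(\<Sum>p\<in>W. 1 / real p) \<le> 1 / 2" by (rule small[OF finW]) (auto simp: W_def)
      have "H \<ge> 0" unfolding H_def by (rule sum_nonneg) auto
      then show "0 \<le> 1 + H / real L" by simp
    qed
    finally have "H / real L \<le> (1 / 2) * (1 + H / real L)" .
    moreover have "x \<le> (1 / 2) * (1 + x) \<Longrightarrow> x \<le> 1" for x :: real by simp
    ultimately have "H / real L \<le> 1" by blast
    then show ?thesis using L by (simp add: H_def)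
  qed
  have "summable (\<lambda>i. 1 / real (Suc i))"
    by (rule summableI_nonneg_bounded[OF _ bound]) auto
  then have "summable (\<lambda>i. inverse (real (Suc i)))" by (simp add: inverse_eq_divide)
  then show False
    using not_summable_harmonic[where 'a=real] by (subst (asm) summable_Suc_iff) simp
qed

text \<open>A finite \<open>W0\<close> carries all but \<open>1 / 2\<close> of the reciprocal sum.
  Its primes are avoided by prescribing the residue 1 modulo their product, the remaining ones by
  the sieve for the enlarged modulus.\<close>

lemma exists_residue_avoiding_primes:
  fixes L a :: nat and V :: "nat set" and C :: real
  assumes L: "L > 0" and a: "coprime a L"
    and V: "\<And>p. p \<in> V \<Longrightarrow> prime p \<and> \<not> p dvd L"
    and bounded: "\<And>W. finite W \<Longrightarrow> W \<subseteq> V \<Longrightarrow> (\<Sum>p\<in>W. 1 / real p) \<le> C"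
  shows "\<exists>n>0. [n = a] (mod L) \<and> (\<forall>p\<in>V. \<not> p dvd n)"
proof -
  define A where "A = (\<lambda>W. \<Sum>p\<in>W. 1 / real p) ` {W. finite W \<and> W \<subseteq> V}"
  have bdd: "bdd_above A" using bounded by (auto simp: A_def bdd_above_def)
  have "A \<noteq> {}" by (auto simp: A_def)
  then obtain y where "y \<in> A" "Sup A - 1 / 2 < y"
    using less_cSup_iff[OF _ bdd, of "Sup A - 1 / 2"] by auto
  then obtain W0 where W0: "finite W0" "W0 \<subseteq> V" "Sup A - 1 / 2 < (\<Sum>p\<in>W0. 1 / real p)"
    by (auto simp: A_def)
  have tail: "(\<Sum>p\<in>W. 1 / real p) \<le> 1 / 2" if "finite W" "W \<subseteq> V - W0" for W
  proof -
    have "(\<Sum>p\<in>W0 \<union> W. 1 / real p) \<in> A" using that W0 by (auto simp: A_def)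
    then have "(\<Sum>p\<in>W0 \<union> W. 1 / real p) \<le> Sup A" using bdd by (rule cSup_upper)
    moreover have "(\<Sum>p\<in>W0 \<union> W. 1 / real p) = (\<Sum>p\<in>W0. 1 / real p) + (\<Sum>p\<in>W. 1 / real p)"
      using that W0(1) by (intro sum.union_disjoint) auto
    ultimately show ?thesis using W0(3) by linarith
  qed
  define N where "N = \<Prod>W0"
  have N: "N > 0" unfolding N_def using W0(2) V by (intro prod_pos) (auto simp: prime_gt_0_nat)
  have "coprime L N" unfolding N_def
    using W0(2) V by (intro prod_coprime_right) (metis prime_imp_coprime coprime_commute subsetD)
  then obtain x where x: "[x = a] (mod L)" "[x = 1] (mod N)"
    using binary_chinese_remainder_nat by blast
  define K where "K = L * N"
  have K: "K > 0" using L N by (simp add: K_def)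
  \<comment> \<open>The representative is taken in \<open>{1..K}\<close>, with \<open>K\<close> in
    place of 0, as the sieve for progressions requires.\<close>
  define b where "b = (if x mod K = 0 then K else x mod K)"
  have b: "1 \<le> b" "b \<le> K" "[b = x] (mod K)"
    using K by (auto simp: b_def cong_def mod_less_divisor less_imp_le)
  have "\<exists>j. \<forall>p\<in>V - W0. \<not> p dvd b + j * K"
  proof (rule exists_progression_member_avoiding_sparse[OF K b(1,2) _ tail])
    fix p assume p: "p \<in> V - W0"
    then have pp: "prime p" "\<not> p dvd L" using V by auto
    have "\<not> p dvd N"
    proof
      assume "p dvd N"
      then obtain q where "q \<in> W0" "p dvd q"
        using prime_dvd_prod_iff[OF W0(1) pp(1), of "\<lambda>x. x"] by (auto simp: N_def)
      then have "p = q" using V W0(2) pp(1) by (metis primes_dvd_imp_eq subsetD)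
      then show False using \<open>q \<in> W0\<close> p by auto
    qed
    then have "\<not> p dvd K" using pp by (simp add: K_def prime_dvd_mult_iff)
    then show "p > 0 \<and> coprime p K" using pp by (simp add: prime_imp_coprime prime_gt_0_nat)
  qed auto
  then obtain j where j: "\<forall>p\<in>V - W0. \<not> p dvd b + j * K" by blast
  let ?n = "b + j * K"
  have nx: "[?n = x] (mod K)" using b(3) by (simp add: cong_def)
  have "[?n = x] (mod L)" "[?n = x] (mod N)"
    using cong_dvd_modulus_nat[OF nx] by (auto simp: K_def)
  then have n: "[?n = a] (mod L)" "[?n = 1] (mod N)"
    using x cong_trans by blast+
  have "\<not> p dvd ?n" if "p \<in> V" for p
  proof (cases "p \<in> W0")
    case True
    then have "p dvd N" unfolding N_def using W0(1) by (simp add: dvd_prodI[of W0 p "\<lambda>x. x", simplified])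
    then have "[?n = 1] (mod p)" using n(2) cong_dvd_modulus_nat by blast
    then show ?thesis using V[OF that]
      by (metis cong_dvd_iff nat_dvd_1_iff_1 not_prime_1)
  qed (use j that in blast)
  moreover have "?n > 0" using b(1) by linarith
  ultimately show ?thesis using n(1) by blast
qed

section \<open>Euler sums and estimates on the disc\<close>

text \<open>For a list of pairs \<open>(p, t\<^sub>p)\<close> this is the sum of \<open>f (d n)\<close> weighted by the product of the
  \<open>t\<^sub>p ^ v\<^sub>p(d)\<close>, over all \<open>d\<close> whose prime factors occur in the list: a Dirichlet series evaluated at
  a point of the polydisc.\<close>
fun euler_sum :: "(nat \<Rightarrow> complex) \<Rightarrow> (nat \<times> complex) list \<Rightarrow> nat \<Rightarrow> complex" where
  "euler_sum f [] n = f n"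
| "euler_sum f ((p, t) # xs) n = (\<Sum>j. t ^ j * euler_sum f xs (p ^ j * n))"

text \<open>The radius \<open>1 / real p\<close> is the unit disc after the substitution
  \<open>t = z / of_nat p\<close>; the denominator stems from the \<open>n\<close> in the sine
  coefficient \<open>f n / n\<close>.\<close>

definition admissible :: "(nat \<times> complex) list \<Rightarrow> bool" where
  "admissible xs \<longleftrightarrow> distinct (map fst xs) \<and> (\<forall>(p, t)\<in>set xs. prime p \<and> norm t < 1 / real p)"

lemma admissible_Cons:
  "admissible ((p, t) # xs) \<longleftrightarrow> prime p \<and> norm t < 1 / real p \<and> p \<notin> fst ` set xs \<and> admissible xs"
  by (auto simp: admissible_def)

lemma norm_less_one_of_prime: "prime p \<Longrightarrow> norm (t::complex) < 1 / real p \<Longrightarrow> norm t < 1"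
  using prime_ge_2_nat[of p] by (smt (verit) divide_le_eq_1 of_nat_1 of_nat_le_iff one_le_numeral order_trans)

lemma admissible_norm_less_one: "admissible xs \<Longrightarrow> (p, t) \<in> set xs \<Longrightarrow> norm t < 1"
  unfolding admissible_def using norm_less_one_of_prime by fastforce

lemma summable_power_bounded:
  fixes t :: complex and c :: "nat \<Rightarrow> complex"
  assumes "norm t < 1" "\<And>j. norm (c j) \<le> C"
  shows "summable (\<lambda>j. t ^ j * c j)"
proof (rule summable_comparison_test')
  show "summable (\<lambda>j. norm t ^ j * C)"
    using assms(1) by (intro summable_mult2 summable_geometric) simp
  show "norm (t ^ j * c j) \<le> norm t ^ j * C" for j
    by (simp add: norm_mult norm_power mult_left_mono assms(2))
qed

lemma euler_sum_bounded:
  assumes "\<And>n. norm (f n) \<le> K" "\<And>p t. (p, t) \<in> set xs \<Longrightarrow> norm t < 1"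
  shows "\<exists>C. \<forall>n. norm (euler_sum f xs n) \<le> C"
  using assms(2)
proof (induction xs)
  case Nil then show ?case using assms(1) by auto
next
  case (Cons a xs)
  obtain p t where a: "a = (p, t)" by force
  then obtain C where C: "\<And>n. norm (euler_sum f xs n) \<le> C" using Cons by auto
  have t: "norm t < 1" using Cons.prems a by auto
  have "norm (euler_sum f (a # xs) n) \<le> (\<Sum>j. norm t ^ j * C)" for n
  proof -
    have "norm (t ^ j * euler_sum f xs (p ^ j * n)) \<le> norm t ^ j * C" for j
      by (simp add: norm_mult norm_power mult_left_mono C)
    then show ?thesis unfolding a using t
      by (auto intro!: norm_suminf_le summable_mult2 summable_geometric)
  qed
  then show ?case by blast
qed

lemma euler_sum_cong_mod:
  assumes "\<And>m n. [m = n] (mod M) \<Longrightarrow> f m = f n" "[m = n] (mod M)"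
  shows "euler_sum f xs m = euler_sum f xs n"
  using assms(2)
proof (induction xs arbitrary: m n)
  case (Cons a xs)
  obtain p t where a: "a = (p, t)" by force
  have "euler_sum f xs (p ^ j * m) = euler_sum f xs (p ^ j * n)" for j
    using Cons by (intro Cons.IH cong_scalar_left)
  then show ?case by (simp add: a)
qed (use assms in auto)

lemma powser_coeff_zero:
  fixes a :: "nat \<Rightarrow> complex"
  assumes r: "r > 0" and s: "\<And>x. norm x < r \<Longrightarrow> (\<lambda>n. a n * x ^ n) sums 0"
  shows "a n = 0"
proof (rule ccontr)
  assume n: "a n \<noteq> 0"
  have "n > 0"
  proof (rule ccontr)
    assume "\<not> n > 0"
    moreover have "(\<lambda>n. a n * 0 ^ n) sums 0" using s[of 0] r by simp
    then have "a 0 = 0" by (simp only: powser_sums_zero_iff)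
    ultimately show False using n by simp
  qed
  show False
  proof (rule powser_0_nonzero[of r 0 a "\<lambda>_. 0" n])
    fix e :: real assume e: "0 < e" "\<And>z::complex. z \<in> cball 0 e - {0} \<Longrightarrow> (0::complex) \<noteq> 0"
    have "complex_of_real e \<in> cball 0 e - {0}" using e(1) by auto
    then show False using e(2) by blast
  qed (use r s n \<open>n > 0\<close> in auto)
qed

lemma sum_cis_multiples:
  fixes N :: nat and a :: int
  assumes N: "N > 0"
  shows "(\<Sum>n<N. cis (2 * pi * real n * real_of_int a / real N)) = (if int N dvd a then of_nat N else 0)"
proof -
  define w where "w = cis (2 * pi * real_of_int a / real N)"
  have pw: "cis (2 * pi * real n * real_of_int a / real N) = w ^ n" for n
    unfolding w_def Complex.DeMoivre by (rule arg_cong[where f = cis]) (simp add: field_simps)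
  have wN: "w ^ N = 1"
  proof -
    have "real N * (2 * pi * real_of_int a / real N) = 2 * pi * real_of_int a" using N by simp
    then show ?thesis unfolding w_def Complex.DeMoivre by (metis Ints_of_int cis_multiple_2pi)
  qed
  show ?thesis
  proof (cases "int N dvd a")
    case True
    then obtain k where k: "a = int N * k" by blast
    have "2 * pi * real_of_int a / real N = 2 * pi * real_of_int k" using N by (simp add: k)
    then have "w = 1" unfolding w_def by (metis Ints_of_int cis_multiple_2pi)
    then show ?thesis using True by (simp add: pw)
  next
    case False
    have "w \<noteq> 1"
    proof
      assume "w = 1"
      then have "cos (2 * pi * real_of_int a / real N) = 1" by (simp add: w_def complex_eq_iff)
      then obtain k :: int where "2 * pi * real_of_int a / real N = real_of_int k * 2 * pi"
        using cos_one_2pi_int by (auto simp: mult_ac)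
      then have "real_of_int a = real_of_int k * real N" using N by (simp add: field_simps)
      then have "a = k * int N" by (metis of_int_eq_iff of_int_mult of_int_of_nat_eq)
      then show False using False by simp
    qed
    then show ?thesis using False by (simp add: pw geometric_sum wN)
  qed
qed

lemma sum_cos_multiples:
  fixes N :: nat and a :: int
  assumes N: "N > 0"
  shows "(\<Sum>n<N. cos (2 * pi * real n * real_of_int a / real N)) = (if int N dvd a then real N else 0)"
proof -
  have "(\<Sum>n<N. cos (2 * pi * real n * real_of_int a / real N)) =
    Re (\<Sum>n<N. cis (2 * pi * real n * real_of_int a / real N))" by simp
  then show ?thesis unfolding sum_cis_multiples[OF N] by simp
qed

text \<open>Discrete Fourier inversion. It splits the dependence on the exponent in
  \<open>u ^ k\<close> into components on which an Euler factor acts by multiplication.\<close>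

lemma periodic_eq_sum_roots_of_unity:
  fixes B :: "nat \<Rightarrow> complex"
  assumes m: "m > 0" and per: "\<And>k. B (k mod m) = B k"
  shows "\<exists>b. \<forall>k. B k = (\<Sum>r<m. b r * cis (2 * pi * real r / real m) ^ k)"
proof (intro exI allI)
  fix k
  let ?b = "\<lambda>r. (1 / of_nat m) * (\<Sum>l<m. B l * cis (- 2 * pi * real r * real l / real m))"
  have cis_shift: "cis (- 2 * pi * real r * real l / real m) * cis (2 * pi * real r / real m) ^ k
    = cis (2 * pi * real r * real_of_int (int k - int l) / real m)" for r l
    unfolding Complex.DeMoivre cis_mult using m by (intro arg_cong[where f = cis]) (simp add: field_simps)
  have "(\<Sum>r<m. ?b r * cis (2 * pi * real r / real m) ^ k)
    = (1 / of_nat m) * (\<Sum>r<m. \<Sum>l<m. B l * cis (2 * pi * real r * real_of_int (int k - int l) / real m))"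
  proof -
    have "(\<Sum>l<m. B l * cis (- 2 * pi * real r * real l / real m)) * cis (2 * pi * real r / real m) ^ k
      = (\<Sum>l<m. B l * cis (2 * pi * real r * real_of_int (int k - int l) / real m))" for r
      unfolding sum_distrib_right by (intro sum.cong refl) (subst mult.assoc, subst cis_shift, rule refl)
    then have "?b r * cis (2 * pi * real r / real m) ^ k
      = (1 / of_nat m) * (\<Sum>l<m. B l * cis (2 * pi * real r * real_of_int (int k - int l) / real m))" for r
      by (subst mult.assoc) simp
    then show ?thesis by (simp only: sum_distrib_left)
  qed
  also have "(\<Sum>r<m. \<Sum>l<m. B l * cis (2 * pi * real r * real_of_int (int k - int l) / real m))
    = (\<Sum>l<m. B l * (\<Sum>r<m. cis (2 * pi * real r * real_of_int (int k - int l) / real m)))"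
    by (subst sum.swap) (simp add: sum_distrib_left)
  also have "\<dots> = (\<Sum>l<m. B l * (if int m dvd int k - int l then of_nat m else 0))"
    by (simp only: sum_cis_multiples[OF m])
  also have "\<dots> = (\<Sum>l<m. if l = k mod m then B l * of_nat m else 0)"
  proof (rule sum.cong)
    fix l assume "l \<in> {..<m}"
    then have "int m dvd int k - int l \<longleftrightarrow> l = k mod m"
      by (metis cong_iff_dvd_diff cong_int_iff cong_def lessThan_iff mod_less)
    then show "B l * (if int m dvd int k - int l then of_nat m else 0) = (if l = k mod m then B l * of_nat m else 0)"
      by simp
  qed simp
  also have "\<dots> = B k * of_nat m" using m per by (simp add: sum.delta)
  finally show "B k = (\<Sum>r<m. ?b r * cis (2 * pi * real r / real m) ^ k)" using m by simp
qed

text \<open>A root \<open>(G / G 0) powr (1 / A)\<close> exists on the disc and is bounded by \<open>exp 1\<close> there, so Cauchy's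
  estimate bounds its derivatives at the origin independently of \<open>A\<close>.\<close>
lemma log_derivative_second_bound:
  fixes G G1 :: "complex \<Rightarrow> complex"
  assumes nz: "\<And>w. w \<in> ball 0 1 \<Longrightarrow> G w \<noteq> 0"
    and d1: "\<And>w. w \<in> ball 0 1 \<Longrightarrow> (G has_field_derivative G1 w) (at w)"
    and d2: "(G1 has_field_derivative G2) (at 0)"
    and A: "A > 0" and bound: "\<And>w. w \<in> ball 0 1 \<Longrightarrow> norm (G w) \<le> norm (G 0) * exp A"
  shows "norm (G2 / G 0 - (G1 0 / G 0)\<^sup>2) \<le> 60 * A"
proof -
  have hol: "G holomorphic_on ball 0 1"
    unfolding holomorphic_on_open[OF open_ball] using d1 by blast
  obtain L where L: "L holomorphic_on ball 0 1" "\<And>z. z \<in> ball 0 1 \<Longrightarrow> G z = exp (L z)"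
    using contractible_imp_holomorphic_log[OF hol] nz convex_imp_contractible[of "ball (0::complex) 1"] by auto
  define H where "H = (\<lambda>w. exp ((L w - L 0) / of_real A))"
  have Ld: "(L has_field_derivative G1 w / G w) (at w)" if w: "w \<in> ball 0 1" for w
  proof -
    have Lw: "(L has_field_derivative deriv L w) (at w)"
      using L(1) w by (simp add: holomorphic_derivI)
    have "((\<lambda>z. exp (L z)) has_field_derivative exp (L w) * deriv L w) (at w)"
      by (rule derivative_eq_intros Lw refl | simp)+
    then have "(G has_field_derivative exp (L w) * deriv L w) (at w)"
      by (rule has_field_derivative_transform_within_open[OF _ open_ball w]) (simp add: L(2))
    then have "exp (L w) * deriv L w = G1 w" using d1[OF w] DERIV_unique by blast
    then have "deriv L w = G1 w / G w" using L(2)[OF w] by (simp add: field_simps)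
    with Lw show ?thesis by simp
  qed
  have Hd: "(H has_field_derivative H w * (G1 w / G w) / of_real A) (at w)" if "w \<in> ball 0 1" for w
    unfolding H_def using A by (auto intro!: derivative_eq_intros Ld that)
  have H0: "H 0 = 1" by (simp add: H_def)
  have H2: "((\<lambda>w. H w * (G1 w / G w) / of_real A) has_field_derivative
      ((G1 0 / G 0)\<^sup>2 / of_real A + (G2 / G 0 - (G1 0 / G 0)\<^sup>2)) / of_real A) (at 0)"
    using nz[of 0] A
    by (auto intro!: derivative_eq_intros Hd d1 d2 simp: H0 field_simps power2_eq_square)
  have dH: "deriv H w = H w * (G1 w / G w) / of_real A" if "w \<in> ball 0 1" for w
    using Hd[OF that] by (rule DERIV_imp_deriv)
  have ddH: "deriv (deriv H) 0 = ((G1 0 / G 0)\<^sup>2 / of_real A + (G2 / G 0 - (G1 0 / G 0)\<^sup>2)) / of_real A"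
    by (rule DERIV_imp_deriv, rule has_field_derivative_transform_within_open[OF H2 open_ball[of 0 1]])
      (simp_all add: dH)
  have holH: "H holomorphic_on ball 0 1" unfolding holomorphic_on_open[OF open_ball] using Hd by blast
  have Hb: "norm (H w) \<le> 3" if w: "w \<in> ball 0 1" for w
  proof -
    have "norm (G w) = exp (Re (L w))" "norm (G 0) = exp (Re (L 0))"
      using L(2)[OF w] L(2)[of 0] by simp_all
    then have "exp (Re (L w)) \<le> exp (Re (L 0) + A)" using bound[OF w] by (simp add: exp_add)
    then have "(Re (L w) - Re (L 0)) / A \<le> 1" using A by (simp add: field_simps)
    moreover have "norm (H w) = exp ((Re (L w) - Re (L 0)) / A)"
      by (simp add: H_def)
    ultimately have "norm (H w) \<le> exp 1" by simp
    then show ?thesis using exp_le by linarith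
  qed
  have hb: "H holomorphic_on ball 0 (1/2)" "continuous_on (cball 0 (1/2)) H"
    using holH by (auto intro: holomorphic_on_subset intro!: holomorphic_on_imp_continuous_on)
  \<comment> \<open>Cauchy's estimate on the circle of radius \<open>1 / 2\<close>, where
    \<open>H\<close> is bounded by 3. It gives 6 and 24 for the first two derivatives, and
    \<open>60 = 24 + 6 ^ 2\<close>.\<close>
  have C: "norm ((deriv ^^ n) H 0) \<le> fact n * 3 / (1/2) ^ n" for n
    by (rule Cauchy_inequality[OF hb]) (auto intro!: Hb)
  have c1: "norm ((G1 0 / G 0) / of_real A) \<le> 6" using C[of 1] dH[of 0] H0 by simp
  have c2: "norm (deriv (deriv H) 0) \<le> 24" using C[of 2] by (simp add: numeral_2_eq_2 power2_eq_square)
  \<comment> \<open>Both sides are the second derivative of \<open>log G\<close> at 0, since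
    \<open>log G\<close> and \<open>A * log H\<close> differ by a constant and
    \<open>H 0 = 1\<close>.\<close>
  have "(G2 / G 0 - (G1 0 / G 0)\<^sup>2) = of_real A * (deriv (deriv H) 0 - ((G1 0 / G 0) / of_real A)\<^sup>2)"
    unfolding ddH using A by (simp add: field_simps power2_eq_square)
  also have "norm \<dots> \<le> A * (24 + 6\<^sup>2)"
    unfolding norm_mult using A
    by (intro mult_mono order_trans[OF norm_triangle_ineq4] add_mono c2)
      (auto simp only: norm_power norm_of_real intro!: power_mono c1 norm_ge_zero)
  finally show ?thesis by simp
qed

lemma prod_inverse_linear_derivative:
  fixes a :: "'a \<Rightarrow> complex"
  assumes "finite T" "\<And>p. p \<in> T \<Longrightarrow> a p * w \<noteq> 1"
  shows "((\<lambda>w. \<Prod>p\<in>T. 1 / (1 - a p * w)) has_field_derivative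
    (\<Prod>p\<in>T. 1 / (1 - a p * w)) * (\<Sum>p\<in>T. a p / (1 - a p * w))) (at w)"
  using assms
proof (induction T)
  case (insert x T)
  have ne: "1 - a x * w \<noteq> 0" using insert.prems[of x] by auto
  have "((\<lambda>w. 1 / (1 - a x * w)) has_field_derivative (1 / (1 - a x * w)) * (a x / (1 - a x * w))) (at w)"
    using ne by (auto intro!: derivative_eq_intros simp: field_simps)
  from DERIV_mult[OF this insert.IH] show ?case
    using insert by (simp add: algebra_simps)
qed auto

text \<open>The logarithmic derivative of each product is the sum of \<open>a / (1 - a * w)\<close>,
  whose own derivative at 0 is the sum of the \<open>a ^ 2\<close>; the product rule yields the two
  terms of the second derivative.\<close>

lemma sum_prod_inverse_linear_derivatives:
  fixes a :: "'b \<Rightarrow> 'a \<Rightarrow> complex" and b :: "'b \<Rightarrow> complex"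
  assumes "finite T" "finite I" "\<And>r p. p \<in> T \<Longrightarrow> norm (a r p) < 1"
  defines "G \<equiv> \<lambda>w. \<Sum>r\<in>I. b r * (\<Prod>p\<in>T. 1 / (1 - a r p * w))"
    and "G1 \<equiv> \<lambda>w. \<Sum>r\<in>I. b r * ((\<Prod>p\<in>T. 1 / (1 - a r p * w)) * (\<Sum>p\<in>T. a r p / (1 - a r p * w)))"
  shows "w \<in> ball 0 1 \<Longrightarrow> (G has_field_derivative G1 w) (at w)"
    and "(G1 has_field_derivative (\<Sum>r\<in>I. b r * ((\<Sum>p\<in>T. a r p)\<^sup>2 + (\<Sum>p\<in>T. (a r p)\<^sup>2)))) (at 0)"
proof -
  have ne: "a r p * w \<noteq> 1" if "p \<in> T" "w \<in> ball 0 1" for r p w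
  proof
    assume "a r p * w = 1"
    then have "norm (a r p) * norm w = 1" by (metis norm_mult norm_one)
    moreover have "norm (a r p) * norm w < 1 * 1"
      using that assms(3)[of p r] by (intro mult_strict_mono') auto
    ultimately show False by simp
  qed
  show "(G has_field_derivative G1 w) (at w)" if "w \<in> ball 0 1" for w
    unfolding G_def G1_def
    by (intro DERIV_sum DERIV_cmult prod_inverse_linear_derivative assms ne that)
  have s: "((\<lambda>w. \<Sum>p\<in>T. a r p / (1 - a r p * w)) has_field_derivative (\<Sum>p\<in>T. (a r p)\<^sup>2)) (at 0)" for r
    by (intro DERIV_sum) (auto intro!: derivative_eq_intros simp: power2_eq_square)
  have "((\<lambda>w. (\<Prod>p\<in>T. 1 / (1 - a r p * w)) * (\<Sum>p\<in>T. a r p / (1 - a r p * w)))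
     has_field_derivative ((\<Sum>p\<in>T. a r p)\<^sup>2 + (\<Sum>p\<in>T. (a r p)\<^sup>2))) (at 0)" for r
    using DERIV_mult[OF prod_inverse_linear_derivative[OF assms(1), of "a r" 0] s[of r]]
    by (simp add: power2_eq_square)
  then show "(G1 has_field_derivative (\<Sum>r\<in>I. b r * ((\<Sum>p\<in>T. a r p)\<^sup>2 + (\<Sum>p\<in>T. (a r p)\<^sup>2)))) (at 0)"
    unfolding G1_def by (intro DERIV_sum DERIV_cmult)
qed

section \<open>Nonvanishing periodic functions are multiplicative\<close>

text \<open>The setting of a Gleason--Kahane--Zelazko argument: the functional given by
  \<open>f\<close> vanishes at no completely multiplicative weight. Only finitely many primes carry
  a parameter at a time, so all sums are iterated power series.\<close>

locale nonvanishing_periodic =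
  fixes f :: "nat \<Rightarrow> complex" and M :: nat
  assumes M: "M > 0"
    and per: "\<And>m n. [m = n] (mod M) \<Longrightarrow> f m = f n"
    and nonzero: "\<And>xs. admissible xs \<Longrightarrow> euler_sum f xs 1 \<noteq> 0"
begin

lemma euler_sum_cong: "[m = n] (mod M) \<Longrightarrow> euler_sum f xs m = euler_sum f xs n"
  using per by (rule euler_sum_cong_mod)

lemma euler_sum_bounded_locale: "\<exists>C. \<forall>n. norm (euler_sum f xs n) \<le> C" if "admissible xs"
proof -
  have "norm (f n) \<le> Max ((\<lambda>n. norm (f n)) ` {..<M})" for n
  proof -
    have "f n = f (n mod M)" by (rule per) (simp add: cong_def)
    then show ?thesis using M by (auto intro!: Max_ge)
  qed
  then show ?thesis using euler_sum_bounded admissible_norm_less_one[OF that] by blast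
qed

text \<open>\<open>Q\<close> holds the primes already used by a parameter list. Where this fails,
  the primes of the class outside some finite \<open>Q\<close> have bounded reciprocal sums; this
  dichotomy stands in for knowledge of primes in progressions.\<close>

definition rich :: "nat \<Rightarrow> bool" where
  "rich u \<longleftrightarrow> (\<forall>Q s. finite Q \<longrightarrow> (\<exists>T. finite T \<and> T \<inter> Q = {} \<and>
     (\<forall>p\<in>T. prime p \<and> [p = u] (mod M)) \<and> s \<le> (\<Sum>p\<in>T. 1 / real p)))"

lemma richD:
  assumes "rich u" "finite Q"
  obtains T where "finite T" "T \<inter> Q = {}" "\<And>p. p \<in> T \<Longrightarrow> prime p \<and> [p = u] (mod M)"
    "s \<le> (\<Sum>p\<in>T. 1 / real p)"
proof -
  have "\<exists>T. finite T \<and> T \<inter> Q = {} \<and> (\<forall>p\<in>T. prime p \<and> [p = u] (mod M)) \<and> s \<le> (\<Sum>p\<in>T. 1 / real p)"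
    using assms unfolding rich_def by simp
  then show thesis by (elim exE conjE) (rule that, auto)
qed

text \<open>Modulo \<open>M\<close> each prime of \<open>ps\<close> equals \<open>u\<close>, so its
  \<open>j\<close>-th power only raises the exponent \<open>k\<close> by \<open>j\<close>; on the
  component \<open>\<zeta> r ^ k\<close> the sum over \<open>j\<close> is geometric.\<close>

lemma euler_sum_append_class:
  assumes "distinct ps" "\<And>p. p \<in> set ps \<Longrightarrow> prime p \<and> [p = u] (mod M)" "norm w < 1"
    and b: "\<And>k. euler_sum f xs (u ^ k) = (\<Sum>r<m. b r * \<zeta> r ^ k)" and z: "\<And>r. norm (\<zeta> r) = 1"
  shows "euler_sum f (map (\<lambda>p. (p, w / of_nat p)) ps @ xs) (u ^ k) =
    (\<Sum>r<m. b r * \<zeta> r ^ k * (\<Prod>p\<in>set ps. 1 / (1 - (\<zeta> r / of_nat p) * w)))"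
  using assms(1,2)
proof (induction ps arbitrary: k)
  case Nil then show ?case by (simp add: b)
next
  case (Cons p ps)
  define P where "P = (\<lambda>r. \<Prod>p\<in>set ps. 1 / (1 - (\<zeta> r / of_nat p) * w))"
  have p: "prime p" "[p = u] (mod M)" using Cons.prems by auto
  have p2: "real p \<ge> 1" using prime_ge_1_nat[OF p(1)] by simp
  have "(\<lambda>j. \<Sum>r<m. (b r * \<zeta> r ^ k * P r) * (\<zeta> r / of_nat p * w) ^ j) sums
    (\<Sum>r<m. (b r * \<zeta> r ^ k * P r) * (1 / (1 - \<zeta> r / of_nat p * w)))"
  proof (intro sums_sum sums_mult geometric_sums)
    fix r
    have "norm (\<zeta> r / of_nat p * w) = norm w / real p" by (simp add: norm_mult norm_divide z)
    also have "\<dots> \<le> norm w" using p2 by (simp add: divide_le_eq mult_le_cancel_left1)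
    finally show "norm (\<zeta> r / of_nat p * w) < 1" using assms(3) by simp
  qed
  moreover have "(w / of_nat p) ^ j * euler_sum f (map (\<lambda>p. (p, w / of_nat p)) ps @ xs) (p ^ j * u ^ k)
    = (\<Sum>r<m. (b r * \<zeta> r ^ k * P r) * (\<zeta> r / of_nat p * w) ^ j)" for j
  proof -
    have "[p ^ j * u ^ k = u ^ j * u ^ k] (mod M)" using p(2) by (intro cong_mult cong_pow) auto
    then have "euler_sum f (map (\<lambda>p. (p, w / of_nat p)) ps @ xs) (p ^ j * u ^ k)
      = euler_sum f (map (\<lambda>p. (p, w / of_nat p)) ps @ xs) (u ^ (j + k))"
      by (subst power_add) (rule euler_sum_cong)
    also have "\<dots> = (\<Sum>r<m. b r * \<zeta> r ^ (j + k) * P r)"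
      unfolding P_def using Cons.prems by (intro Cons.IH) auto
    finally show ?thesis
      by (simp add: sum_distrib_left power_add power_mult_distrib power_divide mult_ac)
  qed
  ultimately have "euler_sum f (map (\<lambda>p. (p, w / of_nat p)) (p # ps) @ xs) (u ^ k)
     = (\<Sum>r<m. (b r * \<zeta> r ^ k * P r) * (1 / (1 - \<zeta> r / of_nat p * w)))"
    by (simp add: sums_iff)
  then show ?case using Cons.prems by (simp add: P_def mult_ac)
qed

lemma prod_inverse_linear_norm_le:
  fixes w \<zeta> :: complex
  assumes "finite T" "\<And>p. p \<in> T \<Longrightarrow> prime p" "norm w < 1" "norm \<zeta> = 1"
  shows "norm (\<Prod>p\<in>T. 1 / (1 - (\<zeta> / of_nat p) * w)) \<le> exp (2 * (\<Sum>p\<in>T. 1 / real p))"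
proof -
  have "norm (1 / (1 - (\<zeta> / of_nat p) * w)) \<le> exp (2 * (1 / real p))" if "p \<in> T" for p
  proof -
    define x where "x = 1 / real p"
    have x: "0 < x" "x \<le> 1 / 2"
      using prime_ge_2_nat[OF assms(2)[OF that]] by (auto simp: x_def field_simps)
    have "norm ((\<zeta> / of_nat p) * w) = x * norm w"
      by (simp add: norm_mult norm_divide assms(4) x_def)
    also have "\<dots> \<le> x" using x assms(3) by (simp add: mult_le_cancel_left1)
    finally have le: "1 - x \<le> norm (1 - (\<zeta> / of_nat p) * w)"
      using norm_triangle_ineq2[of 1 "(\<zeta> / of_nat p) * w"] by simp
    \<comment> \<open>The product is \<open>1 + x * (1 - 2 * x)\<close>, so
      \<open>x \<le> 1 / 2\<close> enters here. Each factor is then at most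
      \<open>1 + 2 * x \<le> exp (2 * x)\<close>.\<close>
    have "1 \<le> (1 - x) * (1 + 2 * x)" using x by (simp add: field_simps power2_eq_square)
    also have "\<dots> \<le> norm (1 - (\<zeta> / of_nat p) * w) * exp (2 * x)"
      using le x exp_ge_add_one_self[of "2 * x"] by (intro mult_mono) auto
    finally show ?thesis
      using le x unfolding x_def[symmetric] norm_divide by (simp add: divide_le_eq mult_ac)
  qed
  then have "(\<Prod>p\<in>T. norm (1 / (1 - (\<zeta> / of_nat p) * w))) \<le> (\<Prod>p\<in>T. exp (2 * (1 / real p)))"
    by (intro prod_mono) auto
  then show ?thesis using assms(1) by (simp add: prod_norm exp_sum sum_distrib_left)
qed

lemma euler_sum_power_periodic:
  assumes "coprime u M"
  shows "euler_sum f xs (u ^ (k mod totient M)) = euler_sum f xs (u ^ k)"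
proof (rule euler_sum_cong)
  have "u ^ k = (u ^ totient M) ^ (k div totient M) * u ^ (k mod totient M)"
    by (simp flip: power_mult power_add)
  moreover have "[(u ^ totient M) ^ (k div totient M) * u ^ (k mod totient M) = 1 ^ (k div totient M) * u ^ (k mod totient M)] (mod M)"
    using assms by (intro cong_mult cong_pow euler_theorem) auto
  ultimately show "[u ^ (k mod totient M) = u ^ k] (mod M)" by (simp add: cong_sym)
qed

text \<open>Put the same variable \<open>w\<close> at all primes of a finite set \<open>T\<close> in the class of \<open>u\<close>. The resulting
  function has no zeros on the disc and grows like \<open>exp (2 S)\<close> with \<open>S\<close> the sum of the \<open>1 / p\<close>, so the second
  coefficient of its logarithm is \<open>O(S)\<close>; but it equals \<open>S\<^sup>2 / 2\<close> times the defect of the relation, up to \<open>O(S)\<close>.\<close>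
lemma square_relation:
  assumes u: "coprime u M" "rich u" and xs: "admissible xs"
  shows "euler_sum f xs (u ^ 2) * euler_sum f xs 1 = (euler_sum f xs u)\<^sup>2"
proof -
  define m where "m = totient M"
  define B where "B = (\<lambda>k. euler_sum f xs (u ^ k))"
  define \<zeta> where "\<zeta> = (\<lambda>r. cis (2 * pi * real r / real m))"
  have "m > 0" using M by (simp add: m_def)
  moreover have "B (k mod m) = B k" for k
    unfolding B_def m_def by (rule euler_sum_power_periodic[OF u(1)])
  ultimately obtain b where b: "\<And>k. B k = (\<Sum>r<m. b r * \<zeta> r ^ k)"
    unfolding \<zeta>_def using periodic_eq_sum_roots_of_unity by blast
  have z: "norm (\<zeta> r) = 1" for r by (simp add: \<zeta>_def)
  have B0: "B 0 \<noteq> 0" using nonzero[OF xs] by (simp add: B_def)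
  define Cb where "Cb = (\<Sum>r<m. norm (b r))"
  have Cb: "norm (B 0) \<le> Cb" unfolding b[of 0] Cb_def by (simp add: norm_sum)
  define C0 where "C0 = ln (Cb / norm (B 0))"
  have "Cb > 0" using Cb B0 by (meson less_le_trans zero_less_norm_iff)
  then have C0: "C0 \<ge> 0" "exp C0 * norm (B 0) = Cb"
    using Cb B0 by (auto simp: C0_def ln_ge_zero_iff exp_ln)
  \<comment> \<open>\<open>D\<close> is the defect of the relation divided by
    \<open>(B 0)\<^sup>2\<close>. The constant \<open>C1\<close> collects all terms of order
    \<open>S\<close>: for \<open>S \<ge> 1\<close>,
    \<open>60 * (C0 + 2 * S) + S * norm (B 2 / B 0) \<le> S * C1\<close>.\<close>
  define D where "D = B 2 / B 0 - (B 1 / B 0)\<^sup>2"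
  define C1 where "C1 = 120 + 60 * C0 + norm (B 2 / B 0)"
  have main: "\<exists>S\<ge>s. S * norm D \<le> C1" if s: "s \<ge> 1" for s :: real
  proof -
    obtain T where T: "finite T" "T \<inter> fst ` set xs = {}"
      "\<And>p. p \<in> T \<Longrightarrow> prime p \<and> [p = u] (mod M)" "s \<le> (\<Sum>p\<in>T. 1 / real p)"
      using richD[OF u(2), of "fst ` set xs" s] by auto
    define S where "S = (\<Sum>p\<in>T. 1 / real p)"
    define S2 where "S2 = (\<Sum>p\<in>T. (1 / real p)\<^sup>2)"
    have S: "S \<ge> 1" using T(4) s by (simp add: S_def)
    have S2: "0 \<le> S2" "S2 \<le> S"
    proof -
      show "0 \<le> S2" unfolding S2_def by (rule sum_nonneg) auto
      show "S2 \<le> S" unfolding S2_def S_def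
      proof (rule sum_mono)
        fix p assume "p \<in> T"
        then have "1 / real p \<le> 1" using prime_ge_1_nat[of p] T(3) by auto
        then show "(1 / real p)\<^sup>2 \<le> 1 / real p"
          using mult_right_mono[of "1 / real p" 1 "1 / real p"] by (simp add: power2_eq_square)
      qed
    qed
    define a where "a = (\<lambda>r (p::nat). \<zeta> r / of_nat p)"
    define G where "G = (\<lambda>w. \<Sum>r<m. b r * (\<Prod>p\<in>T. 1 / (1 - a r p * w)))"
    define G1 where "G1 = (\<lambda>w. \<Sum>r<m. b r * ((\<Prod>p\<in>T. 1 / (1 - a r p * w)) * (\<Sum>p\<in>T. a r p / (1 - a r p * w))))"
    define G2 where "G2 = (\<Sum>r<m. b r * ((\<Sum>p\<in>T. a r p)\<^sup>2 + (\<Sum>p\<in>T. (a r p)\<^sup>2)))"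
    have a1: "norm (a r p) < 1" if "p \<in> T" for r p
      using T(3)[OF that] prime_gt_1_nat[of p] by (auto simp: a_def norm_divide z divide_less_eq)
    have G_eq: "G w = euler_sum f (map (\<lambda>p. (p, w / of_nat p)) (sorted_list_of_set T) @ xs) 1"
      if "norm w < 1" for w
      using euler_sum_append_class[where ps="sorted_list_of_set T" and u=u and w=w and xs=xs and m=m and b=b and \<zeta>=\<zeta> and k=0]
        T that b z unfolding B_def by (auto simp: G_def a_def)
    have adm: "admissible (map (\<lambda>p. (p, w / of_nat p)) (sorted_list_of_set T) @ xs)" if "norm w < 1" for w
      using xs T that unfolding admissible_def
      by (auto simp: comp_def norm_divide divide_strict_right_mono prime_gt_0_nat)
    have nz: "G w \<noteq> 0" if "w \<in> ball 0 1" for w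
      using nonzero[OF adm[of w]] G_eq[of w] that by simp
    have Sa: "(\<Sum>p\<in>T. a r p) = \<zeta> r * of_real S" "(\<Sum>p\<in>T. (a r p)\<^sup>2) = \<zeta> r ^ 2 * of_real S2" for r
      by (simp_all add: a_def S_def S2_def sum_distrib_left power_divide)
    have G0: "G 0 = B 0" by (simp add: G_def b)
    \<comment> \<open>Multiplying each component by \<open>\<zeta> r\<close> advances
      \<open>B\<close> by one index, so the derivatives of \<open>G\<close> at 0 are multiples of
      \<open>B 1\<close> and \<open>B 2\<close>.\<close>
    have "G1 0 = (\<Sum>r<m. b r * (\<Sum>p\<in>T. a r p))" by (simp add: G1_def)
    also have "\<dots> = of_real S * B 1" by (simp only: Sa) (simp add: b sum_distrib_left mult_ac)
    finally have G10: "G1 0 = of_real S * B 1" .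
    have G20: "G2 = of_real (S\<^sup>2 + S2) * B 2"
      unfolding G2_def Sa
      by (simp add: b sum_distrib_left sum_distrib_right power_mult_distrib algebra_simps)
    have bnd: "norm (G w) \<le> norm (G 0) * exp (C0 + 2 * S)" if "w \<in> ball 0 1" for w
    proof -
      have "norm (G w) \<le> (\<Sum>r<m. norm (b r) * exp (2 * S))"
        unfolding G_def a_def S_def
        by (intro sum_norm_le) (unfold norm_mult, intro mult_left_mono prod_inverse_linear_norm_le,
            use T that z in auto)
      also have "\<dots> = Cb * exp (2 * S)" by (simp add: Cb_def sum_distrib_right)
      also have "\<dots> = norm (G 0) * exp (C0 + 2 * S)" using C0(2) by (simp add: G0 exp_add mult_ac)
      finally show ?thesis .
    qed
    have "norm (G2 / G 0 - (G1 0 / G 0)\<^sup>2) \<le> 60 * (C0 + 2 * S)"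
    proof (rule log_derivative_second_bound[where G = G and ?G1.0 = G1 and ?G2.0 = G2])
      show "(G has_field_derivative G1 w) (at w)" if "w \<in> ball 0 1" for w
        unfolding G_def G1_def
        using sum_prod_inverse_linear_derivatives(1)[where a=a and b=b and T=T and I="{..<m}"] T(1) a1 that by blast
      show "(G1 has_field_derivative G2) (at 0)"
        unfolding G1_def G2_def
        using sum_prod_inverse_linear_derivatives(2)[where a=a and b=b and T=T and I="{..<m}"] T(1) a1 by blast
    qed (use C0 S nz bnd in auto)
    moreover have "G2 / G 0 - (G1 0 / G 0)\<^sup>2 = of_real (S\<^sup>2) * D + of_real S2 * (B 2 / B 0)"
      using B0 by (simp add: G0 G10 G20 D_def field_simps power2_eq_square)
    ultimately have "norm (of_real (S\<^sup>2) * D + of_real S2 * (B 2 / B 0)) \<le> 60 * (C0 + 2 * S)" by simp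
    moreover have "norm (of_real (S\<^sup>2) * D) \<le> norm (of_real (S\<^sup>2) * D + of_real S2 * (B 2 / B 0)) + norm (of_real S2 * (B 2 / B 0))"
      by (metis norm_triangle_ineq4 add_diff_cancel_right')
    moreover have "norm (of_real (S\<^sup>2) * D) = S * (S * norm D)"
      by (simp add: norm_mult norm_power power2_eq_square)
    moreover have "norm (of_real S2 * (B 2 / B 0)) \<le> S * norm (B 2 / B 0)"
      unfolding norm_mult using S2 by (intro mult_right_mono) auto
    ultimately have "S * (S * norm D) \<le> 60 * (C0 + 2 * S) + S * norm (B 2 / B 0)" by linarith
    also have "\<dots> \<le> S * C1" using C0(1) S mult_right_mono[OF S C0(1)] by (simp add: C1_def algebra_simps)
    finally have "S * norm D \<le> C1" using S by simp
    then show ?thesis using T(4) by (auto simp: S_def)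
  qed
  have "D = 0"
  proof (rule ccontr)
    assume D: "D \<noteq> 0"
    define s where "s = max 1 (C1 / norm D + 1)"
    obtain S where S: "S \<ge> s" "S * norm D \<le> C1" using main[of s] by (auto simp: s_def)
    have "C1 / norm D + 1 \<le> S" using S(1) by (simp add: s_def)
    then have "(C1 / norm D + 1) * norm D \<le> S * norm D" by (intro mult_right_mono) auto
    moreover have "(C1 / norm D + 1) * norm D = C1 + norm D" using D by (simp add: field_simps)
    moreover have "norm D > 0" using D by simp
    ultimately show False using S(2) by linarith
  qed
  then have "B 2 * B 0 = (B 1)\<^sup>2" using B0 by (simp add: D_def field_simps power2_eq_square)
  then show ?thesis by (simp add: B_def)
qed

text \<open>Inserting one more prime of the class of \<open>u\<close> with parameter \<open>t\<close> turns the square relation into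
  \<open>E 0 * (B 0 - B 1 * t) = (B 0)\<^sup>2\<close>, so the generating series \<open>E 0\<close> of the \<open>B j\<close> is geometric.\<close>
lemma ratio_root_of_unity:
  assumes u: "coprime u M" "rich u" and xs: "admissible xs"
  shows "(euler_sum f xs u / euler_sum f xs 1) ^ totient M = 1"
proof -
  define B where "B = (\<lambda>k. euler_sum f xs (u ^ k))"
  have B0: "B 0 \<noteq> 0" using nonzero[OF xs] by (simp add: B_def)
  obtain T where T: "finite T" "T \<inter> fst ` set xs = {}"
      "\<And>p. p \<in> T \<Longrightarrow> prime p \<and> [p = u] (mod M)" "1 \<le> (\<Sum>p\<in>T. 1 / real p)"
    using richD[OF u(2), of "fst ` set xs" 1] by auto
  then obtain p where "p \<in> T" by fastforce
  then have p: "prime p" "[p = u] (mod M)" "p \<notin> fst ` set xs" using T by auto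
  obtain C where C: "\<And>n. norm (euler_sum f xs n) \<le> C" using euler_sum_bounded_locale[OF xs] by blast
  \<comment> \<open>The series is the expansion in \<open>t\<close> of
    \<open>B 0 * E 0 - B 1 * t * E 0 - (B 0)\<^sup>2\<close>, whose coefficient at
    \<open>j = 0\<close> cancels.\<close>
  have rel: "(\<lambda>j. (if j = 0 then 0 else B 0 * B j - B 1 * B (j - 1)) * t ^ j) sums 0"
    if t: "norm t < 1 / real p" for t
  proof -
    have t1: "norm t < 1" using norm_less_one_of_prime[OF p(1) t] .
    have adm: "admissible ((p, t) # xs)" using p t xs by (simp add: admissible_Cons)
    define E where "E = (\<lambda>k. \<Sum>j. t ^ j * B (j + k))"
    have sm: "summable (\<lambda>j. t ^ j * B (j + k))" for k
      by (rule summable_power_bounded[OF t1, where C = C]) (simp add: B_def C)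
    have E: "euler_sum f ((p, t) # xs) (u ^ k) = E k" for k
    proof -
      have "euler_sum f xs (p ^ j * u ^ k) = B (j + k)" for j
        unfolding B_def power_add using p(2) by (intro euler_sum_cong cong_mult cong_pow) auto
      then show ?thesis by (simp add: E_def)
    qed
    have step: "E k = B k + t * E (Suc k)" for k
    proof -
      have "E k = t ^ 0 * B (0 + k) + (\<Sum>j. t ^ Suc j * B (Suc j + k))"
        using suminf_split_head[OF sm[of k]] by (simp add: E_def)
      also have "(\<Sum>j. t ^ Suc j * B (Suc j + k)) = t * E (Suc k)"
        unfolding E_def by (subst suminf_mult[OF sm, symmetric]) (simp add: mult_ac)
      finally show ?thesis by simp
    qed
    have "E 2 * E 0 = (E 1)\<^sup>2"
      using square_relation[OF u adm] E[of 2] E[of 1] E[of 0] by simp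
    moreover have "E 0 = B 0 + t * E 1" "E 1 = B 1 + t * E 2"
      using step[of 0] step[of 1] by (simp_all add: numeral_2_eq_2)
    ultimately have "t\<^sup>2 * E 2 * E 0 = (t * E 1)\<^sup>2" "t * E 1 = E 0 - B 0" "t\<^sup>2 * E 2 = E 0 - B 0 - B 1 * t"
      by (simp_all add: power2_eq_square algebra_simps)
    then have "(E 0 - B 0 - B 1 * t) * E 0 = (E 0 - B 0)\<^sup>2" by simp
    then have rel: "E 0 * (B 0 - B 1 * t) = (B 0)\<^sup>2"
      by (simp add: power2_eq_square algebra_simps)
    have s0: "(\<lambda>j. t ^ j * B j) sums E 0" using summable_sums[OF sm[of 0]] by (simp add: E_def)
    have s1: "(\<lambda>j. (if j = 0 then 0 else B (j - 1)) * t ^ j) sums (t * E 0)"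
    proof -
      have "(\<lambda>j. (\<lambda>j. (if j = 0 then 0 else B (j - 1)) * t ^ j) (Suc j)) sums (t * E 0)"
        using sums_mult[OF s0, of t] by (simp add: mult_ac)
      from this[THEN sums_Suc] show ?thesis by simp
    qed
    have "(\<lambda>j. B 0 * (t ^ j * B j) - B 1 * ((if j = 0 then 0 else B (j - 1)) * t ^ j)
        - (if j = 0 then (B 0)\<^sup>2 else 0)) sums (B 0 * E 0 - B 1 * (t * E 0) - (B 0)\<^sup>2)"
      by (intro sums_diff sums_mult s0 s1 sums_single[where i=0, THEN sums_cong[THEN iffD1, rotated]]) auto
    also have "B 0 * E 0 - B 1 * (t * E 0) - (B 0)\<^sup>2 = 0" using rel by (simp add: algebra_simps)
    also have "(\<lambda>j. B 0 * (t ^ j * B j) - B 1 * ((if j = 0 then 0 else B (j - 1)) * t ^ j)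
        - (if j = 0 then (B 0)\<^sup>2 else 0)) = (\<lambda>j. (if j = 0 then 0 else B 0 * B j - B 1 * B (j - 1)) * t ^ j)"
      by (auto simp: fun_eq_iff power2_eq_square algebra_simps)
    finally show ?thesis .
  qed
  have "(if j = 0 then 0 else B 0 * B j - B 1 * B (j - 1)) = 0" for j
    by (rule powser_coeff_zero[of "1 / real p", OF _ rel]) (use p in \<open>auto simp: prime_gt_0_nat\<close>)
  then have coeff: "B 0 * B (Suc j) = B 1 * B j" for j
    by (metis diff_Suc_1 nat.distinct(1) right_minus_eq)
  define r where "r = B 1 / B 0"
  have rec: "B (Suc j) = r * B j" for j using coeff[of j] B0 by (simp add: r_def field_simps)
  have "B j = r ^ j * B 0" for j
    by (induction j) (simp_all only: rec power_0 power_Suc mult_1 mult.assoc)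
  moreover have "B (totient M) = B 0"
    using euler_sum_power_periodic[OF u(1), of xs "totient M"] by (simp add: B_def)
  ultimately have "r ^ totient M = 1" using B0 by (metis mult_cancel_right2)
  then have "(B 1 / B 0) ^ totient M = 1" by (simp only: r_def)
  then show ?thesis by (simp add: B_def)
qed

lemma continuous_on_euler_sum_head:
  assumes "admissible xs" "r \<le> 1"
  shows "continuous_on (ball 0 r) (\<lambda>t. euler_sum f ((p, t) # xs) n)"
proof (rule continuous_at_imp_continuous_on, rule ballI)
  fix t :: complex assume "t \<in> ball 0 r"
  then have t: "norm t < 1" using assms(2) by simp
  obtain C where C: "\<And>n. norm (euler_sum f xs n) \<le> C" using euler_sum_bounded_locale[OF assms(1)] by blast
  define K where "K = complex_of_real ((norm t + 1) / 2)"
  have K: "norm K = (norm t + 1) / 2" unfolding K_def norm_of_real by simp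
  have "summable (\<lambda>j. K ^ j * euler_sum f xs (p ^ j * n))"
    by (rule summable_power_bounded[OF _ C]) (use K t in simp)
  then have "isCont (\<lambda>t. \<Sum>j. euler_sum f xs (p ^ j * n) * t ^ j) t"
    by (intro isCont_powser[where K=K]) (use K t in \<open>simp_all add: mult.commute\<close>)
  then show "isCont (\<lambda>t. euler_sum f ((p, t) # xs) n) t"
    by (simp add: mult.commute)
qed

lemma euler_sum_head_zero: "euler_sum f ((p, 0) # xs) n = euler_sum f xs n"
proof -
  have "(\<lambda>j. 0 ^ j * euler_sum f xs (p ^ j * n)) = (\<lambda>j. if j = 0 then euler_sum f xs n else 0)"
    by (auto simp: fun_eq_iff)
  then show ?thesis using sums_single[of 0 "\<lambda>j. euler_sum f xs n"] by (simp add: sums_iff)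
qed

text \<open>The ratio of the values at \<open>u\<close> and 1 is continuous in each parameter and
  takes only finitely many values, being a root of unity of bounded order; so it does not depend on
  that parameter. Setting the parameters to 0 one by one leads to \<open>f u / f 1\<close>.\<close>

lemma ratio_constant:
  assumes u: "coprime u M" "rich u" and xs: "admissible xs"
  shows "euler_sum f xs u * f 1 = f u * euler_sum f xs 1"
  using xs
proof (induction xs)
  case (Cons a xs)
  obtain p t where a: "a = (p, t)" by force
  have adm: "prime p" "norm t < 1 / real p" "p \<notin> fst ` set xs" "admissible xs"
    using Cons.prems by (auto simp: a admissible_Cons)
  define \<rho> where "\<rho> = (\<lambda>s. euler_sum f ((p, s) # xs) u / euler_sum f ((p, s) # xs) 1)"
  have ad: "admissible ((p, s) # xs)" if "s \<in> ball 0 (1 / real p)" for s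
    using adm that by (simp add: admissible_Cons)
  have r: "1 / real p \<le> 1" using prime_ge_1_nat[OF adm(1)] by simp
  have "\<rho> constant_on ball 0 (1 / real p)"
  proof (rule continuous_finite_range_constant)
    show "continuous_on (ball 0 (1 / real p)) \<rho>"
      unfolding \<rho>_def using ad nonzero
      by (intro continuous_on_divide continuous_on_euler_sum_head adm r) blast
    have "\<rho> ` ball 0 (1 / real p) \<subseteq> {z. z ^ totient M = 1}"
      using ratio_root_of_unity[OF u ad] by (auto simp: \<rho>_def)
    moreover have "finite {z::complex. z ^ totient M = 1}"
      using M by (intro finite_roots_unity) (simp add: Suc_le_eq)
    ultimately show "finite (\<rho> ` ball 0 (1 / real p))" by (rule finite_subset)
  qed auto
  then obtain c where c: "\<And>s. s \<in> ball 0 (1 / real p) \<Longrightarrow> \<rho> s = c"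
    by (auto simp: constant_on_def)
  have "\<rho> t = \<rho> 0" using c[of t] c[of 0] adm(2) prime_gt_0_nat[OF adm(1)] by simp
  then have "euler_sum f (a # xs) u / euler_sum f (a # xs) 1 = euler_sum f xs u / euler_sum f xs 1"
    by (simp only: \<rho>_def a euler_sum_head_zero)
  also have "\<dots> = f u / f 1"
    using Cons.IH[OF adm(4)] nonzero[OF adm(4)] nonzero[of "[]"] by (simp add: admissible_def field_simps)
  finally show ?case
    using nonzero[OF Cons.prems] nonzero[of "[]"] by (simp add: admissible_def field_simps)
qed simp

text \<open>Power series in several variables agree coefficientwise. The variables are removed one
  at a time, and \<open>n\<close> accumulates the prime powers whose coefficients have been read
  off.\<close>

lemma euler_sum_relation_imp_coeff_relation:
  assumes "distinct ps" "\<And>p. p \<in> set ps \<Longrightarrow> prime p"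
    "\<And>xs. admissible xs \<Longrightarrow> map fst xs = ps \<Longrightarrow> euler_sum f xs (u * n) = \<alpha> * euler_sum f xs n"
    "d > 0" "prime_factors d \<subseteq> set ps"
  shows "f (u * (n * d)) = \<alpha> * f (n * d)"
  using assms
proof (induction ps arbitrary: n d)
  case Nil
  then have "d = 1" by (simp add: prime_factorization_empty_iff)
  then show ?case using Nil.prems(3)[of "[]"] by (simp add: admissible_def)
next
  case (Cons p ps)
  have p: "prime p" "p \<notin> set ps" using Cons.prems by auto
  have step: "euler_sum f xs (u * (n * p ^ j)) = \<alpha> * euler_sum f xs (n * p ^ j)"
    if xs: "admissible xs" "map fst xs = ps" for xs j
  proof -
    obtain C where C: "\<And>n. norm (euler_sum f xs n) \<le> C" using euler_sum_bounded_locale[OF xs(1)] by blast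
    have "(\<lambda>j. (euler_sum f xs (p ^ j * (u * n)) - \<alpha> * euler_sum f xs (p ^ j * n)) * t ^ j) sums 0"
      if t: "norm t < 1 / real p" for t
    proof -
      have t1: "norm t < 1" using norm_less_one_of_prime[OF p(1) t] .
      have "p \<notin> fst ` set xs" using p(2) xs(2) by (metis list.set_map)
      then have adm: "admissible ((p, t) # xs)" using p t xs by (simp add: admissible_Cons)
      have s: "(\<lambda>j. t ^ j * euler_sum f xs (p ^ j * k)) sums euler_sum f ((p, t) # xs) k" for k
        by (simp add: summable_sums summable_power_bounded[OF t1 C])
      have "euler_sum f ((p, t) # xs) (u * n) = \<alpha> * euler_sum f ((p, t) # xs) n"
        by (rule Cons.prems(3)[OF adm]) (simp add: xs)
      then show ?thesis
        using sums_diff[OF s[of "u * n"] sums_mult[OF s[of n], of \<alpha>]] by (simp add: algebra_simps)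
    qed
    moreover have "0 < 1 / real p" using prime_gt_0_nat[OF p(1)] by simp
    ultimately have "euler_sum f xs (p ^ j * (u * n)) - \<alpha> * euler_sum f xs (p ^ j * n) = 0"
      by (intro powser_coeff_zero)
    then show ?thesis by (simp add: mult_ac)
  qed
  define j where "j = multiplicity p d"
  obtain e where e: "d = p ^ j * e" "\<not> p dvd e"
    using multiplicity_decompose'[of d p] Cons.prems(4) not_prime_unit p(1) unfolding j_def by blast
  have e0: "e > 0" using e(1) Cons.prems(4) by (cases "e = 0") auto
  have "prime_factors e \<subseteq> set ps"
  proof
    fix q assume q: "q \<in> prime_factors e"
    then have "q \<in> prime_factors d" using e(1) Cons.prems(4) by (auto simp: prime_factors_dvd)
    then show "q \<in> set ps" using Cons.prems(5) q e(2) by (auto simp: prime_factors_dvd)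
  qed
  then have "f (u * ((n * p ^ j) * e)) = \<alpha> * f ((n * p ^ j) * e)"
    using Cons.prems e0 step by (intro Cons.IH) auto
  then show ?case by (simp add: e(1) mult_ac)
qed

definition good :: "nat \<Rightarrow> bool" where
  "good u \<longleftrightarrow> (\<forall>n. f (u * n) * f 1 = f u * f n)"

lemma f1_nonzero: "f 1 \<noteq> 0" using nonzero[of "[]"] by (simp add: admissible_def)

lemma rich_imp_good:
  assumes u: "coprime u M" "rich u"
  shows "good u"
proof -
  have pos: "f (u * d) * f 1 = f u * f d" if "d > 0" for d
  proof -
    have "f (u * (1 * d)) = (f u / f 1) * f (1 * d)"
    proof (rule euler_sum_relation_imp_coeff_relation)
      show "distinct (sorted_list_of_set (prime_factors d))" by simp
      show "prime_factors d \<subseteq> set (sorted_list_of_set (prime_factors d))" by simp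
      show "euler_sum f xs (u * 1) = (f u / f 1) * euler_sum f xs 1" if "admissible xs" for xs
        using ratio_constant[OF u that] f1_nonzero by (simp add: field_simps)
    qed (use that in auto)
    then show ?thesis using f1_nonzero by (simp add: field_simps)
  qed
  have "f (u * n) * f 1 = f u * f n" for n
  proof (cases "n > 0")
    case False
    \<comment> \<open>Power series coefficients reach positive arguments only; periodicity replaces
      0 by \<open>M\<close>.\<close>
    have "f 0 = f M" "f (u * 0) = f (u * M)" by (auto intro!: per simp: cong_def)
    then show ?thesis using pos[OF M] False by simp
  qed (rule pos)
  then show ?thesis by (simp add: good_def)
qed

lemma good_cong: "good u \<longleftrightarrow> good v" if "[u = v] (mod M)" for u v
proof -
  have "f (u * n) = f (v * n)" for n using that by (intro per cong_mult) auto
  then show ?thesis using per[OF that] by (simp add: good_def)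
qed

lemma good_mult: "good u \<Longrightarrow> good v \<Longrightarrow> good (u * v)"
proof -
  assume u: "good u" and v: "good v"
  have "f (u * v * n) * f 1 = f (u * v) * f n" for n
  proof -
    have "f (u * (v * n)) * f 1 * f 1 = f u * f (v * n) * f 1" using u by (simp add: good_def)
    also have "\<dots> = f u * f v * f n" using v by (simp add: good_def mult.assoc)
    also have "\<dots> = f (u * v) * f n * f 1" using u by (simp add: good_def)
    finally show ?thesis using f1_nonzero by (simp add: mult_ac)
  qed
  then show ?thesis by (simp add: good_def)
qed

lemma good_of_prime_factors:
  assumes "n > 0" "\<And>p. prime p \<Longrightarrow> p dvd n \<Longrightarrow> good p"
  shows "good n"
  using assms
proof (induction n rule: prime_divisors_induct)
  case (unit x)
  then show ?case by (simp add: good_def mult.commute)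
next
  case (factor p x)
  then show ?case by (intro good_mult) auto
qed auto

text \<open>Instead of Dirichlet's theorem: the primes outside the rich classes have a finite sum of
  reciprocals, and every residue class contains a number free of such primes.\<close>
theorem good_of_coprime:
  assumes "coprime c M"
  shows "good c"
proof -
  \<comment> \<open>The exceptional primes. Rich classes contribute none, and each of the finitely
    many other classes contributes a bounded reciprocal sum, so \<open>V\<close> is sparse enough to
    be avoided.\<close>
  define V where "V = {p. prime p \<and> \<not> p dvd M \<and> \<not> good p}"
  have class_bound: "\<exists>C. \<forall>W. finite W \<longrightarrow> W \<subseteq> {p\<in>V. p mod M = u} \<longrightarrow> (\<Sum>p\<in>W. 1 / real p) \<le> C" for u
  proof (cases "coprime u M \<and> rich u")
    case True
    then have "good u" using rich_imp_good by blast
    moreover have "good p" if "p mod M = u" for p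
      using good_cong[of p u] that \<open>good u\<close> by (auto simp: cong_def)
    ultimately have empty: "{p\<in>V. p mod M = u} = {}" by (auto simp: V_def)
    show ?thesis unfolding empty by (intro exI[of _ 0]) auto
  next
    case nr: False
    show ?thesis
    proof (cases "rich u")
      case True
      with nr have "\<not> coprime u M" by simp
      moreover have "coprime (p mod M) M" if "p \<in> V" for p
        using that M by (simp add: V_def prime_imp_coprime)
      ultimately have empty: "{p\<in>V. p mod M = u} = {}" by auto
      show ?thesis unfolding empty by (intro exI[of _ 0]) auto
    next
      case False
      then obtain Q s where Q: "finite Q" "\<And>T. finite T \<Longrightarrow> T \<inter> Q = {} \<Longrightarrow>
        (\<forall>p\<in>T. prime p \<and> [p = u] (mod M)) \<Longrightarrow> (\<Sum>p\<in>T. 1 / real p) < s"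
        unfolding rich_def by (meson not_le_imp_less)
      have "(\<Sum>p\<in>W. 1 / real p) \<le> s + (\<Sum>p\<in>Q. 1 / real p)"
        if W: "finite W" "W \<subseteq> {p\<in>V. p mod M = u}" for W
      proof -
        have "(\<Sum>p\<in>W. 1 / real p) = (\<Sum>p\<in>W - Q. 1 / real p) + (\<Sum>p\<in>W \<inter> Q. 1 / real p)"
          by (subst sum.Int_Diff[OF W(1), of _ Q]) simp
        moreover have "(\<Sum>p\<in>W - Q. 1 / real p) < s"
          using W by (intro Q(2)) (auto simp: V_def cong_def)
        moreover have "(\<Sum>p\<in>W \<inter> Q. 1 / real p) \<le> (\<Sum>p\<in>Q. 1 / real p)"
          by (rule sum_mono2) (use Q in auto)
        ultimately show ?thesis by linarith
      qed
      then show ?thesis by blast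
    qed
  qed
  then obtain C where C: "\<And>u W. finite W \<Longrightarrow> W \<subseteq> {p\<in>V. p mod M = u} \<Longrightarrow> (\<Sum>p\<in>W. 1 / real p) \<le> C u"
    by metis
  have bound: "(\<Sum>p\<in>W. 1 / real p) \<le> (\<Sum>u<M. C u)" if W: "finite W" "W \<subseteq> V" for W
  proof -
    have "(\<Sum>p\<in>W. 1 / real p) = (\<Sum>u<M. \<Sum>p\<in>{p\<in>W. p mod M = u}. 1 / real p)"
      using W(1) M by (intro sum.group[symmetric]) auto
    also have "\<dots> \<le> (\<Sum>u<M. C u)"
      using W by (intro sum_mono C) auto
    finally show ?thesis .
  qed
  have "\<exists>n>0. [n = c] (mod M) \<and> (\<forall>p\<in>V. \<not> p dvd n)"
    by (rule exists_residue_avoiding_primes[OF M assms _ bound]) (auto simp: V_def)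
  then obtain n where n: "n > 0" "[n = c] (mod M)" "\<forall>p\<in>V. \<not> p dvd n" by blast
  have "coprime n M" using n(2) assms by (metis cong_imp_coprime cong_sym)
  have "good n"
  proof (rule good_of_prime_factors[OF n(1)])
    fix p assume p: "prime p" "p dvd n"
    then have "\<not> p dvd M" using \<open>coprime n M\<close> by (metis coprime_common_divisor not_prime_unit)
    then show "good p" using n(3) p by (auto simp: V_def)
  qed
  then show ?thesis using good_cong[OF n(2)] by simp
qed

end

section \<open>Eigenfunctions of the dilation adjoints\<close>

lemma bij_betw_mult_mod:
  fixes a q :: nat
  assumes "q > 0" "coprime a q"
  shows "bij_betw (\<lambda>i. a * i mod q) {..<q} {..<q}"
proof -
  have "inj_on (\<lambda>i. a * i mod q) {..<q}"
  proof (rule inj_onI)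
    fix i j assume "i \<in> {..<q}" "j \<in> {..<q}" "a * i mod q = a * j mod q"
    then have "[i = j] (mod q)" using assms(2)
      by (simp add: cong_mult_lcancel_nat flip: cong_def)
    then show "i = j" using \<open>i \<in> {..<q}\<close> \<open>j \<in> {..<q}\<close> by (simp add: cong_def)
  qed
  moreover have "(\<lambda>i. a * i mod q) ` {..<q} \<subseteq> {..<q}" using assms(1) by auto
  ultimately show ?thesis by (simp add: bij_betw_def endo_inj_surj)
qed

text \<open>The series of \<open>z d * sin (d * pi * x)\<close> over the \<open>d\<close> composed
  of the listed primes, \<open>z\<close> completely multiplicative. Summing prime by prime exposes
  how each dilation acts.\<close>

fun wave :: "(nat \<times> complex) list \<Rightarrow> real \<Rightarrow> complex" where
  "wave [] x = of_real (sin (pi * x))"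
| "wave ((p, z) # zs) x = (\<Sum>j. z ^ j * wave zs (real p ^ j * x))"

definition disc_params :: "(nat \<times> complex) list \<Rightarrow> bool" where
  "disc_params zs \<longleftrightarrow> distinct (map fst zs) \<and> (\<forall>(p, z)\<in>set zs. prime p \<and> norm z < 1)"

lemma disc_params_Cons:
  "disc_params ((p, z) # zs) \<longleftrightarrow> prime p \<and> norm z < 1 \<and> p \<notin> fst ` set zs \<and> disc_params zs"
  by (auto simp: disc_params_def)

lemma wave_bounded:
  assumes "disc_params zs"
  shows "\<exists>C. \<forall>x. norm (wave zs x) \<le> C"
  using assms
proof (induction zs)
  case Nil then show ?case by (auto intro!: exI[of _ 1])
next
  case (Cons a zs)
  obtain p z where a: "a = (p, z)" by force
  then obtain C where C: "\<And>x. norm (wave zs x) \<le> C" using Cons by (auto simp: disc_params_Cons)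
  have z: "norm z < 1" using Cons.prems a by (simp add: disc_params_Cons)
  have "norm (wave (a # zs) x) \<le> (\<Sum>j. norm z ^ j * C)" for x
  proof -
    have "norm (z ^ j * wave zs (real p ^ j * x)) \<le> norm z ^ j * C" for j
      by (simp add: norm_mult norm_power mult_left_mono C)
    then show ?thesis unfolding a using z
      by (auto intro!: norm_suminf_le summable_mult2 summable_geometric)
  qed
  then show ?case by blast
qed

lemma wave_sums:
  assumes "disc_params ((p, z) # zs)"
  shows "(\<lambda>j. z ^ j * wave zs (real p ^ j * x)) sums wave ((p, z) # zs) x"
proof -
  obtain C where C: "\<And>x. norm (wave zs x) \<le> C"
    using wave_bounded[of zs] assms by (auto simp: disc_params_Cons)
  have "summable (\<lambda>j. z ^ j * wave zs (real p ^ j * x))"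
    by (rule summable_power_bounded[OF _ C]) (use assms in \<open>simp add: disc_params_Cons\<close>)
  then show ?thesis by (simp add: summable_sums)
qed

lemma wave_continuous:
  assumes "disc_params zs"
  shows "continuous_on UNIV (wave zs)"
  using assms
proof (induction zs)
  case Nil then show ?case by (auto intro!: continuous_intros)
next
  case (Cons a zs)
  obtain p z where a: "a = (p, z)" by force
  have adm: "disc_params zs" "norm z < 1" using Cons.prems a by (auto simp: disc_params_Cons)
  have cont: "continuous_on UNIV (wave zs)" using Cons.IH adm by simp
  obtain C where C: "\<And>x. norm (wave zs x) \<le> C" using wave_bounded[OF adm(1)] by blast
  have "uniform_limit UNIV (\<lambda>n x. \<Sum>j<n. z ^ j * wave zs (real p ^ j * x)) (\<lambda>x. \<Sum>j. z ^ j * wave zs (real p ^ j * x)) sequentially"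
  proof (rule Weierstrass_m_test)
    show "norm (z ^ j * wave zs (real p ^ j * x)) \<le> norm z ^ j * C" for j x
      by (simp add: norm_mult norm_power mult_left_mono C)
    show "summable (\<lambda>j. norm z ^ j * C)" using adm(2) by (intro summable_mult2 summable_geometric) simp
  qed
  moreover have "continuous_on UNIV (\<lambda>x. \<Sum>j<n. z ^ j * wave zs (real p ^ j * x))" for n
    by (intro continuous_intros continuous_on_compose2[OF cont]) auto
  ultimately have "continuous_on UNIV (\<lambda>x. \<Sum>j. z ^ j * wave zs (real p ^ j * x))"
    by (intro uniform_limit_theorem) auto
  then show ?case by (simp add: a)
qed

lemma wave_periodic: "wave zs (x + 2 * real k) = wave zs x"
proof (induction zs arbitrary: x k)
  case Nil
  have "pi * (x + 2 * real k) = pi * x + 2 * real k * pi" by (simp add: algebra_simps)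
  then show ?case using sin.plus_of_nat[of "pi * x" k] by (simp add: algebra_simps)
next
  case (Cons a zs)
  obtain p z where a: "a = (p, z)" by force
  have "wave zs (real p ^ j * (x + 2 * real k)) = wave zs (real p ^ j * x)" for j
    using Cons.IH[of "real p ^ j * x" "p ^ j * k"] by (simp add: algebra_simps)
  then show ?case by (simp add: a)
qed

text \<open>The adjoint of the dilation by \<open>q\<close> on 2-periodic functions.\<close>
definition dilate_avg :: "nat \<Rightarrow> (real \<Rightarrow> complex) \<Rightarrow> real \<Rightarrow> complex" where
  "dilate_avg q g y = (1 / of_nat q) * (\<Sum>i<q. g ((y + 2 * real i) / real q))"

text \<open>Multiplication by \<open>a\<close> permutes the shifts \<open>2 * i\<close> modulo
  \<open>2 * q\<close>, so the average commutes with dilations prime to \<open>q\<close>.\<close>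

lemma dilate_avg_coprime:
  fixes g :: "real \<Rightarrow> complex"
  assumes per: "\<And>x k. g (x + 2 * real k) = g x" and q: "q > 0" and co: "coprime a q"
  shows "dilate_avg q (\<lambda>x. g (real a * x)) y = dilate_avg q g (real a * y)"
proof -
  have bij: "bij_betw (\<lambda>i. a * i mod q) {..<q} {..<q}" by (rule bij_betw_mult_mod[OF q co])
  have "g (real a * ((y + 2 * real i) / real q)) = g ((real a * y + 2 * real (a * i mod q)) / real q)" for i
  proof -
    have "real (a * i) = real q * real (a * i div q) + real (a * i mod q)"
      by (metis mult_div_mod_eq of_nat_add of_nat_mult)
    then have "real a * ((y + 2 * real i) / real q) = (real a * y + 2 * real (a * i mod q)) / real q + 2 * real (a * i div q)"
      using q by (simp add: field_simps)
    then show ?thesis using per by simp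
  qed
  then show ?thesis unfolding dilate_avg_def
    using sum.reindex_bij_betw[OF bij, of "\<lambda>i. g ((real a * y + 2 * real i) / real q)"] by simp
qed

lemma dilate_avg_wave_sums:
  assumes "disc_params ((p, z) # zs)"
  shows "(\<lambda>j. z ^ j * dilate_avg q (\<lambda>x. wave zs (real (p ^ j) * x)) y) sums dilate_avg q (wave ((p, z) # zs)) y"
proof -
  have "(\<lambda>j. (1 / of_nat q) * (\<Sum>i<q. z ^ j * wave zs (real p ^ j * ((y + 2 * real i) / real q)))) sums
    dilate_avg q (wave ((p, z) # zs)) y"
    unfolding dilate_avg_def by (intro sums_mult sums_sum wave_sums assms)
  then show ?thesis by (simp add: dilate_avg_def sum_distrib_left mult.left_commute)
qed

text \<open>The average of a sine over \<open>q > 1\<close> points equally spaced in its period is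
  0, and the dilations by the listed primes commute with the average.\<close>

lemma dilate_avg_wave_notin:
  assumes "disc_params zs" "prime q" "q \<notin> fst ` set zs"
  shows "dilate_avg q (wave zs) y = 0"
  using assms(1,3)
proof (induction zs arbitrary: y)
  case Nil
  have q: "q > 1" using assms(2) prime_gt_1_nat by blast
  have "(\<Sum>i<q. sin (pi * ((y + 2 * real i) / real q))) = Im (cis (pi * y / real q) * (\<Sum>i<q. cis (2 * pi * real i * real_of_int 1 / real q)))"
    using q by (simp add: sum_distrib_left cis_mult field_simps)
  also have "(\<Sum>i<q. cis (2 * pi * real i * real_of_int 1 / real q)) = 0"
    using q sum_cis_multiples[of q 1] by auto
  finally show ?case by (simp add: dilate_avg_def flip: of_real_sum)
next
  case (Cons a zs)
  obtain p z where a: "a = (p, z)" by force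
  have p: "prime p" "disc_params zs" "p \<noteq> q" "q \<notin> fst ` set zs"
    using Cons.prems by (auto simp: a disc_params_Cons)
  have "dilate_avg q (\<lambda>x. wave zs (real (p ^ j) * x)) y = 0" for j
  proof -
    have "coprime (p ^ j) q" using p assms(2) by (simp add: primes_coprime)
    then have "dilate_avg q (\<lambda>x. wave zs (real (p ^ j) * x)) y = dilate_avg q (wave zs) (real (p ^ j) * y)"
      by (intro dilate_avg_coprime wave_periodic) (use assms(2) prime_gt_0_nat in auto)
    then show ?thesis using Cons.IH p by simp
  qed
  then have "(\<lambda>j. 0) sums dilate_avg q (wave (a # zs)) y"
    using dilate_avg_wave_sums[of p z zs q y] Cons.prems(1) by (simp del: wave.simps add: a)
  then show ?case using sums_unique2 sums_zero by blast
qed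

text \<open>Averaging undoes one dilation by \<open>q\<close>, which shifts the sum over powers of
  \<open>q\<close> by one place and pulls out \<open>w\<close>; the term without \<open>q\<close>
  averages to 0. Sums over other primes commute with the average.\<close>

lemma dilate_avg_wave_in:
  assumes "disc_params zs" "prime q" "(q, w) \<in> set zs"
  shows "dilate_avg q (wave zs) y = w * wave zs y"
  using assms(1,3)
proof (induction zs arbitrary: y)
  case (Cons a zs)
  obtain p z where a: "a = (p, z)" by force
  have p: "prime p" "disc_params zs" "p \<notin> fst ` set zs" "disc_params ((p, z) # zs)"
    using Cons.prems by (auto simp: a disc_params_Cons)
  have q0: "q > 0" using assms(2) prime_gt_0_nat by blast
  let ?A = "\<lambda>j. z ^ j * dilate_avg q (\<lambda>x. wave zs (real (p ^ j) * x)) y"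
  have s: "?A sums dilate_avg q (wave (a # zs)) y"
    using dilate_avg_wave_sums[OF p(4)] by (simp add: a)
  show ?case
  proof (cases "p = q")
    case True
    then have w: "w = z" using Cons.prems(2) p(3) by (force simp: a)
    have "dilate_avg q (\<lambda>x. wave zs (real (p ^ Suc j) * x)) y = wave zs (real p ^ j * y)" for j
    proof -
      have "wave zs (real (p ^ Suc j) * ((y + 2 * real i) / real q)) = wave zs (real p ^ j * y)" for i
      proof -
        have "real (p ^ Suc j) * ((y + 2 * real i) / real q) = real p ^ j * y + 2 * real (p ^ j * i)"
          using q0 True by (simp add: field_simps)
        then show ?thesis by (simp only: wave_periodic)
      qed
      then show ?thesis using q0 by (simp add: dilate_avg_def)
    qed
    then have "(\<lambda>j. z ^ Suc j * dilate_avg q (\<lambda>x. wave zs (real (p ^ Suc j) * x)) y) sums (z * wave (a # zs) y)"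
      using sums_mult[OF wave_sums[OF p(4), of y], of z] by (simp add: a mult_ac)
    then have "?A sums
      (z * wave (a # zs) y + z ^ 0 * dilate_avg q (\<lambda>x. wave zs (real (p ^ 0) * x)) y)"
      by (rule sums_Suc[where f = ?A])
    moreover have "dilate_avg q (wave zs) y = 0"
      using dilate_avg_wave_notin p assms(2) True by blast
    ultimately have "?A sums (z * wave (a # zs) y)"
      by simp
    with s show ?thesis unfolding w by (rule sums_unique2)
  next
    case False
    have "dilate_avg q (\<lambda>x. wave zs (real (p ^ j) * x)) y = w * wave zs (real p ^ j * y)" for j
    proof -
      have "coprime (p ^ j) q" using p assms(2) False by (simp add: primes_coprime)
      then have "dilate_avg q (\<lambda>x. wave zs (real (p ^ j) * x)) y = dilate_avg q (wave zs) (real (p ^ j) * y)"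
        by (intro dilate_avg_coprime wave_periodic q0)
      then show ?thesis using Cons.IH p Cons.prems(2) False by (auto simp: a)
    qed
    then have "?A sums (w * wave (a # zs) y)"
      using sums_mult[OF wave_sums[OF p(4), of y], of w] by (simp add: a mult_ac)
    with s show ?thesis by (rule sums_unique2)
  qed
qed simp

section \<open>Pairing bounded periodic functions with waves\<close>

lemma integrable_bounded_times_continuous:
  fixes \<Theta> :: "real \<Rightarrow> real" and g :: "real \<Rightarrow> complex"
  assumes "\<Theta> \<in> borel_measurable borel" "\<And>x. \<bar>\<Theta> x\<bar> \<le> K" "continuous_on UNIV g"
  shows "(\<lambda>x. of_real (\<Theta> x) * g x) integrable_on {a..b}"
proof (rule measurable_bounded_by_integrable_imp_integrable)
  have "g \<in> borel_measurable borel" using assms(3) by (rule borel_measurable_continuous_onI)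
  then have "(\<lambda>x. of_real (\<Theta> x) * g x) \<in> borel_measurable borel" using assms(1) by measurable
  then have "(\<lambda>x. of_real (\<Theta> x) * g x) \<in> borel_measurable lebesgue"
    by (intro measurable_completion) simp
  then show "(\<lambda>x. of_real (\<Theta> x) * g x) \<in> borel_measurable (lebesgue_on {a..b})"
    by (rule measurable_restrict_space1)
  show "(\<lambda>x. K * norm (g x)) integrable_on {a..b}"
    using assms(3) by (intro integrable_continuous_interval continuous_intros) (auto intro: continuous_on_subset)
  show "norm (of_real (\<Theta> x) * g x) \<le> K * norm (g x)" for x
    by (simp add: norm_mult mult_right_mono assms(2))
qed auto

lemma integrable_bounded_measurable:
  fixes \<Theta> :: "real \<Rightarrow> real"
  assumes "\<Theta> \<in> borel_measurable borel" "\<And>x. \<bar>\<Theta> x\<bar> \<le> K"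
  shows "\<Theta> integrable_on {a..b}"
proof (rule measurable_bounded_by_integrable_imp_integrable)
  have "\<Theta> \<in> borel_measurable lebesgue"
    using assms(1) by (intro measurable_completion) simp
  then show "\<Theta> \<in> borel_measurable (lebesgue_on {a..b})"
    by (rule measurable_restrict_space1)
  show "(\<lambda>x. K) integrable_on {a..b}" by (rule integrable_const_ivl)
  show "norm (\<Theta> x) \<le> K" for x using assms(2) by simp
qed auto

definition wave_pairing :: "(real \<Rightarrow> real) \<Rightarrow> (nat \<times> complex) list \<Rightarrow> nat \<Rightarrow> complex" where
  "wave_pairing \<Theta> zs n = integral {0..2} (\<lambda>x. of_real (\<Theta> x) * wave zs (real n * x))"

lemma continuous_on_wave_dilate: "disc_params zs \<Longrightarrow> continuous_on UNIV (\<lambda>x. wave zs (c * x))"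
  by (intro continuous_on_compose2[OF wave_continuous]) (auto intro!: continuous_intros)

lemma wave_pairing_sums:
  assumes \<Theta>: "\<Theta> \<in> borel_measurable borel" "\<And>x. \<bar>\<Theta> x\<bar> \<le> K" and zs: "disc_params ((p, z) # zs)"
  shows "(\<lambda>j. z ^ j * wave_pairing \<Theta> zs (p ^ j * n)) sums wave_pairing \<Theta> ((p, z) # zs) n"
proof -
  have zs': "disc_params zs" and z: "norm z < 1" using zs by (simp_all add: disc_params_Cons)
  obtain C where C: "\<And>x. norm (wave zs x) \<le> C" using wave_bounded[OF zs'] by blast
  have C0: "C \<ge> 0" using C[of 0] norm_ge_zero order_trans by blast
  have K0: "K \<ge> 0" using \<Theta>(2)[of 0] by linarith
  define F where "F = (\<lambda>N x. of_real (\<Theta> x) * (\<Sum>j<N. z ^ j * wave zs (real p ^ j * (real n * x))))"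
  have int: "(\<lambda>x. of_real (\<Theta> x) * wave zs (real (p ^ j * n) * x)) integrable_on {0..2}" for j
    by (rule integrable_bounded_times_continuous[OF \<Theta>]) (rule continuous_on_wave_dilate[OF zs'])
  have F_eq: "F N = (\<lambda>x. \<Sum>j<N. z ^ j * (of_real (\<Theta> x) * wave zs (real (p ^ j * n) * x)))" for N
    by (auto simp: F_def sum_distrib_left mult_ac)
  have intF: "integral {0..2} (F N) = (\<Sum>j<N. z ^ j * wave_pairing \<Theta> zs (p ^ j * n))" for N
    unfolding F_eq wave_pairing_def using int
    by (subst integral_sum) (auto intro!: integrable_on_mult_right)
  have "(\<lambda>N. integral {0..2} (F N)) \<longlonglongrightarrow> integral {0..2} (\<lambda>x. of_real (\<Theta> x) * wave ((p, z) # zs) (real n * x))"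
  proof (rule dominated_convergence(2))
    show "F N integrable_on {0..2}" for N
      unfolding F_eq using int by (intro integrable_sum integrable_on_mult_right) auto
    show "(\<lambda>x::real. K * (C / (1 - norm z))) integrable_on {0..2}" by (rule integrable_const_ivl)
    show "norm (F N x) \<le> K * (C / (1 - norm z))" for N x
    proof -
      have "norm (\<Sum>j<N. z ^ j * wave zs (real p ^ j * (real n * x))) \<le> (\<Sum>j<N. norm z ^ j * C)"
        by (intro sum_norm_le) (simp add: norm_mult norm_power mult_left_mono C)
      also have "\<dots> = C * (\<Sum>j<N. norm z ^ j)" by (simp add: sum_distrib_left mult.commute)
      also have "(\<Sum>j<N. norm z ^ j) \<le> 1 / (1 - norm z)"
        using z by (subst suminf_geometric[symmetric]) (auto intro!: sum_le_suminf summable_geometric)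
      finally show ?thesis unfolding F_def norm_mult using C0 K0 \<Theta>(2)
        by (intro mult_mono) (auto intro: mult_left_mono)
    qed
    show "(\<lambda>N. F N x) \<longlonglongrightarrow> of_real (\<Theta> x) * wave ((p, z) # zs) (real n * x)" for x
      unfolding F_def using wave_sums[OF zs, of "real n * x"] by (intro tendsto_mult_left) (simp only: sums_def)
  qed
  then show ?thesis by (simp only: intF sums_def wave_pairing_def)
qed

text \<open>The factor \<open>n\<close> in \<open>f n\<close> gains \<open>p ^ j\<close> when
  \<open>n\<close> becomes \<open>p ^ j * n\<close>, and dividing the parameter by \<open>p\<close>
  cancels this gain.\<close>

lemma euler_sum_eq_wave_pairing:
  assumes \<Theta>: "\<Theta> \<in> borel_measurable borel" "\<And>x. \<bar>\<Theta> x\<bar> \<le> K" and zs: "disc_params zs"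
    and f: "\<And>n. n > 0 \<Longrightarrow> f n = of_real pi * of_nat n * wave_pairing \<Theta> [] n" and n: "n > 0"
  shows "euler_sum f (map (\<lambda>(p, z). (p, z / of_nat p)) zs) n = of_real pi * of_nat n * wave_pairing \<Theta> zs n"
  using zs n
proof (induction zs arbitrary: n)
  case (Cons a zs)
  obtain p z where a: "a = (p, z)" by force
  have p: "p > 0" "disc_params zs" using Cons.prems(1) by (auto simp: a disc_params_Cons prime_gt_0_nat)
  have "(z / of_nat p) ^ j * euler_sum f (map (\<lambda>(p, z). (p, z / of_nat p)) zs) (p ^ j * n)
     = of_real pi * of_nat n * (z ^ j * wave_pairing \<Theta> zs (p ^ j * n))" for j
    using Cons.IH[OF p(2), of "p ^ j * n"] Cons.prems(2) p(1) by (simp add: power_divide)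
  moreover have "(\<lambda>j. of_real pi * of_nat n * (z ^ j * wave_pairing \<Theta> zs (p ^ j * n))) sums
    (of_real pi * of_nat n * wave_pairing \<Theta> (a # zs) n)"
    unfolding a by (intro sums_mult wave_pairing_sums[OF \<Theta>]) (use Cons.prems(1) a in simp)
  ultimately show ?case by (simp add: a sums_iff)
qed (use f in simp)

lemma integral_cos_full_period:
  fixes k :: int
  shows "((\<lambda>x. cos (real_of_int k * pi * x)) has_integral (if k = 0 then 2 else 0)) {0..2}"
proof (cases "k = 0")
  case True
  then show ?thesis using has_integral_const_real[of "1::real" 0 2] by simp
next
  case False
  have "((\<lambda>x. cos (real_of_int k * pi * x)) has_integral
      (sin (real_of_int k * pi * 2) / (real_of_int k * pi) - sin (real_of_int k * pi * 0) / (real_of_int k * pi))) {0..2}"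
    using False
    by (intro fundamental_theorem_of_calculus)
      (auto intro!: derivative_eq_intros simp flip: has_real_derivative_iff_has_vector_derivative)
  moreover have "sin (real_of_int k * pi * 2) = 0"
    using sin_int_2pin[of k] by (simp add: mult_ac)
  ultimately show ?thesis using False by simp
qed

text \<open>Of the frequencies \<open>d * n\<close> in the dilated wave only
  \<open>d * n = 1\<close> meets the sine. The value 1 at \<open>n = 1\<close> means that no wave
  annihilates the sine.\<close>

lemma wave_pairing_sin:
  assumes "disc_params zs" "n > 0"
  shows "wave_pairing (\<lambda>x. sin (pi * x)) zs n = (if n = 1 then 1 else 0)"
  using assms
proof (induction zs arbitrary: n)
  case Nil
  have "((\<lambda>x. (cos (real_of_int (int n - 1) * pi * x) - cos (real_of_int (int n + 1) * pi * x)) / 2)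
     has_integral ((if int n - 1 = 0 then 2 else 0) - (if int n + 1 = 0 then 2 else 0)) / 2) {0..2}"
    by (intro has_integral_divide has_integral_diff integral_cos_full_period)
  moreover have "(cos (real_of_int (int n - 1) * pi * x) - cos (real_of_int (int n + 1) * pi * x)) / 2
    = sin (pi * x) * sin (pi * (real n * x))" for x
  proof -
    have "cos (real_of_int (int n - 1) * pi * x) = cos (pi * (real n * x) - pi * x)"
      "cos (real_of_int (int n + 1) * pi * x) = cos (pi * (real n * x) + pi * x)"
      by (simp_all add: algebra_simps)
    then show ?thesis by (simp add: cos_add cos_diff)
  qed
  ultimately have "((\<lambda>x. sin (pi * x) * sin (pi * (real n * x))) has_integral (if n = 1 then 1 else 0)) {0..2}"
    by (simp split: if_splits)
  then have "((\<lambda>x. complex_of_real (sin (pi * x) * sin (pi * (real n * x)))) has_integral complex_of_real (if n = 1 then 1 else 0)) {0..2}"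
    by (rule has_integral_of_real)
  then show ?case by (simp add: wave_pairing_def integral_unique split: if_splits)
next
  case (Cons a zs)
  obtain p z where a: "a = (p, z)" by force
  have "prime p" and p2: "disc_params zs" using Cons.prems(1) by (auto simp: a disc_params_Cons)
  then have p: "p > 1" "disc_params zs" using prime_gt_1_nat by blast+
  have "(\<lambda>j. z ^ j * wave_pairing (\<lambda>x. sin (pi * x)) zs (p ^ j * n)) sums wave_pairing (\<lambda>x. sin (pi * x)) (a # zs) n"
    unfolding a by (rule wave_pairing_sums[where K = 1]) (use Cons.prems(1) a in auto)
  moreover have "z ^ j * wave_pairing (\<lambda>x. sin (pi * x)) zs (p ^ j * n) = (if j = 0 then (if n = 1 then 1 else 0) else 0)" for j
  proof -
    have "wave_pairing (\<lambda>x. sin (pi * x)) zs (p ^ j * n) = (if p ^ j * n = 1 then 1 else 0)"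
      using Cons.IH[OF p(2), of "p ^ j * n"] p(1) Cons.prems(2) by simp
    then show ?thesis using p(1) by auto
  qed
  ultimately have "(\<lambda>j. if j = 0 then (if n = 1 then 1 else 0) else 0) sums wave_pairing (\<lambda>x. sin (pi * x)) (a # zs) n"
    by simp
  moreover have "(\<lambda>j::nat. if j = 0 then (if n = 1 then 1 else 0) else 0) sums ((if n = 1 then 1 else 0)::complex)"
    using sums_single[of 0 "\<lambda>j. (if n = 1 then 1 else 0)::complex"] by simp
  ultimately show ?case by (rule sums_unique2)
qed

lemma integral_shift_real:
  fixes G :: "real \<Rightarrow> 'a::euclidean_space"
  shows "integral {a + c..b + c} G = integral {a..b} (\<lambda>y. G (y + c))"
proof -
  have "((\<lambda>y. G (y + c)) has_integral I) {a..b} \<longleftrightarrow> (G has_integral I) {a + c..b + c}" for I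
    using has_integral_shift_Icc_real[of G c I a b] by (simp add: comp_def add.commute)
  then show ?thesis by (simp add: integral_def integrable_on_def)
qed

lemma integral_split_equal:
  fixes G :: "real \<Rightarrow> 'a::euclidean_space"
  assumes "\<And>a b. G integrable_on {a..b}" "h \<ge> 0"
  shows "integral {0..real N * h} G = (\<Sum>i<N. integral {real i * h..real i * h + h} G)"
proof (induction N)
  case (Suc N)
  have "integral {0..real (Suc N) * h} G = integral {0..real N * h} G + integral {real N * h..real (Suc N) * h} G"
    using assms by (intro Henstock_Kurzweil_Integration.integral_combine[symmetric]) (auto simp: mult_right_mono)
  moreover have "real (Suc N) * h = real N * h + h" by (simp add: algebra_simps)
  ultimately show ?case using Suc.IH by simp
qed simp

text \<open>Substitute \<open>y = q * x\<close>, cut the interval of length \<open>2 * q\<close>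
  into \<open>q\<close> periods of \<open>\<Theta>\<close> and shift each back to
  \<open>{0..2}\<close>; the shifted copies of \<open>h\<close> add up to
  \<open>dilate_avg\<close>.\<close>

lemma integral_dilate_adjoint:
  fixes \<Theta> :: "real \<Rightarrow> real" and h :: "real \<Rightarrow> complex"
  assumes \<Theta>: "\<Theta> \<in> borel_measurable borel" "\<And>x. \<bar>\<Theta> x\<bar> \<le> K" and per: "\<And>x k. \<Theta> (x + 2 * real k) = \<Theta> x"
    and h: "continuous_on UNIV h" and q: "q > 0"
  shows "integral {0..2} (\<lambda>x. of_real (\<Theta> (real q * x)) * h x) = integral {0..2} (\<lambda>y. of_real (\<Theta> y) * dilate_avg q h y)"
proof -
  define G where "G = (\<lambda>y. of_real (\<Theta> y) * h (y / real q))"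
  have ch: "continuous_on UNIV (\<lambda>y. h ((y + c) / real q))" for c
    by (intro continuous_on_compose2[OF h]) (use q in \<open>auto intro!: continuous_intros\<close>)
  have intG: "G integrable_on {a..b}" for a b
    unfolding G_def using ch[of 0] by (intro integrable_bounded_times_continuous[OF \<Theta>]) simp
  have "(G has_integral integral {0..real q * 2} G) (cbox 0 (real q * 2))"
    using intG by (simp add: integrable_integral)
  from has_integral_affinity'[OF this, of "real q" 0] q
  have A: "((\<lambda>x. G (real q * x)) has_integral integral {0..real q * 2} G /\<^sub>R real q) {0..inverse (real q) * (real q * 2)}"
    by simp
  have "inverse (real q) * (real q * 2) = 2" using q by simp
  from A[unfolded this]
  have "((\<lambda>x. G (real q * x)) has_integral integral {0..real q * 2} G /\<^sub>R real q) {0..2}" .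
  moreover have "G (real q * x) = of_real (\<Theta> (real q * x)) * h x" for x using q by (simp add: G_def)
  ultimately have "integral {0..2} (\<lambda>x. of_real (\<Theta> (real q * x)) * h x) = integral {0..real q * 2} G /\<^sub>R real q"
    by (simp add: integral_unique)
  also have "integral {0..real q * 2} G = (\<Sum>i<q. integral {real i * 2..real i * 2 + 2} G)"
    by (rule integral_split_equal[OF intG]) simp
  also have "\<dots> = (\<Sum>i<q. integral {0..2} (\<lambda>y. of_real (\<Theta> y) * h ((y + 2 * real i) / real q)))"
  proof (rule sum.cong[OF refl])
    fix i
    have "integral {real i * 2..real i * 2 + 2} G = integral {0 + 2 * real i..2 + 2 * real i} G"
      by (simp add: algebra_simps)
    also have "\<dots> = integral {0..2} (\<lambda>y. G (y + 2 * real i))" by (rule integral_shift_real)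
    finally show "integral {real i * 2..real i * 2 + 2} G = integral {0..2} (\<lambda>y. of_real (\<Theta> y) * h ((y + 2 * real i) / real q))"
      by (simp add: G_def per)
  qed
  also have "\<dots> = integral {0..2} (\<lambda>y. \<Sum>i<q. of_real (\<Theta> y) * h ((y + 2 * real i) / real q))"
    by (intro integral_sum[symmetric] integrable_bounded_times_continuous[OF \<Theta>] ch) auto
  also have "\<dots> /\<^sub>R real q = integral {0..2} (\<lambda>y. of_real (\<Theta> y) * dilate_avg q h y)"
    unfolding dilate_avg_def scaleR_conv_of_real
    by (subst integral_mult_right[symmetric]) (simp add: sum_distrib_left divide_inverse mult_ac)
  finally show ?thesis .
qed

text \<open>Each prime factor of \<open>k\<close> is moved onto the wave by the adjoint, which
  multiplies the wave by a scalar, 0 for an unlisted prime. So every dilate pairs to a multiple of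
  the pairing with \<open>\<Theta>\<close> itself.\<close>

lemma wave_orthogonal_dilates:
  assumes \<Theta>: "\<Theta> \<in> borel_measurable borel" "\<And>x. \<bar>\<Theta> x\<bar> \<le> K" and per: "\<And>x k. \<Theta> (x + 2 * real k) = \<Theta> x"
    and zs: "disc_params zs" and zero: "wave_pairing \<Theta> zs 1 = 0" and "k > 0"
  shows "integral {0..2} (\<lambda>x. of_real (\<Theta> (real k * x)) * wave zs x) = 0"
  using \<open>k > 0\<close>
proof (induction k rule: prime_divisors_induct)
  case (unit k)
  then show ?case using zero by (simp add: wave_pairing_def)
next
  case (factor q k)
  have q: "q > 0" using factor.hyps prime_gt_0_nat by blast
  have k: "k > 0" using factor.prems by simp
  have "integral {0..2} (\<lambda>x. of_real (\<Theta> (real (q * k) * x)) * wave zs x)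
    = integral {0..2} (\<lambda>x. of_real ((\<lambda>y. \<Theta> (real k * y)) (real q * x)) * wave zs x)"
    by (simp add: mult_ac)
  also have "\<dots> = integral {0..2} (\<lambda>y. of_real (\<Theta> (real k * y)) * dilate_avg q (wave zs) y)"
  proof (rule integral_dilate_adjoint[OF _ _ _ wave_continuous[OF zs] q])
    show "(\<lambda>y. \<Theta> (real k * y)) \<in> borel_measurable borel" using \<Theta>(1) by measurable
    show "\<bar>\<Theta> (real k * x)\<bar> \<le> K" for x by (rule \<Theta>(2))
    show "\<Theta> (real k * (x + 2 * real m)) = \<Theta> (real k * x)" for x m
      using per[of "real k * x" "k * m"] by (simp add: algebra_simps)
  qed
  also have "\<dots> = 0"
  proof (cases "q \<in> fst ` set zs")
    case True
    then obtain w where "(q, w) \<in> set zs" by auto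
    then have "dilate_avg q (wave zs) y = w * wave zs y" for y
      using dilate_avg_wave_in zs factor.hyps by blast
    then have "integral {0..2} (\<lambda>y. of_real (\<Theta> (real k * y)) * dilate_avg q (wave zs) y)
      = w * integral {0..2} (\<lambda>y. of_real (\<Theta> (real k * y)) * wave zs y)"
      by (simp add: mult.left_commute)
    then show ?thesis using factor.IH k by simp
  next
    case False
    then show ?thesis using dilate_avg_wave_notin[OF zs factor.hyps] by simp
  qed
  finally show ?case .
qed simp

lemma integral_even_periodic:
  fixes G :: "real \<Rightarrow> real"
  assumes "\<And>a b. G integrable_on {a..b}" "\<And>x. G (- x) = G x" "\<And>x. G (x + 2) = G x"
  shows "integral {0..2} G = 2 * integral {0..1} G"
proof -
  have "integral {1..2} G = integral {-2..-1} (\<lambda>x. G (- x))"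
    using Henstock_Kurzweil_Integration.integral_reflect_real[of 2 1 G] by simp
  also have "\<dots> = integral {-2..-1} (\<lambda>x. G (x + 2))" using assms(2,3) by simp
  also have "\<dots> = integral {-2 + 2..-1 + 2} G" by (rule integral_shift_real[symmetric])
  finally have "integral {1..2} G = integral {0..1} G" by simp
  then show ?thesis
    using Henstock_Kurzweil_Integration.integral_combine[of 0 1 2 G] assms(1) by simp
qed

text \<open>Otherwise the wave would be orthogonal to all dilates of \<open>\<Theta>\<close>, hence
  to the sine as their limit, whereas its pairing with the sine is 1.\<close>

theorem wave_pairing_nonzero:
  assumes \<Theta>: "\<Theta> \<in> borel_measurable borel" "\<And>x. \<bar>\<Theta> x\<bar> \<le> K"
    and per: "\<And>x k. \<Theta> (x + 2 * real k) = \<Theta> x" and odd: "\<And>x. \<Theta> (- x) = - \<Theta> x"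
    and dense: "\<And>\<epsilon>. \<epsilon> > 0 \<Longrightarrow> \<exists>K c. finite K \<and> K \<subseteq> {1..} \<and>
       integral {0..1} (\<lambda>x. (sin (pi * x) - (\<Sum>k\<in>K. c k * \<Theta> (real k * x)))\<^sup>2) < \<epsilon>"
    and zs: "disc_params zs"
  shows "wave_pairing \<Theta> zs 1 \<noteq> 0"
proof
  assume zero: "wave_pairing \<Theta> zs 1 = 0"
  obtain C where C: "\<And>x. norm (wave zs x) \<le> C" using wave_bounded[OF zs] by blast
  define H where "H = max 1 C"
  have H: "H \<ge> 1" "\<And>x. norm (wave zs x) \<le> H" using C by (simp_all add: H_def le_max_iff_disj)
  \<comment> \<open>The weight in \<open>2 * (\<bar>g x\<bar> * H) \<le> a * (g x)\<^sup>2 +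
    H\<^sup>2 / a\<close>. An error below \<open>1 / (4 * a)\<close> on \<open>{0..1}\<close>
    doubles on \<open>{0..2}\<close>, and the integrated bound becomes
    \<open>(1 / 2 + 1) / 2 = 3 / 4\<close>, which is less than 1.\<close>
  define a where "a = 2 * H\<^sup>2"
  have a: "a > 0" using H(1) by (simp add: a_def)
  obtain I c where I: "finite I" "I \<subseteq> {1..}"
    "integral {0..1} (\<lambda>x. (sin (pi * x) - (\<Sum>k\<in>I. c k * \<Theta> (real k * x)))\<^sup>2) < 1 / (4 * a)"
    using dense[of "1 / (4 * a)"] a by auto
  define g where "g = (\<lambda>x. sin (pi * x) - (\<Sum>k\<in>I. c k * \<Theta> (real k * x)))"
  have gm: "g \<in> borel_measurable borel" unfolding g_def using \<Theta>(1) by measurable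
  have gb: "\<bar>g x\<bar> \<le> 1 + (\<Sum>k\<in>I. \<bar>c k\<bar> * K)" for x
  proof -
    have "\<bar>\<Sum>k\<in>I. c k * \<Theta> (real k * x)\<bar> \<le> (\<Sum>k\<in>I. \<bar>c k\<bar> * K)"
      by (rule order_trans[OF sum_abs]) (auto intro!: sum_mono simp: abs_mult mult_left_mono \<Theta>(2))
    moreover have "\<bar>sin (pi * x)\<bar> \<le> 1" by simp
    ultimately show ?thesis unfolding g_def by linarith
  qed
  have g2m: "(\<lambda>x. (g x)\<^sup>2) \<in> borel_measurable borel" using gm by measurable
  have g2b: "\<bar>(g x)\<^sup>2\<bar> \<le> (1 + (\<Sum>k\<in>I. \<bar>c k\<bar> * K))\<^sup>2" for x
    using power_mono[OF gb, of x 2] by simp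
  have g2i: "(\<lambda>x. (g x)\<^sup>2) integrable_on {s..t}" for s t
    by (rule integrable_bounded_measurable[OF g2m g2b])
  have g_odd: "g (- x) = - g x" for x
    by (simp add: g_def odd sum_negf)
  have g_per: "g (x + 2) = g x" for x
  proof -
    have "\<Theta> (real k * (x + 2)) = \<Theta> (real k * x)" for k
      using per[of "real k * x" k] by (simp add: algebra_simps)
    moreover have "sin (pi * (x + 2)) = sin (pi * x)"
      using sin_periodic[of "pi * x"] by (simp add: algebra_simps)
    ultimately show ?thesis by (simp add: g_def)
  qed
  have "integral {0..2} (\<lambda>x. (g x)\<^sup>2) = 2 * integral {0..1} (\<lambda>x. (g x)\<^sup>2)"
    by (rule integral_even_periodic[OF g2i]) (simp_all add: g_odd g_per)
  also have "\<dots> < 2 * (1 / (4 * a))" using I(3) by (simp add: g_def)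
  finally have small: "integral {0..2} (\<lambda>x. (g x)\<^sup>2) < 1 / (2 * a)" by simp
  have int: "(\<lambda>x. of_real (\<Theta> (real k * x)) * wave zs x) integrable_on {0..2}" for k
    by (rule integrable_bounded_times_continuous[where K = K])
      (use \<Theta> in \<open>auto intro!: wave_continuous[OF zs] measurable_compose[OF _ \<Theta>(1)]\<close>)
  have "integral {0..2} (\<lambda>x. of_real (g x) * wave zs x)
    = integral {0..2} (\<lambda>x. of_real (sin (pi * x)) * wave zs x - (\<Sum>k\<in>I. of_real (c k) * (of_real (\<Theta> (real k * x)) * wave zs x)))"
    by (simp add: g_def algebra_simps sum_distrib_left)
  also have "\<dots> = integral {0..2} (\<lambda>x. of_real (sin (pi * x)) * wave zs x)
      - integral {0..2} (\<lambda>x. \<Sum>k\<in>I. of_real (c k) * (of_real (\<Theta> (real k * x)) * wave zs x))"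
  proof (rule Henstock_Kurzweil_Integration.integral_diff)
    show "(\<lambda>x. of_real (sin (pi * x)) * wave zs x) integrable_on {0..2}"
      by (rule integrable_bounded_times_continuous[where K = 1]) (auto intro!: wave_continuous[OF zs])
    show "(\<lambda>x. \<Sum>k\<in>I. of_real (c k) * (of_real (\<Theta> (real k * x)) * wave zs x)) integrable_on {0..2}"
      by (intro integrable_sum integrable_on_mult_right int I(1))
  qed
  also have "integral {0..2} (\<lambda>x. \<Sum>k\<in>I. of_real (c k) * (of_real (\<Theta> (real k * x)) * wave zs x))
    = (\<Sum>k\<in>I. of_real (c k) * integral {0..2} (\<lambda>x. of_real (\<Theta> (real k * x)) * wave zs x))"
    using I(1) int by (simp add: integral_sum integrable_on_mult_right)
  also have "(\<Sum>k\<in>I. of_real (c k) * integral {0..2} (\<lambda>x. of_real (\<Theta> (real k * x)) * wave zs x)) = 0"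
    using I(2) by (intro sum.neutral) (auto simp: wave_orthogonal_dilates[OF \<Theta> per zs zero])
  also have "integral {0..2} (\<lambda>x. of_real (sin (pi * x)) * wave zs x) = 1"
    using wave_pairing_sin[OF zs, of 1] by (simp add: wave_pairing_def)
  finally have "1 = norm (integral {0..2} (\<lambda>x. of_real (g x) * wave zs x))" by simp
  also have "\<dots> \<le> integral {0..2} (\<lambda>x. (a * (g x)\<^sup>2 + H\<^sup>2 / a) / 2)"
  proof (rule integral_norm_bound_integral)
    show "(\<lambda>x. of_real (g x) * wave zs x) integrable_on {0..2}"
      by (rule integrable_bounded_times_continuous[OF gm gb wave_continuous[OF zs]])
    show "(\<lambda>x. (a * (g x)\<^sup>2 + H\<^sup>2 / a) / 2) integrable_on {0..2}"
      by (intro integrable_on_divide integrable_add integrable_on_mult_right g2i integrable_const_ivl)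
    fix x
    have "norm (of_real (g x) * wave zs x) \<le> \<bar>g x\<bar> * H"
      by (simp add: norm_mult mult_left_mono H(2))
    moreover have "2 * (\<bar>g x\<bar> * H) \<le> a * (g x)\<^sup>2 + H\<^sup>2 / a"
    proof -
      have "0 \<le> (a * \<bar>g x\<bar> - H)\<^sup>2 / a" using a by simp
      also have "\<dots> = a * (g x)\<^sup>2 + H\<^sup>2 / a - 2 * (\<bar>g x\<bar> * H)"
        using a by (simp add: power2_diff power_mult_distrib field_simps power2_eq_square)
      finally show ?thesis by linarith
    qed
    ultimately have "2 * norm (of_real (g x) * wave zs x) \<le> a * (g x)\<^sup>2 + H\<^sup>2 / a"
      using mult_left_mono[of "norm (of_real (g x) * wave zs x)" "\<bar>g x\<bar> * H" 2] order_trans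
      by (metis zero_le_numeral)
    then show "norm (of_real (g x) * wave zs x) \<le> (a * (g x)\<^sup>2 + H\<^sup>2 / a) / 2" by simp
  qed
  also have "\<dots> = (a * integral {0..2} (\<lambda>x. (g x)\<^sup>2) + 2 * (H\<^sup>2 / a)) / 2"
    by (subst integral_divide, subst Henstock_Kurzweil_Integration.integral_add)
      (auto intro!: integrable_on_mult_right g2i)
  also have "\<dots> \<le> (a * (1 / (2 * a)) + 2 * (H\<^sup>2 / a)) / 2"
    using small a by (intro divide_right_mono add_right_mono mult_left_mono) auto
  also have "\<dots> = 3 / 4" using H(1) by (simp add: a_def field_simps)
  finally show False by simp
qed

section \<open>Rational step functions\<close>

lemma eventually_at_notin_finite:
  fixes x :: real
  assumes "finite F"
  shows "eventually (\<lambda>y. y \<notin> F) (at x within A)"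
  unfolding eventually_at_topological
proof (intro exI[of _ "- (F - {x})"] conjI)
  show "open (- (F - {x}))" using assms by (intro open_Compl finite_imp_closed) simp
qed auto

lemma common_denominator:
  assumes "finite R" "R \<subseteq> (\<rat> :: real set)"
  shows "\<exists>D::nat>0. \<forall>x\<in>R. x * real D \<in> \<int>"
  using assms
proof (induction R)
  case (insert x R)
  then obtain D :: nat where D: "D > 0" "\<forall>x\<in>R. x * real D \<in> \<int>" by auto
  obtain a b :: int where ab: "b > 0" "x = of_int a / of_int b"
    using insert.prems Rats_cases' by (metis insert_subset)
  have "y * real (D * nat b) \<in> \<int>" if "y \<in> insert x R" for y
  proof (cases "y = x")
    case True
    then have "y * real (D * nat b) = of_int (a * int D)" using ab by (simp add: field_simps)
    then show ?thesis by (metis Ints_of_int)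
  next
    case False
    then have "y * real D * of_int b \<in> \<int>" using D that by auto
    then show ?thesis using ab(1) by (simp add: mult.assoc)
  qed
  moreover have "D * nat b > 0" using D ab by simp
  ultimately show ?case by blast
qed (auto intro: exI[of _ 1])

text \<open>The limit along punctured neighbourhoods is locally constant, hence constant on the
  connected interval; stray values of \<open>\<phi>\<close> at single points do not affect
  it.\<close>

lemma locally_constant_deleted_imp_constant:
  fixes \<phi> :: "real \<Rightarrow> real"
  assumes ev: "\<And>x. x \<in> {a<..<b} \<Longrightarrow> \<exists>c. eventually (\<lambda>y. \<phi> y = c) (at x)"
  shows "\<exists>c. \<forall>x\<in>{a<..<b}. eventually (\<lambda>y. \<phi> y = c) (at x)"
proof -
  define \<psi> where "\<psi> = (\<lambda>x. Lim (at x) \<phi>)"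
  have \<psi>: "\<psi> x = c" if "eventually (\<lambda>y. \<phi> y = c) (at x)" for x c
    unfolding \<psi>_def by (rule tendsto_Lim) (auto intro: tendsto_eventually that)
  have loc: "eventually (\<lambda>y. \<psi> x = \<psi> y) (at x within {a<..<b})" if x: "x \<in> {a<..<b}" for x
  proof -
    obtain c where c: "eventually (\<lambda>y. \<phi> y = c) (at x)" using ev[OF x] by blast
    then obtain T where T: "open T" "x \<in> T" "\<forall>y\<in>T. y \<noteq> x \<longrightarrow> \<phi> y = c"
      by (auto simp: eventually_at_topological)
    have "\<psi> y = c" if "y \<in> T" "y \<noteq> x" for y
    proof (rule \<psi>)
      have "open (T - {x})" using T(1) by (simp add: open_delete)
      then show "eventually (\<lambda>y. \<phi> y = c) (at y)"
        unfolding eventually_at_topological using T that by (intro exI[of _ "T - {x}"]) auto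
    qed
    then show ?thesis unfolding eventually_at_topological using T \<psi>[OF c] by auto
  qed
  have "eventually (\<lambda>y. \<phi> y = \<psi> ((a + b) / 2)) (at x)" if x: "x \<in> {a<..<b}" for x
  proof -
    have "\<psi> x = \<psi> ((a + b) / 2)"
      by (rule connected_local_const[of "{a<..<b}"]) (use x loc in auto)
    then show ?thesis using ev[OF x] \<psi> by metis
  qed
  then show ?thesis by blast
qed

text \<open>The factor \<open>Q\<close> puts further prescribed points on the grid of mesh
  \<open>1 / q\<close>. Between grid points only irrational exceptional points remain, and there the
  second half of \<open>step_rat\<close> forbids a jump.\<close>

lemma step_rat_pieces:
  assumes "step_rat \<phi>" "Q > 0"
  obtains q :: nat and c :: "nat \<Rightarrow> real" and S where "q > 0" "Q dvd q" "finite S"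
    "\<And>j y. j < q \<Longrightarrow> real j / real q < y \<Longrightarrow> y < real (Suc j) / real q \<Longrightarrow> y \<notin> S \<Longrightarrow> \<phi> y = c j"
proof -
  have "\<exists>S. finite S \<and> S \<subseteq> {0<..<1} \<and> (\<forall>x\<in>{0<..<1} - S. \<exists>e>0. \<forall>y. \<bar>y - x\<bar> < e \<longrightarrow> \<phi> y = \<phi> x)"
    and irr: "\<forall>x\<in>{0<..<1} - \<rat>. \<exists>c. \<exists>e>0. \<forall>y. y \<noteq> x \<and> \<bar>y - x\<bar> < e \<longrightarrow> \<phi> y = c"
    using assms(1) unfolding step_rat_def by simp_all
  then obtain S where S: "finite S" "S \<subseteq> {0<..<1}"
    "\<forall>x\<in>{0<..<1} - S. \<exists>e>0. \<forall>y. \<bar>y - x\<bar> < e \<longrightarrow> \<phi> y = \<phi> x"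
    by (elim exE conjE)
  obtain D :: nat where D: "D > 0" "\<And>x. x \<in> S \<inter> \<rat> \<Longrightarrow> x * real D \<in> \<int>"
    using common_denominator[of "S \<inter> \<rat>"] S(1) by auto
  define q where "q = D * Q"
  have q: "q > 0" "Q dvd q" using D assms(2) by (auto simp: q_def)
  have "\<exists>c. \<forall>x\<in>{real j / real q<..<real (Suc j) / real q}. eventually (\<lambda>y. \<phi> y = c) (at x)" if j: "j < q" for j
  proof (rule locally_constant_deleted_imp_constant)
    fix x assume x: "x \<in> {real j / real q<..<real (Suc j) / real q}"
    have "real (Suc j) / real q \<le> 1" using j q by simp
    then have "x < 1" using x less_le_trans[of x "real (Suc j) / real q" 1] by simp
    moreover have "0 < x" using x le_less_trans[of 0 "real j / real q" x] by simp
    ultimately have x01: "x \<in> {0<..<1}" by simp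
    show "\<exists>c. eventually (\<lambda>y. \<phi> y = c) (at x)"
    proof (cases "x \<in> S")
      case False
      then show ?thesis using bspec[OF S(3), of x] x01
        unfolding eventually_at by (metis DiffI dist_real_def)
    next
      case True
      have "x \<notin> \<rat>"
      proof
        assume "x \<in> \<rat>"
        then have "x * real D \<in> \<int>" using D True by blast
        then have "x * real D * real Q \<in> \<int>" by (rule Ints_mult) simp
        then obtain k :: int where k: "x * real q = of_int k" by (auto simp: q_def mult.assoc elim: Ints_cases)
        have "real j < x * real q" "x * real q < real (Suc j)"
          using x q(1) by (auto simp: field_simps)
        then have "int j < k" "k < int (Suc j)" unfolding k by linarith+
        then show False by linarith
      qed
      then show ?thesis using bspec[OF irr, of x] x01
        unfolding eventually_at by (metis DiffI dist_real_def)
    qed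
  qed
  then obtain c where c: "\<And>j x. j < q \<Longrightarrow> x \<in> {real j / real q<..<real (Suc j) / real q} \<Longrightarrow> eventually (\<lambda>y. \<phi> y = c j) (at x)"
    by metis
  have "\<phi> y = c j" if j: "j < q" "real j / real q < y" "y < real (Suc j) / real q" "y \<notin> S" for j y
  proof -
    have "real (Suc j) / real q \<le> 1" using j q by simp
    then have "y < 1" using j(3) less_le_trans[of y "real (Suc j) / real q" 1] by simp
    moreover have "0 < y" using j(2) le_less_trans[of 0 "real j / real q" y] by simp
    ultimately have "y \<in> {0<..<1} - S" using j(4) by simp
    then have "eventually (\<lambda>z. \<phi> z = \<phi> y) (at y)"
      using bspec[OF S(3), of y] unfolding eventually_at by (metis dist_real_def)
    moreover have "eventually (\<lambda>z. \<phi> z = c j) (at y)" using c j by auto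
    ultimately have "eventually (\<lambda>z. \<phi> y = c j) (at y)" by eventually_elim simp
    then show ?thesis by simp
  qed
  with q S(1) show thesis by (rule that)
qed

text \<open>\<open>c j\<close> is the value between \<open>j / q\<close> and
  \<open>(j + 1) / q\<close>. Reflection in 0 exchanges the intervals numbered \<open>j\<close> and
  \<open>- 1 - j\<close>, whence the form of the oddness condition.\<close>

locale odd_profile =
  fixes q :: nat and c :: "int \<Rightarrow> real"
  assumes q: "q > 0" and c_mod: "\<And>j. c (j mod (2 * int q)) = c j" and c_odd: "\<And>j. c (- 1 - j) = - c j"
begin

text \<open>Averaging the two one-sided values makes the function exactly odd, also at the jumps.\<close>
definition step :: "real \<Rightarrow> real" where
  "step x = (c \<lfloor>real q * x\<rfloor> + c (\<lceil>real q * x\<rceil> - 1)) / 2"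

definition J :: "int \<Rightarrow> real" where "J j = c j - c (j - 1)"

definition coef :: "nat \<Rightarrow> real" where
  "coef n = (\<Sum>j<2 * q. J (int j) * cos (pi * real n * real j / real q))"

lemma c_shift: "c (j + 2 * int q * k) = c j"
  by (metis c_mod mod_mult_self2)

lemma J_mod: "J (j mod (2 * int q)) = J j"
proof -
  have "c (j mod (2 * int q) - 1) = c (j - 1)"
    by (metis c_mod mod_diff_left_eq)
  then show ?thesis by (simp add: J_def c_mod)
qed

lemma J_cong: "[i = j] (mod (2 * int q)) \<Longrightarrow> J i = J j"
  by (metis J_mod cong_def)

lemma J_even: "J (- j) = J j"
  using c_odd[of j] c_odd[of "j - 1"] by (simp add: J_def minus_diff_commute)

lemma step_odd: "step (- x) = - step x"
proof -
  have "c \<lfloor>- (real q * x)\<rfloor> = - c (\<lceil>real q * x\<rceil> - 1)"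
    using c_odd[of "\<lceil>real q * x\<rceil> - 1"] by (simp add: floor_minus)
  moreover have "c (\<lceil>- (real q * x)\<rceil> - 1) = - c \<lfloor>real q * x\<rfloor>"
    using c_odd[of "\<lfloor>real q * x\<rfloor>"] by (simp add: ceiling_minus minus_diff_commute)
  ultimately have "step (- x) = (- c (\<lceil>real q * x\<rceil> - 1) + - c \<lfloor>real q * x\<rfloor>) / 2"
    unfolding step_def by simp
  also have "\<dots> = - step x" by (simp add: step_def add_divide_distrib)
  finally show ?thesis .
qed

lemma step_periodic: "step (x + 2 * real k) = step x"
proof -
  have e: "real q * (x + 2 * real k) = real q * x + of_int (2 * int q * int k)" by (simp add: algebra_simps)
  have "c (\<lceil>real q * x\<rceil> + 2 * int q * int k - 1) = c (\<lceil>real q * x\<rceil> - 1)"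
    using c_shift[of "\<lceil>real q * x\<rceil> - 1" "int k"] by (simp add: algebra_simps)
  then show ?thesis unfolding step_def e floor_add_int[symmetric] ceiling_add_of_int c_shift by simp
qed

lemma c_bounded: "\<exists>K. \<forall>j. \<bar>c j\<bar> \<le> K"
proof (intro exI allI)
  fix j
  have "\<bar>c (j mod (2 * int q))\<bar> \<in> (\<lambda>i. \<bar>c i\<bar>) ` {0..<2 * int q}" using q by auto
  then show "\<bar>c j\<bar> \<le> Max ((\<lambda>i. \<bar>c i\<bar>) ` {0..<2 * int q})" by (intro Max_ge) (auto simp: c_mod)
qed

lemma step_bounded: "\<exists>K. \<forall>x. \<bar>step x\<bar> \<le> K"
proof -
  obtain K where K: "\<And>j. \<bar>c j\<bar> \<le> K" using c_bounded by blast
  have "\<bar>step x\<bar> \<le> K" for x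
    using K[of "\<lfloor>real q * x\<rfloor>"] K[of "\<lceil>real q * x\<rceil> - 1"] unfolding step_def by (simp add: abs_le_iff)
  then show ?thesis by blast
qed

lemma step_measurable: "step \<in> borel_measurable borel"
  unfolding step_def by measurable

lemma step_between:
  assumes "of_int j / real q < x" "x < (of_int j + 1) / real q"
  shows "step x = c j"
proof -
  have "of_int j < real q * x" "real q * x < of_int j + 1"
    using assms q by (simp_all add: field_simps)
  then have "\<lfloor>real q * x\<rfloor> = j" "\<lceil>real q * x\<rceil> = j + 1" by linarith+
  then show ?thesis by (simp add: step_def)
qed

text \<open>Integrating the sine over each grid interval leaves differences of cosines; summation by
  parts moves the difference onto \<open>c\<close>, and the end terms cancel by periodicity.\<close>

lemma coef_eq_wave_pairing:
  assumes n: "n > 0"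
  shows "of_real (coef n) = of_real pi * of_nat n * wave_pairing step [] n"
proof -
  define C where "C = (\<lambda>j::nat. cos (pi * real n * real j / real q))"
  define G where "G = (\<lambda>x. step x * sin (pi * (real n * x)))"
  obtain K where K: "\<And>x. \<bar>step x\<bar> \<le> K" using step_bounded by blast
  have Gm: "G \<in> borel_measurable borel" unfolding G_def using step_measurable by measurable
  have Gb: "\<bar>G x\<bar> \<le> K" for x
  proof -
    have "\<bar>step x\<bar> * \<bar>sin (pi * (real n * x))\<bar> \<le> K * 1"
      using K order_trans[OF abs_ge_zero K] by (intro mult_mono) auto
    then show ?thesis by (simp add: G_def abs_mult)
  qed
  have Gi: "G integrable_on {a..b}" for a b by (rule integrable_bounded_measurable[OF Gm Gb])
  have piece: "pi * real n * integral {real j * (1 / real q)..real j * (1 / real q) + 1 / real q} G = c (int j) * (C j - C (Suc j))" for j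
  proof -
    define s where "s = real j / real q"
    define t where "t = real (Suc j) / real q"
    have st: "s \<le> t" by (simp add: s_def t_def divide_right_mono)
    have "((\<lambda>x. c (int j) * sin (pi * (real n * x))) has_integral
      (- c (int j) * cos (pi * (real n * t)) / (pi * real n) - (- c (int j) * cos (pi * (real n * s)) / (pi * real n)))) {s..t}"
      using st n
      by (intro fundamental_theorem_of_calculus)
        (auto intro!: derivative_eq_intros simp flip: has_real_derivative_iff_has_vector_derivative)
    then have "(G has_integral
      (- c (int j) * cos (pi * (real n * t)) / (pi * real n) - (- c (int j) * cos (pi * (real n * s)) / (pi * real n)))) {s..t}"
    proof (rule has_integral_spike_finite[rotated 2])
      show "finite {s, t}" by simp
      fix x assume "x \<in> {s..t} - {s, t}"
      then have "step x = c (int j)" by (intro step_between) (auto simp: s_def t_def add.commute)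
      then show "G x = c (int j) * sin (pi * (real n * x))" by (simp add: G_def)
    qed
    then have "pi * real n * integral {s..t} G = c (int j) * (cos (pi * (real n * s)) - cos (pi * (real n * t)))"
      using n by (simp add: integral_unique field_simps)
    moreover have "real j * (1 / real q) = s" "real j * (1 / real q) + 1 / real q = t"
      by (simp_all add: s_def t_def add_divide_distrib)
    moreover have "cos (pi * (real n * s)) = C j" "cos (pi * (real n * t)) = C (Suc j)"
      by (simp_all only: C_def s_def t_def times_divide_eq_right mult.assoc)
    ultimately show ?thesis by simp
  qed
  have "pi * real n * integral {0..2} G = pi * real n * integral {0..real (2 * q) * (1 / real q)} G"
    using q by simp
  also have "\<dots> = (\<Sum>j<2 * q. pi * real n * integral {real j * (1 / real q)..real j * (1 / real q) + 1 / real q} G)"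
    by (subst integral_split_equal[OF Gi]) (auto simp: sum_distrib_left)
  also have "\<dots> = (\<Sum>j<2 * q. c (int j) * C j) - (\<Sum>j<2 * q. c (int j) * C (Suc j))"
    unfolding piece by (simp add: right_diff_distrib sum_subtractf)
  also have "(\<Sum>j<2 * q. c (int j) * C (Suc j)) = (\<Sum>j<2 * q. c (int j - 1) * C j)"
  proof -
    have "(\<Sum>j<Suc (2 * q). c (int j - 1) * C j) = c (-1) * C 0 + (\<Sum>j<2 * q. c (int j) * C (Suc j))"
      by (subst sum.lessThan_Suc_shift) simp
    moreover have "(\<Sum>j<Suc (2 * q). c (int j - 1) * C j) = (\<Sum>j<2 * q. c (int j - 1) * C j) + c (int (2 * q) - 1) * C (2 * q)"
      by simp
    moreover have "c (int (2 * q) - 1) = c (-1)" using c_shift[of "-1" 1] by simp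
    moreover have "C (2 * q) = C 0"
    proof -
      have "pi * real n * real (2 * q) / real q = 2 * real n * pi" using q by simp
      then show ?thesis unfolding C_def by (simp add: cos_2npi)
    qed
    ultimately show ?thesis by simp
  qed
  also have "(\<Sum>j<2 * q. c (int j) * C j) - (\<Sum>j<2 * q. c (int j - 1) * C j) = coef n"
    by (simp add: coef_def J_def C_def left_diff_distrib sum_subtractf)
  finally have "coef n = pi * real n * integral {0..2} G" by simp
  moreover have "wave_pairing step [] n = of_real (integral {0..2} G)"
  proof -
    have "((\<lambda>x. complex_of_real (G x)) has_integral of_real (integral {0..2} G)) {0..2}"
      using Gi by (intro has_integral_of_real integrable_integral)
    then show ?thesis by (simp add: wave_pairing_def G_def integral_unique)
  qed
  ultimately show ?thesis by simp
qed

lemma euler_sum_coef_nonzero: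
  assumes dense: "\<And>\<epsilon>. \<epsilon> > 0 \<Longrightarrow> \<exists>K c. finite K \<and> K \<subseteq> {1..} \<and>
       integral {0..1} (\<lambda>x. (sin (pi * x) - (\<Sum>k\<in>K. c k * step (real k * x)))\<^sup>2) < \<epsilon>"
    and xs: "admissible xs"
  shows "euler_sum (\<lambda>n. of_real (coef n)) xs 1 \<noteq> 0"
proof -
  obtain K where K: "\<And>x. \<bar>step x\<bar> \<le> K" using step_bounded by blast
  \<comment> \<open>The inverse of the substitution \<open>t = z / p\<close>.\<close>
  define zs where "zs = map (\<lambda>(p, t). (p, t * of_nat p)) xs"
  have zs: "disc_params zs"
    using xs unfolding admissible_def disc_params_def zs_def
    by (auto simp: comp_def case_prod_beta norm_mult field_simps prime_gt_0_nat)
  have "map (\<lambda>(p, z). (p, z / of_nat p)) zs = map (\<lambda>x. x) xs"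
    unfolding zs_def map_map using xs
    by (intro map_cong refl) (auto simp: admissible_def)
  then have "euler_sum (\<lambda>n. of_real (coef n)) xs 1 = of_real pi * of_nat 1 * wave_pairing step zs 1"
    using euler_sum_eq_wave_pairing[OF step_measurable K zs coef_eq_wave_pairing, of 1] by simp
  moreover have "wave_pairing step zs 1 \<noteq> 0"
    by (rule wave_pairing_nonzero[OF step_measurable K step_periodic step_odd dense zs])
  ultimately show ?thesis by simp
qed

end

section \<open>From a rational step function to its profile\<close>

lemma oext_periodic: "oext \<phi> (x + 2 * real k) = oext \<phi> x"
proof -
  have "\<lfloor>(x + 2 * real k) / 2\<rfloor> = \<lfloor>x / 2\<rfloor> + int k"
    by (simp add: add_divide_distrib floor_add_int[of _ "int k", symmetric])
  then show ?thesis by (simp add: oext_def Let_def algebra_simps)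
qed

lemma sin_L2_01: "L2_01 (\<lambda>x. sin (pi * x))"
proof -
  have "set_integrable lborel {0..1} (\<lambda>x. (sin (pi * x))\<^sup>2)"
    by (rule borel_integrable_atLeastAtMost') (auto intro!: continuous_intros)
  then have "set_integrable lborel {0<..<1} (\<lambda>x. (sin (pi * x))\<^sup>2)"
    by (rule set_integrable_subset) auto
  then show ?thesis by (simp add: L2_01_def)
qed

text \<open>\<open>oext \<phi>\<close> and \<open>step\<close> can differ only at grid points,
  exceptional points of \<open>\<phi>\<close> and their periodic or mirror images, finitely many in
  each bounded interval. One-sided limits and integrals ignore these, so jumps and completeness pass
  to \<open>step\<close>.\<close>

theorem step_rat_profile:
  assumes "step_rat \<phi>" "complete_dilates \<phi>" "Q > 0"
  obtains q c where "odd_profile q c" "Q dvd q"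
    "\<And>j. j > 0 \<Longrightarrow> j \<le> 2 * q \<Longrightarrow> jump \<phi> (real j / real q) = odd_profile.J c (int j)"
    "2 * rlim0 \<phi> = odd_profile.J c 0"
    "\<And>xs. admissible xs \<Longrightarrow> euler_sum (\<lambda>n. of_real (odd_profile.coef q c n)) xs 1 \<noteq> 0"
proof -
  obtain q :: nat and c0 and S where q: "q > 0" and qQ: "Q dvd q" and S: "finite S"
    and c0: "\<And>j y. j < q \<Longrightarrow> real j / real q < y \<Longrightarrow> y < real (Suc j) / real q \<Longrightarrow> y \<notin> S \<Longrightarrow> \<phi> y = c0 j"
    by (rule step_rat_pieces[OF assms(1,3)]) (rule that)
  \<comment> \<open>For \<open>1 < x < 2\<close> the odd extension is
    \<open>- \<phi> (2 - x)\<close>, and \<open>2 - x\<close> runs through the interval numbered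
    \<open>2 * q - 1 - r\<close>.\<close>
  define c :: "int \<Rightarrow> real" where "c = (\<lambda>j. let r = nat (j mod (2 * int q)) in if r < q then c0 r else - c0 (2 * q - 1 - r))"
  interpret odd_profile q c
  proof
    show "c (- 1 - j) = - c j" for j
    proof -
      define r where "r = j mod (2 * int q)"
      have r: "0 \<le> r" "r < 2 * int q" using q by (auto simp: r_def)
      have "(- 1 - j) mod (2 * int q) = (- 1 - r) mod (2 * int q)"
        unfolding r_def by (simp add: mod_diff_right_eq)
      also have "\<dots> = (2 * int q - 1 - r) mod (2 * int q)"
        using mod_add_self1[of "2 * int q" "- 1 - r"] by (simp add: algebra_simps)
      also have "\<dots> = 2 * int q - 1 - r" using r by simp
      finally have e: "nat ((- 1 - j) mod (2 * int q)) = 2 * q - 1 - nat r" using r by simp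
      have "nat r < 2 * q" using r by simp
      then show ?thesis unfolding c_def Let_def e r_def[symmetric]
        by (auto simp: not_less)
    qed
  qed (use q in \<open>auto simp: c_def\<close>)
  have c_low: "c (int j) = c0 j" if "j < q" for j using that by (simp add: c_def nat_mod_distrib)
  have c_high: "c (int j) = - c0 (2 * q - 1 - j)" if "q \<le> j" "j < 2 * q" for j
    using that by (simp add: c_def nat_mod_distrib zmod_int)
  have eq0: "oext \<phi> x = step x"
    if x: "0 \<le> x" "x < 2" "real q * x \<notin> \<int>" "x \<notin> S" "2 - x \<notin> S" for x
  proof -
    define j where "j = nat \<lfloor>real q * x\<rfloor>"
    have fl: "\<lfloor>x / 2\<rfloor> = 0" using x by (simp add: floor_eq_iff)
    have nonneg: "0 \<le> \<lfloor>real q * x\<rfloor>" using x by simp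
    then have ij: "int j = \<lfloor>real q * x\<rfloor>" by (simp add: j_def)
    have ne: "real q * x \<noteq> of_int k" for k using x(3) by (metis Ints_of_int)
    have j1: "real j < real q * x" "real q * x < real j + 1"
    proof -
      have "of_int \<lfloor>real q * x\<rfloor> \<le> real q * x" "real q * x < of_int \<lfloor>real q * x\<rfloor> + 1" by linarith+
      moreover have "of_int \<lfloor>real q * x\<rfloor> = real j" using ij by (metis of_int_of_nat_eq)
      ultimately show "real j < real q * x" "real q * x < real j + 1"
        using ne[of "int j"] by auto
    qed
    then have j2: "real j / real q < x" "x < (real j + 1) / real q" using q by (simp_all add: field_simps)
    have st: "step x = c (int j)" using j2 by (intro step_between) simp_all
    have "real q * x < real (2 * q)" using x q by simp
    then have j3: "j < 2 * q" using j1(1) by (metis less_trans of_nat_less_iff)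
    have "x \<noteq> 1" using ne[of "int q"] by auto
    then consider "x < 1" | "x > 1" by linarith
    then show ?thesis
    proof cases
      case 1
      have "real q * x < real q" using 1 q by simp
      then have "j < q" using j1(1) by (metis less_trans of_nat_less_iff)
      moreover have "x > 0" using j2(1) x(1) ne[of 0] by (cases "x = 0") auto
      ultimately show ?thesis using 1 x c0[of j x] j2 c_low st
        by (simp add: oext_def fl add.commute)
    next
      case 2
      have "real q < real q * x" using 2 q by simp
      then have "real q < real j + 1" using j1(2) by linarith
      then have qj: "q \<le> j" by linarith
      have "\<phi> (2 - x) = c0 (2 * q - 1 - j)"
      proof (rule c0)
        show "2 * q - 1 - j < q" using qj q(1) by simp
        have e: "real (2 * q - 1 - j) = 2 * real q - 1 - real j" using j3 by (simp add: of_nat_diff)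
        show "real (2 * q - 1 - j) / real q < 2 - x" unfolding e using j1(2) q(1) by (simp add: field_simps)
        show "2 - x < real (Suc (2 * q - 1 - j)) / real q" unfolding of_nat_Suc e using j1(1) q(1) by (simp add: field_simps)
      qed (use x in simp)
      then show ?thesis using 2 x c_high[OF qj j3] st by (simp add: oext_def fl)
    qed
  qed
  have finX: "finite {x\<in>{0..real N}. oext \<phi> x \<noteq> step x}" for N
  proof -
    define F where "F = (\<lambda>j. real j / real q) ` {..2 * q} \<union> S \<union> (\<lambda>s. 2 - s) ` S"
    have F: "finite F" using S by (simp add: F_def)
    have "{x\<in>{0..real N}. oext \<phi> x \<noteq> step x} \<subseteq> (\<lambda>(k, y). y + 2 * real k) ` ({..N} \<times> F)"
    proof
      fix x assume x: "x \<in> {x\<in>{0..real N}. oext \<phi> x \<noteq> step x}"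
      define k where "k = nat \<lfloor>x / 2\<rfloor>"
      define y where "y = x - 2 * real k"
      have k: "real k = of_int \<lfloor>x / 2\<rfloor>" using x by (simp add: k_def)
      have "of_int \<lfloor>x / 2\<rfloor> \<le> x / 2" "x / 2 < of_int \<lfloor>x / 2\<rfloor> + 1" by linarith+
      then have y: "0 \<le> y" "y < 2" unfolding y_def k by linarith+
      have "real k \<le> real N" using y x unfolding y_def by auto
      then have kN: "k \<le> N" by simp
      have "oext \<phi> y \<noteq> step y" using x oext_periodic[of \<phi> y k] step_periodic[of y k] by (simp add: y_def)
      then have "real q * y \<in> \<int> \<or> y \<in> S \<or> 2 - y \<in> S" using eq0 y by blast
      then have "y \<in> F"
      proof (elim disjE)
        assume "real q * y \<in> \<int>"
        then obtain i :: int where i: "real q * y = of_int i" by (auto elim: Ints_cases)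
        have "0 \<le> real q * y" "real q * y < real q * 2" using y q by simp_all
        then have i2: "0 \<le> i" "i < 2 * int q" unfolding i by linarith+
        have "y = real (nat i) / real q" using i i2 q by (simp add: field_simps)
        then show ?thesis using i2 by (auto simp: F_def intro!: rev_image_eqI[of "nat i"])
      next
        assume "2 - y \<in> S"
        then show ?thesis by (auto simp: F_def intro!: rev_image_eqI[of "2 - y"])
      qed (simp add: F_def)
      then show "x \<in> (\<lambda>(k, y). y + 2 * real k) ` ({..N} \<times> F)"
        using kN by (intro rev_image_eqI[of "(k, y)"]) (auto simp: y_def)
    qed
    then show ?thesis by (rule finite_subset) (use F in simp)
  qed
  have jumps: "jump \<phi> (real j / real q) = J (int j)" if j: "j > 0" "j \<le> 2 * q" for j
  proof -
    define x where "x = real j / real q"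
    \<comment> \<open>The jump is taken at \<open>j / q \<le> 2\<close>, and the right neighbourhood
      used ends at \<open>(j + 1) / q \<le> 3\<close>.\<close>
    define X where "X = {x\<in>{0..real 3}. oext \<phi> x \<noteq> step x}"
    have X: "finite X" unfolding X_def by (rule finX)
    have "real j \<le> real (2 * q)" using j(2) by (rule of_nat_mono)
    moreover have "real q \<ge> 1" using q by simp
    ultimately have j3: "real j + 1 \<le> 3 * real q" by simp
    have qp: "0 < real q" using q by simp
    have jq: "(real j + 1) / real q \<le> 3" unfolding pos_divide_le_eq[OF qp] by (rule j3)
    have jq': "0 \<le> (real j - 1) / real q" using j(1) by simp
    have xl: "x < (real j + 1) / real q" "(real j - 1) / real q < x"
      using qp by (simp_all add: x_def divide_strict_right_mono)
    have "eventually (\<lambda>y. y < (real j + 1) / real q) (at_right x)" "eventually (\<lambda>y. x < y) (at_right x)"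
      by (rule order_tendstoD(2)[OF tendsto_ident_at xl(1)]) (simp add: eventually_at_filter)
    then have "eventually (\<lambda>y. oext \<phi> y = c (int j)) (at_right x)"
      using eventually_at_notin_finite[OF X, of x "{x<..}"]
    proof eventually_elim
      case (elim y)
      have "0 \<le> x" by (simp add: x_def)
      then have "oext \<phi> y = step y" using elim jq by (auto simp: X_def)
      also have "\<dots> = c (int j)" using elim by (intro step_between) (simp_all add: x_def)
      finally show ?case .
    qed
    then have R: "Lim (at_right x) (oext \<phi>) = c (int j)"
      by (intro tendsto_Lim tendsto_eventually) auto
    have "eventually (\<lambda>y. (real j - 1) / real q < y) (at_left x)" "eventually (\<lambda>y. y < x) (at_left x)"
      by (rule order_tendstoD(1)[OF tendsto_ident_at xl(2)]) (simp add: eventually_at_filter)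
    then have "eventually (\<lambda>y. oext \<phi> y = c (int j - 1)) (at_left x)"
      using eventually_at_notin_finite[OF X, of x "{..<x}"]
    proof eventually_elim
      case (elim y)
      have "x \<le> 3" using xl(1) jq by linarith
      then have "oext \<phi> y = step y" using elim jq' by (auto simp: X_def)
      also have "\<dots> = c (int j - 1)" using elim by (intro step_between) (simp_all add: x_def)
      finally show ?case .
    qed
    then have L: "Lim (at_left x) (oext \<phi>) = c (int j - 1)"
      by (intro tendsto_Lim tendsto_eventually) auto
    show ?thesis using R L by (simp add: jump_def J_def x_def)
  qed
  have rl: "2 * rlim0 \<phi> = J 0"
  proof -
    have "(0::real) < 1 / real q" using q by simp
    then have "eventually (\<lambda>y. y < 1 / real q) (at_right 0)"
      by (rule order_tendstoD(2)[OF tendsto_ident_at])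
    moreover have "eventually (\<lambda>y::real. 0 < y) (at_right 0)" by (simp add: eventually_at_filter)
    ultimately have "eventually (\<lambda>y. \<phi> y = c0 0) (at_right 0)"
      using eventually_at_notin_finite[OF S, of 0 "{0<..}"]
      by eventually_elim (use c0[of 0] q in auto)
    then have "rlim0 \<phi> = c0 0" unfolding rlim0_def
      by (intro tendsto_Lim tendsto_eventually) auto
    moreover have "c 0 = c0 0" using c_low[of 0] q by simp
    \<comment> \<open>Oddness gives \<open>c (- 1) = - c 0\<close>, so the jump at 0 is twice the
      right limit.\<close>
    ultimately show ?thesis using c_odd[of 0] by (simp add: J_def)
  qed
  have dense: "\<exists>K d. finite K \<and> K \<subseteq> {1..} \<and>
       integral {0..1} (\<lambda>x. (sin (pi * x) - (\<Sum>k\<in>K. d k * step (real k * x)))\<^sup>2) < \<epsilon>" if "\<epsilon> > 0" for \<epsilon>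
  proof -
    have "\<exists>K d. finite K \<and> K \<subseteq> {1..} \<and>
        set_integrable lborel {0<..<1} (\<lambda>x. (sin (pi * x) - (\<Sum>k\<in>K. d k * oext \<phi> (real k * x)))\<^sup>2) \<and>
        (LINT x:{0<..<1}|lborel. (sin (pi * x) - (\<Sum>k\<in>K. d k * oext \<phi> (real k * x)))\<^sup>2) < \<epsilon>"
      using assms(2)[unfolded complete_dilates_def Let_def, THEN conjunct2, rule_format, OF sin_L2_01 that] .
    then obtain K d where K: "finite K" "K \<subseteq> {1..}"
      and gi: "set_integrable lborel {0<..<1} (\<lambda>x. (sin (pi * x) - (\<Sum>k\<in>K. d k * oext \<phi> (real k * x)))\<^sup>2)"
      and gs: "(LINT x:{0<..<1}|lborel. (sin (pi * x) - (\<Sum>k\<in>K. d k * oext \<phi> (real k * x)))\<^sup>2) < \<epsilon>"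
      by (elim exE conjE)
    have "integral {0..1} (\<lambda>x. (sin (pi * x) - (\<Sum>k\<in>K. d k * oext \<phi> (real k * x)))\<^sup>2) < \<epsilon>"
      using gs set_borel_integral_eq_integral(2)[OF gi] by (simp add: integral_open_interval_real)
    moreover define B where "B = (\<Union>k\<in>K. (\<lambda>y. y / real k) ` {y\<in>{0..real k}. oext \<phi> y \<noteq> step y})"
    have "integral {0..1} (\<lambda>x. (sin (pi * x) - (\<Sum>k\<in>K. d k * oext \<phi> (real k * x)))\<^sup>2)
       = integral {0..1} (\<lambda>x. (sin (pi * x) - (\<Sum>k\<in>K. d k * step (real k * x)))\<^sup>2)"
    proof (rule integral_spike)
      show "negligible B" unfolding B_def using K(1) finX by (intro negligible_finite) auto
      fix x assume x: "x \<in> {0..1} - B"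
      have "oext \<phi> (real k * x) = step (real k * x)" if "k \<in> K" for k
      proof (rule ccontr)
        assume ne: "oext \<phi> (real k * x) \<noteq> step (real k * x)"
        have k: "k > 0" using K(2) that by auto
        have "real k * x \<in> {y\<in>{0..real k}. oext \<phi> y \<noteq> step y}"
          using ne x by (auto simp: mult_left_le)
        then have "x \<in> (\<lambda>y. y / real k) ` {y\<in>{0..real k}. oext \<phi> y \<noteq> step y}"
          using k by (intro rev_image_eqI[of "real k * x"]) auto
        then show False using x that by (auto simp: B_def)
      qed
      then show "(sin (pi * x) - (\<Sum>k\<in>K. d k * step (real k * x)))\<^sup>2 = (sin (pi * x) - (\<Sum>k\<in>K. d k * oext \<phi> (real k * x)))\<^sup>2"
        by simp
    qed
    ultimately show ?thesis using K by auto
  qed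
  show thesis
    by (rule that[OF odd_profile_axioms qQ jumps rl euler_sum_coef_nonzero[OF dense]])
qed

section \<open>Polynomials and arithmetic\<close>

text \<open>Each root \<open>a\<close> has \<open>norm a \<ge> 1\<close>, so its linear factor has
  norm \<open>norm a\<close> at 0 and at most \<open>1 + norm a \<le> 2 * norm a\<close> at
  1.\<close>

lemma poly_no_roots_disc_bound:
  fixes p :: "complex poly"
  assumes "\<And>w. norm w < 1 \<Longrightarrow> poly p w \<noteq> 0"
  shows "norm (poly p 1) \<le> 2 ^ Polynomial.degree p * norm (poly p 0)"
  using assms
proof (induction "Polynomial.degree p" arbitrary: p)
  case 0
  then obtain a where "p = [:a:]" using degree_eq_zeroE by metis
  then show ?case by simp
next
  case (Suc n)
  have "\<not> constant (poly p)" using Suc.hyps(2) by (simp add: constant_degree)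
  then obtain a where a: "poly p a = 0" using Fundamental_Theorem_Algebra.fundamental_theorem_of_algebra by blast
  then obtain r where r: "p = [:- a, 1:] * r" by (auto simp: poly_eq_0_iff_dvd)
  have "norm a \<ge> 1" using Suc.prems[of a] a by force
  have "r \<noteq> 0" using r Suc.hyps(2) by auto
  then have "Polynomial.degree p = Polynomial.degree [:- a, 1:] + Polynomial.degree r"
    unfolding r by (intro degree_mult_eq) auto
  then have deg: "Polynomial.degree p = Suc (Polynomial.degree r)" by simp
  have "norm (poly r 1) \<le> 2 ^ Polynomial.degree r * norm (poly r 0)"
    using Suc.hyps deg Suc.prems r by (intro Suc.hyps(1)) auto
  moreover have "norm (1 - a) \<le> 2 * norm a"
    using norm_triangle_ineq4[of 1 a] \<open>norm a \<ge> 1\<close> by simp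
  ultimately have "norm (1 - a) * norm (poly r 1) \<le> (2 * norm a) * (2 ^ Polynomial.degree r * norm (poly r 0))"
    by (intro mult_mono) auto
  moreover have "poly p 1 = (1 - a) * poly r 1" "poly p 0 = - a * poly r 0"
    unfolding r by (simp_all add: algebra_simps)
  ultimately show ?case unfolding deg by (simp add: norm_mult mult_ac)
qed

text \<open>The real polynomial has no zero on \<open>[0, 1)\<close>, so its constant term inherits
  the sign of its value at 1, and the root bound gives the size. The factor \<open>2 ^ N\<close> is
  independent of the coefficients, so the estimate survives limits.\<close>

lemma nonvanishing_constant_term_ge:
  fixes A :: "'a \<Rightarrow> real" and e :: "'a \<Rightarrow> nat"
  assumes D: "finite D" "\<And>d. d \<in> D \<Longrightarrow> e d \<le> N"
    and nz: "\<And>w::complex. norm w < 1 \<Longrightarrow> (\<Sum>d\<in>D. of_real (A d) * w ^ e d) \<noteq> 0"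
    and pos: "(\<Sum>d\<in>D. A d) > 0"
  shows "(\<Sum>d\<in>D. A d) / 2 ^ N \<le> (\<Sum>d\<in>{d\<in>D. e d = 0}. A d)"
proof -
  define P where "P = (\<Sum>d\<in>D. Polynomial.monom (complex_of_real (A d)) (e d))"
  define g where "g = (\<lambda>x::real. \<Sum>d\<in>D. A d * x ^ e d)"
  have P: "poly P w = (\<Sum>d\<in>D. of_real (A d) * w ^ e d)" for w
    by (simp add: P_def poly_sum poly_monom)
  have Pg: "poly P (of_real x) = of_real (g x)" for x by (simp add: P g_def)
  have deg: "Polynomial.degree P \<le> N" unfolding P_def
    by (rule degree_sum_le) (use D degree_monom_le order_trans in blast)+
  have g0: "g 0 = (\<Sum>d\<in>{d\<in>D. e d = 0}. A d)"
    unfolding g_def using D(1) by (simp add: sum.inter_filter power_0_left if_distrib[of "\<lambda>x. _ * x"] cong: if_cong)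
  have g1: "g 1 = (\<Sum>d\<in>D. A d)" by (simp add: g_def)
  have "norm (poly P 1) \<le> 2 ^ Polynomial.degree P * norm (poly P 0)"
    by (rule poly_no_roots_disc_bound) (simp add: P nz)
  also have "\<dots> \<le> 2 ^ N * norm (poly P 0)"
    using deg by (intro mult_right_mono power_increasing) auto
  also have "norm (poly P 0) = \<bar>g 0\<bar>" by (metis Pg norm_of_real of_real_0)
  also have "norm (poly P 1) = g 1" by (metis Pg abs_of_pos g1 norm_of_real of_real_1 pos)
  finally have le: "g 1 / 2 ^ N \<le> \<bar>g 0\<bar>" by (simp add: field_simps)
  have "g 0 \<ge> 0"
  proof (rule ccontr)
    assume "\<not> g 0 \<ge> 0"
    moreover have "continuous_on {0..1} g" unfolding g_def by (intro continuous_intros)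
    ultimately obtain x where x: "0 \<le> x" "x \<le> 1" "g x = 0"
      using IVT'[of g 0 0 1] pos g1 by auto
    then have "x \<noteq> 1" using pos g1 by auto
    then have "norm (complex_of_real x) < 1" using x by simp
    then have "poly P (of_real x) \<noteq> 0" using nz P by simp
    then show False using Pg x by simp
  qed
  then show ?thesis using le g0 g1 by simp
qed

section \<open>Lifting units, square roots up to sign, and divisor sums\<close>

lemma exists_coprime_lift:
  fixes a L N :: nat
  assumes "L > 0" "coprime a L" "N > 0"
  shows "\<exists>s. [s = a] (mod L) \<and> coprime s N"
proof -
  \<comment> \<open>Only these primes need avoiding; a common prime of \<open>N\<close> and
    \<open>L\<close> is excluded because the residue \<open>a\<close> is a unit modulo
    \<open>L\<close>.\<close>
  define V where "V = {p\<in>prime_factors N. \<not> p dvd L}"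
  have "finite V" by (simp add: V_def)
  have "\<exists>n>0. [n = a] (mod L) \<and> (\<forall>p\<in>V. \<not> p dvd n)"
  proof (rule exists_residue_avoiding_primes[OF assms(1,2)])
    show "(\<Sum>p\<in>W. 1 / real p) \<le> (\<Sum>p\<in>V. 1 / real p)" if "W \<subseteq> V" for W
      using \<open>finite V\<close> that by (intro sum_mono2) auto
  qed (auto simp: V_def)
  then obtain n where n: "n > 0" "[n = a] (mod L)" "\<And>p. p \<in> V \<Longrightarrow> \<not> p dvd n" by blast
  have "coprime n N"
  proof (rule ccontr)
    assume "\<not> coprime n N"
    then have "gcd n N \<noteq> 1" using coprime_iff_gcd_eq_1 by blast
    then obtain p where p: "prime p" "p dvd gcd n N" using prime_factor_nat by blast
    then have "p dvd n" "p dvd N" by auto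
    then have "p dvd L" using n(3)[of p] p(1) assms(3) by (auto simp: V_def prime_factors_dvd)
    moreover have "coprime n L" using n(2) assms(2) by (metis cong_imp_coprime cong_sym)
    ultimately show False using \<open>p dvd n\<close> p(1) by (metis coprime_common_divisor not_prime_unit)
  qed
  then show ?thesis using n(2) by blast
qed

text \<open>The unit group modulo \<open>p ^ k\<close> has order \<open>2 * e\<close> with
  \<open>e\<close> odd, because \<open>p \<equiv> 3\<close> modulo 4. Then \<open>v ^ e\<close> is a
  square root of 1, hence 1 or -1, and \<open>v ^ ((e + 1) div 2)\<close> squares to
  \<open>v * v ^ e\<close>.\<close>

lemma exists_sqrt_up_to_sign:
  fixes p k v :: nat
  assumes p: "prime p" "p mod 4 = 3" and k: "k > 0" and v: "coprime v p"
  shows "\<exists>s. coprime s p \<and> ([int s ^ 2 = int v] (mod int (p ^ k)) \<or> [int s ^ 2 = - int v] (mod int (p ^ k)))"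
proof -
  obtain a where a: "p = 4 * a + 3" using p(2) by (metis mod_mult_div_eq add.commute mult.commute)
  define e where "e = p ^ (k - 1) * (2 * a + 1)"
  have "odd p" using a by simp
  then have "odd e" by (simp add: e_def)
  have tot: "totient (p ^ k) = 2 * e"
    using totient_prime_power[OF p(1) k] by (simp add: e_def a)
  define x where "x = int (v ^ e)"
  have "[v ^ totient (p ^ k) = 1] (mod p ^ k)"
    using v by (intro euler_theorem) simp
  then have "[int (v ^ (2 * e)) = int 1] (mod int (p ^ k))" unfolding tot by (simp only: cong_int_iff)
  then have "[x * x = 1] (mod int (p ^ k))"
    by (simp add: x_def mult_2 power_add)
  then have "int (p ^ k) dvd x * x - 1" by (simp add: cong_iff_dvd_diff)
  also have "x * x - 1 = (x - 1) * (x + 1)" by (simp add: algebra_simps)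
  finally have dvd: "int (p ^ k) dvd (x - 1) * (x + 1)" .
  have pint: "prime (int p)" using p(1) by simp
  \<comment> \<open>The factors differ by 2, so the odd prime \<open>p\<close> divides at most one
    of them and the whole power goes into the other's partner.\<close>
  have "int (p ^ k) dvd x - 1 \<or> int (p ^ k) dvd x + 1"
  proof (cases "int p dvd x - 1")
    case True
    have "\<not> int p dvd x + 1"
    proof
      assume "int p dvd x + 1"
      then have "int p dvd (x + 1) - (x - 1)" using True by (rule dvd_diff)
      then have "int p dvd 2" by simp
      then have "int p \<le> 2" by (rule zdvd_imp_le) simp
      then show False using a by simp
    qed
    then have "coprime (int (p ^ k)) (x + 1)"
      using pint by (simp add: prime_imp_coprime)
    then show ?thesis using dvd by (simp add: coprime_dvd_mult_left_iff)
  next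
    case False
    then have "coprime (int (p ^ k)) (x - 1)" using pint by (simp add: prime_imp_coprime)
    then show ?thesis using dvd by (simp add: coprime_dvd_mult_right_iff)
  qed
  then have x: "[x = 1] (mod int (p ^ k)) \<or> [x = - 1] (mod int (p ^ k))"
    by (simp add: cong_iff_dvd_diff)
  define s where "s = v ^ ((e + 1) div 2)"
  have "2 * ((e + 1) div 2) = e + 1" using \<open>odd e\<close> by presburger
  then have "s ^ 2 = v ^ (e + 1)" by (simp only: s_def power_mult[symmetric] mult.commute)
  then have "int s ^ 2 = int v * x" by (simp add: x_def flip: of_nat_power)
  then have "[int s ^ 2 = int v] (mod int (p ^ k)) \<or> [int s ^ 2 = - int v] (mod int (p ^ k))"
    using x cong_scalar_left[of x 1 _ "int v"] cong_scalar_left[of x "-1" _ "int v"] by auto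
  moreover have "coprime s p" using v by (simp add: s_def)
  ultimately show ?thesis by blast
qed

text \<open>Moebius inversion on an initial segment: the system is triangular, so
  \<open>h (Suc N)\<close> is fixed by the earlier values.\<close>

lemma divisor_sum_inversion:
  fixes F :: "nat \<Rightarrow> real"
  shows "\<exists>h. \<forall>n. 0 < n \<and> n \<le> N \<longrightarrow> F n = (\<Sum>d | d dvd n. h d)"
proof (induction N)
  case (Suc N)
  then obtain h where h: "\<And>n. 0 < n \<Longrightarrow> n \<le> N \<Longrightarrow> F n = (\<Sum>d | d dvd n. h d)" by blast
  define h' where "h' = h(Suc N := F (Suc N) - (\<Sum>d | d dvd Suc N \<and> d \<noteq> Suc N. h d))"
  have "F n = (\<Sum>d | d dvd n. h' d)" if n: "0 < n" "n \<le> Suc N" for n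
  proof (cases "n = Suc N")
    case True
    have "{d. d dvd Suc N} = insert (Suc N) {d. d dvd Suc N \<and> d \<noteq> Suc N}" by auto
    moreover have "finite {d. d dvd Suc N \<and> d \<noteq> Suc N}" by simp
    ultimately have "(\<Sum>d | d dvd Suc N. h' d) = h' (Suc N) + (\<Sum>d | d dvd Suc N \<and> d \<noteq> Suc N. h' d)"
      by simp
    also have "(\<Sum>d | d dvd Suc N \<and> d \<noteq> Suc N. h' d) = (\<Sum>d | d dvd Suc N \<and> d \<noteq> Suc N. h d)"
      by (rule sum.cong) (auto simp: h'_def)
    finally show ?thesis unfolding True by (simp add: h'_def)
  next
    case False
    then have "(\<Sum>d | d dvd n. h' d) = (\<Sum>d | d dvd n. h d)"
      using n by (intro sum.cong) (auto simp: h'_def dest!: dvd_imp_le)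
    then show ?thesis using h n False by simp
  qed
  then show ?case by blast
qed auto

lemma euler_sum_shift: "euler_sum f xs (k * n) = euler_sum (\<lambda>m. f (m * n)) xs k"
proof (induction xs arbitrary: k)
  case (Cons a xs)
  obtain p t where a: "a = (p, t)" by force
  have "euler_sum f xs (p ^ j * (k * n)) = euler_sum (\<lambda>m. f (m * n)) xs (p ^ j * k)" for j
    using Cons.IH[of "p ^ j * k"] by (simp add: mult.assoc)
  then show ?case by (simp add: a)
qed simp

text \<open>Only multiples of \<open>d\<close> composed of the listed primes count. Their exponents
  vary independently from \<open>multiplicity p d\<close> upwards, which gives a product of
  geometric tails; no such multiple exists if \<open>d\<close> has another prime.\<close>

lemma euler_sum_divisibility:
  assumes "admissible xs" "d > 0"
  shows "euler_sum (\<lambda>n. if d dvd n then 1 else 0) xs 1 =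
    (if prime_factors d \<subseteq> fst ` set xs then (\<Prod>(p, t)\<in>set xs. t ^ multiplicity p d / (1 - t)) else 0)"
  using assms
proof (induction xs arbitrary: d)
  case Nil
  then show ?case by (auto simp: prime_factorization_empty_iff)
next
  case (Cons x xs)
  obtain p t where x: "x = (p, t)" by force
  have p: "prime p" "p \<notin> fst ` set xs" "admissible xs" and t: "norm t < 1"
    using Cons.prems norm_less_one_of_prime by (auto simp: x admissible_Cons)
  define a where "a = multiplicity p d"
  obtain e where e: "d = p ^ a * e" "\<not> p dvd e"
    using multiplicity_decompose'[of d p] Cons.prems(2) not_prime_unit p(1) unfolding a_def by blast
  have e0: "e > 0" using e(1) Cons.prems(2) by (cases "e = 0") auto
  have p0: "p > 0" using p(1) prime_gt_0_nat by blast
  have pe: "coprime (p ^ i) e" for i using p(1) e(2) by (simp add: prime_imp_coprime)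
  define W where "W = (if prime_factors e \<subseteq> fst ` set xs then (\<Prod>(p, t)\<in>set xs. t ^ multiplicity p e / (1 - t)) else 0)"
  \<comment> \<open>For \<open>j < a\<close> the remaining divisor still contains \<open>p\<close>,
    which the rest of the list lacks, so the sum is 0; from \<open>j = a\<close> on only the part
    \<open>e\<close> prime to \<open>p\<close> matters.\<close>
  have tail: "euler_sum (\<lambda>n. if d dvd n then 1 else 0) xs (p ^ j * 1) = (if j < a then 0 else W)" for j
  proof (cases "j < a")
    case True
    have "d dvd m * p ^ j \<longleftrightarrow> p ^ (a - j) * e dvd m" for m
    proof -
      have "d = p ^ j * (p ^ (a - j) * e)" using e(1) True by (simp flip: power_add mult.assoc)
      then have "d dvd m * p ^ j \<longleftrightarrow> p ^ j * (p ^ (a - j) * e) dvd p ^ j * m" by (simp only: mult.commute)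
      then show ?thesis using p0 by simp
    qed
    then have "euler_sum (\<lambda>n. if d dvd n then 1 else 0) xs (p ^ j * 1) =
       euler_sum (\<lambda>n. if p ^ (a - j) * e dvd n then 1 else 0) xs 1"
      using euler_sum_shift[of "\<lambda>n. if d dvd n then 1 else 0" xs 1 "p ^ j"] by simp
    also have "\<dots> = 0"
    proof -
      have "p \<in> prime_factors (p ^ (a - j) * e)"
        using True p(1) e0 p0 by (auto simp: prime_factors_dvd dvd_mult2 dvd_power)
      then show ?thesis using Cons.IH[OF p(3), of "p ^ (a - j) * e"] p(2) p0 e0 by auto
    qed
    finally show ?thesis using True by simp
  next
    case False
    have "d dvd m * p ^ j \<longleftrightarrow> e dvd m" for m
    proof
      assume "d dvd m * p ^ j"
      then have "e dvd m * p ^ j" using e(1) by (metis dvd_mult_right)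
      then show "e dvd m" using pe[of j] by (simp add: coprime_dvd_mult_left_iff coprime_commute)
    next
      assume "e dvd m"
      moreover have "p ^ a dvd p ^ j" using False by (simp add: le_imp_power_dvd)
      ultimately show "d dvd m * p ^ j" unfolding e(1) by (metis mult.commute mult_dvd_mono)
    qed
    then have "euler_sum (\<lambda>n. if d dvd n then 1 else 0) xs (p ^ j * 1) =
       euler_sum (\<lambda>n. if e dvd n then 1 else 0) xs 1"
      using euler_sum_shift[of "\<lambda>n. if d dvd n then 1 else 0" xs 1 "p ^ j"] by simp
    also have "\<dots> = W" using Cons.IH[OF p(3) e0] by (simp add: W_def)
    finally show ?thesis using False by simp
  qed
  have "(\<lambda>j. t ^ (j + a) * (if j + a < a then 0 else W)) sums (t ^ a * W * (1 / (1 - t)))"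
    using sums_mult[OF geometric_sums[OF t], of "t ^ a * W"] by (simp add: power_add mult_ac)
  then have "(\<lambda>j. t ^ j * (if j < a then 0 else W)) sums (t ^ a * W * (1 / (1 - t)))"
    by (subst (asm) sums_zero_iff_shift) auto
  then have sum: "euler_sum (\<lambda>n. if d dvd n then 1 else 0) (x # xs) 1 = t ^ a / (1 - t) * W"
    by (simp only: x euler_sum.simps tail) (simp add: sums_iff)
  have "prime_factors d \<subseteq> fst ` set (x # xs) \<longleftrightarrow> prime_factors e \<subseteq> fst ` set xs"
  proof
    assume L: "prime_factors d \<subseteq> fst ` set (x # xs)"
    show "prime_factors e \<subseteq> fst ` set xs"
    proof
      fix r assume r: "r \<in> prime_factors e"
      then have "r \<in> prime_factors d" using e Cons.prems(2) by (auto simp: prime_factors_dvd)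
      moreover have "r \<noteq> p" using r e(2) by (auto simp: prime_factors_dvd)
      ultimately show "r \<in> fst ` set xs" using L by (auto simp: x)
    qed
  next
    assume R: "prime_factors e \<subseteq> fst ` set xs"
    show "prime_factors d \<subseteq> fst ` set (x # xs)"
    proof
      fix r assume r: "r \<in> prime_factors d"
      then have rp: "prime r" "r dvd p ^ a * e" using e(1) by (auto simp: prime_factors_dvd)
      then have "r dvd p ^ a \<or> r dvd e" by (simp add: prime_dvd_mult_iff)
      then have "r = p \<or> r \<in> prime_factors e"
        using rp(1) p(1) e0 by (metis in_prime_factors_iff not_gr_zero prime_dvd_power primes_dvd_imp_eq)
      then show "r \<in> fst ` set (x # xs)" using R by (auto simp: x)
    qed
  qed
  moreover have "(\<Prod>(r, s)\<in>set (x # xs). s ^ multiplicity r d / (1 - s)) = t ^ a / (1 - t) * (\<Prod>(r, s)\<in>set xs. s ^ multiplicity r e / (1 - s))"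
  proof -
    have "x \<notin> set xs" using p(2) x by force
    moreover have "(\<Prod>(r, s)\<in>set xs. s ^ multiplicity r d / (1 - s)) = (\<Prod>(r, s)\<in>set xs. s ^ multiplicity r e / (1 - s))"
    proof (rule prod.cong[OF refl], clarify)
      fix r s assume rs: "(r, s) \<in> set xs"
      then have "prime r" "r \<noteq> p" using p by (auto simp: admissible_def rev_image_eqI)
      then have "multiplicity r d = multiplicity r e"
        using p(1) e e0 p0 by (simp add: prime_elem_multiplicity_mult_distrib multiplicity_distinct_prime_power)
      then show "s ^ multiplicity r d / (1 - s) = s ^ multiplicity r e / (1 - s)" by simp
    qed
    ultimately show ?thesis by (simp add: x a_def)
  qed
  ultimately show ?case unfolding sum W_def by simp
qed

lemma euler_sum_linear:
  assumes "admissible xs" "finite D" "\<And>d n. norm (g d n) \<le> 1"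
  shows "euler_sum (\<lambda>n. \<Sum>d\<in>D. A d * g d n) xs n = (\<Sum>d\<in>D. A d * euler_sum (g d) xs n)"
  using assms(1)
proof (induction xs arbitrary: n)
  case (Cons x xs)
  obtain p t where x: "x = (p, t)" by force
  have adm: "admissible xs" and t: "norm t < 1"
    using Cons.prems norm_less_one_of_prime by (auto simp: x admissible_Cons)
  have "(\<lambda>j. \<Sum>d\<in>D. A d * (t ^ j * euler_sum (g d) xs (p ^ j * n))) sums (\<Sum>d\<in>D. A d * euler_sum (g d) (x # xs) n)"
  proof (intro sums_sum sums_mult)
    fix d
    obtain C where "\<And>n. norm (euler_sum (g d) xs n) \<le> C"
      using euler_sum_bounded[of "g d" 1 xs] assms(3) admissible_norm_less_one[OF adm] by blast
    then have "summable (\<lambda>j. t ^ j * euler_sum (g d) xs (p ^ j * n))"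
      by (intro summable_power_bounded[OF t])
    then show "(\<lambda>j. t ^ j * euler_sum (g d) xs (p ^ j * n)) sums euler_sum (g d) (x # xs) n"
      by (simp add: x summable_sums)
  qed
  moreover have "(\<Sum>d\<in>D. A d * (t ^ j * euler_sum (g d) xs (p ^ j * n))) =
     t ^ j * euler_sum (\<lambda>n. \<Sum>d\<in>D. A d * g d n) xs (p ^ j * n)" for j
    by (simp add: Cons.IH[OF adm] sum_distrib_left mult_ac)
  ultimately show ?case by (simp add: x sums_iff)
qed simp

section \<open>The jumps\<close>

lemma prod_primes_dvd:
  fixes d :: nat
  assumes "finite S" "\<And>p. p \<in> S \<Longrightarrow> prime p \<and> p dvd d"
  shows "\<Prod>S dvd d"
  using assms
proof (induction S)
  case (insert p S)
  have "coprime p (\<Prod>S)"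
    by (rule prod_coprime_right, rule primes_coprime) (use insert in auto)
  then have "p * \<Prod>S dvd d" using insert by (intro divides_mult) auto
  then show ?case using insert by simp
qed simp

lemma sum_cos_pick:
  fixes K :: "int \<Rightarrow> real" and q :: nat and j :: int
  assumes q: "q > 0" and per: "\<And>i. K (i mod (2 * int q)) = K i"
  shows "(\<Sum>i<2 * q. K (int i) * (if int (2 * q) dvd int i - j then real (2 * q) else 0)) = real (2 * q) * K j"
proof -
  define i0 where "i0 = nat (j mod (2 * int q))"
  have i0: "int i0 = j mod (2 * int q)" "i0 < 2 * q" using q by (simp_all add: i0_def nat_less_iff)
  have "(\<Sum>i<2 * q. K (int i) * (if int (2 * q) dvd int i - j then real (2 * q) else 0))
    = (\<Sum>i<2 * q. if i = i0 then K (int i0) * real (2 * q) else 0)"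
  proof (rule sum.cong[OF refl])
    fix i assume i: "i \<in> {..<2 * q}"
    have "int (2 * q) dvd int i - j \<longleftrightarrow> int i mod (2 * int q) = j mod (2 * int q)"
      by (simp add: mod_eq_dvd_iff)
    also have "\<dots> \<longleftrightarrow> i = i0" using i by (simp flip: i0(1))
    finally show "K (int i) * (if int (2 * q) dvd int i - j then real (2 * q) else 0)
      = (if i = i0 then K (int i0) * real (2 * q) else 0)" by simp
  qed
  also have "\<dots> = real (2 * q) * K j" using i0 per[of j] by simp
  finally show ?thesis .
qed

locale cyclic_profile = odd_profile +
  assumes nz: "\<And>xs. admissible xs \<Longrightarrow> euler_sum (\<lambda>n. of_real (coef n)) xs 1 \<noteq> 0"
begin

lemma cos_cong:
  assumes "[m = n] (mod 2 * q)"
  shows "cos (pi * real m * of_int j / real q) = cos (pi * real n * of_int j / real q)"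
proof -
  have "int (2 * q) dvd int m - int n" using assms by (metis cong_iff_dvd_diff cong_int_iff)
  then obtain k where k: "int m - int n = int (2 * q) * k" by blast
  have "real m = real n + of_int (int m - int n)" by simp
  then have "pi * real m * of_int j / real q = pi * real n * of_int j / real q + of_int (k * j) * (2 * pi)"
    unfolding k using q by (simp add: field_simps)
  then show ?thesis using cos.plus_of_int[of "pi * real n * of_int j / real q" "k * j"] by simp
qed

lemma coef_cong: "[m = n] (mod 2 * q) \<Longrightarrow> coef m = coef n"
  unfolding coef_def using cos_cong[of m n "int _"] by simp

sublocale nonvanishing_periodic "\<lambda>n. of_real (coef n)" "2 * q"
  by standard (use q nz in \<open>auto intro: coef_cong\<close>)

lemma coef1: "coef 1 \<noteq> 0" using f1_nonzero by simp

lemma coef_mult: "coprime u (2 * q) \<Longrightarrow> coef (u * n) * coef 1 = coef u * coef n"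
  using good_of_coprime[of u] unfolding good_def by (metis of_real_eq_iff of_real_mult)

definition chi :: "nat \<Rightarrow> real" where "chi u = coef u / coef 1"

lemma coef_twist: "coprime u (2 * q) \<Longrightarrow> coef (u * n) = chi u * coef n"
  using coef_mult[of u n] coef1 by (simp add: chi_def field_simps)

lemma chi_mult: "coprime u (2 * q) \<Longrightarrow> chi (u * v) = chi u * chi v"
  using coef_twist[of u v] by (simp add: chi_def)

lemma chi_cong: "[u = v] (mod 2 * q) \<Longrightarrow> chi u = chi v"
  using coef_cong by (simp add: chi_def)

text \<open>By Euler's theorem \<open>chi u\<close> is a root of unity, and it is real.\<close>

lemma chi_square:
  assumes u: "coprime u (2 * q)"
  shows "chi u * chi u = 1"
proof -
  have "chi (u ^ k) = chi u ^ k" for k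
    using u coef1 by (induction k) (simp_all add: chi_mult, simp add: chi_def)
  moreover have "chi (u ^ totient (2 * q)) = chi 1"
    using u by (intro chi_cong euler_theorem)
  ultimately have "chi u ^ totient (2 * q) = 1" using coef1 by (simp add: chi_def)
  then have "\<bar>chi u\<bar> ^ totient (2 * q) = 1" by (simp flip: power_abs)
  then have "\<bar>chi u\<bar> = 1" using q power_eq_1_iff[of "\<bar>chi u\<bar>" "totient (2 * q)"] by auto
  then show ?thesis by (metis abs_mult_self_eq mult_1)
qed

text \<open>Up to the factor \<open>2 * q\<close>, transforming twice returns the mean of
  \<open>J j\<close> and \<open>J (- j)\<close>, which coincide because the jumps of an odd function
  are even.\<close>

lemma coef_inversion: "(\<Sum>n<2 * q. coef n * cos (pi * real n * of_int j / real q)) = real (2 * q) * J j"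
proof -
  let ?c = "\<lambda>i k n. cos (2 * pi * real n * of_int (int i - k) / real (2 * q))"
  let ?d = "\<lambda>i k. if int (2 * q) dvd int i - k then real (2 * q) else 0"
  have prod: "cos (pi * real n * real i / real q) * cos (pi * real n * of_int j / real q)
    = (?c i j n + ?c i (- j) n) / 2" for n i
  proof -
    have "2 * pi * real n * of_int (int i - j) / real (2 * q) = pi * real n * real i / real q - pi * real n * of_int j / real q"
      "2 * pi * real n * of_int (int i - (- j)) / real (2 * q) = pi * real n * real i / real q + pi * real n * of_int j / real q"
      using q by (simp_all add: field_simps)
    then show ?thesis by (simp add: cos_times_cos)
  qed
  have "(\<Sum>n<2 * q. coef n * cos (pi * real n * of_int j / real q))
    = (\<Sum>n<2 * q. \<Sum>i<2 * q. J (int i) * ((?c i j n + ?c i (- j) n) / 2))"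
    unfolding coef_def sum_distrib_right
    by (intro sum.cong refl trans[OF mult.assoc] arg_cong2[where f = "(*)"] prod)
  also have "\<dots> = (\<Sum>i<2 * q. \<Sum>n<2 * q. J (int i) * ((?c i j n + ?c i (- j) n) / 2))"
    by (rule sum.swap)
  also have "\<dots> = (\<Sum>i<2 * q. J (int i) * (((\<Sum>n<2 * q. ?c i j n) + (\<Sum>n<2 * q. ?c i (- j) n)) / 2))"
    by (simp only: sum_distrib_left[symmetric] sum_divide_distrib[symmetric] sum.distrib)
  also have "\<dots> = (\<Sum>i<2 * q. J (int i) * ((?d i j + ?d i (- j)) / 2))"
    using q by (subst (1 2) sum_cos_multiples) simp_all
  also have "\<dots> = ((\<Sum>i<2 * q. J (int i) * ?d i j) + (\<Sum>i<2 * q. J (int i) * ?d i (- j))) / 2"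
    by (simp only: add_divide_distrib distrib_left sum.distrib sum_divide_distrib times_divide_eq_right)
  also have "\<dots> = (real (2 * q) * J j + real (2 * q) * J (- j)) / 2"
    by (simp only: sum_cos_pick[where K = J and q = q, OF q J_mod])
  finally show ?thesis by (simp add: J_even)
qed

text \<open>Inserting \<open>coef (u * n) = chi u * coef n\<close> into the inversion formula and
  permuting the frequencies by \<open>u\<close> carries the character over to the jumps.\<close>

lemma J_twist:
  assumes u: "coprime u (2 * q)"
  shows "chi u * J (int u * j) = J j"
proof -
  define g where "g = (\<lambda>n. coef n * cos (pi * real n * of_int j / real q))"
  have g: "g (u * n) = g (u * n mod (2 * q))" for n
    unfolding g_def using cos_cong[of "u * n" "u * n mod (2 * q)" j] coef_cong[of "u * n" "u * n mod (2 * q)"] by (simp add: cong_def)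
  have "real (2 * q) * (chi u * J (int u * j)) = chi u * (\<Sum>n<2 * q. coef n * cos (pi * real n * of_int (int u * j) / real q))"
    unfolding coef_inversion by simp
  also have "\<dots> = (\<Sum>n<2 * q. g (u * n))"
    unfolding sum_distrib_left
  proof (rule sum.cong[OF refl])
    fix n
    have eq: "pi * real n * of_int (int u * j) / real q = pi * real (u * n) * of_int j / real q"
      by (simp add: mult_ac)
    show "chi u * (coef n * cos (pi * real n * of_int (int u * j) / real q)) = g (u * n)"
      unfolding g_def coef_twist[OF u] eq by (rule mult.assoc[symmetric])
  qed
  also have "\<dots> = (\<Sum>n<2 * q. g (u * n mod (2 * q)))" using g by simp
  also have "\<dots> = (\<Sum>n<2 * q. g n)"
    using q u by (intro sum.reindex_bij_betw[OF bij_betw_mult_mod]) auto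
  also have "\<dots> = real (2 * q) * J j" unfolding g_def by (rule coef_inversion)
  finally show ?thesis using q by simp
qed

text \<open>Up to sign, \<open>n / m\<close> is a square modulo \<open>p ^ k\<close>, with a root
  \<open>s\<close> that lifts to a unit modulo \<open>2 * q\<close>. Squares have character value 1,
  and evenness of \<open>J\<close> absorbs the sign.\<close>

lemma J_3_mod_4:
  assumes p: "prime p" "p mod 4 = 3" and k: "k > 0" and dvd: "p ^ k dvd q"
    and mn: "\<not> p dvd m" "\<not> p dvd n" "even (int m - int n)"
  shows "J (int (m * (q div p ^ k))) = J (int (n * (q div p ^ k)))"
proof -
  define r where "r = q div p ^ k"
  have r: "q = p ^ k * r" using dvd by (simp add: r_def)
  \<comment> \<open>The quotient \<open>n / m\<close> modulo \<open>p ^ k\<close>; the power of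
    \<open>m\<close> is its inverse by Euler's theorem.\<close>
  define v where "v = n * m ^ (totient (p ^ k) - 1)"
  have co: "coprime m p" "coprime n p" using mn p(1) prime_imp_coprime coprime_commute by blast+
  then obtain s0 where s0: "coprime s0 p" "[int s0 ^ 2 = int v] (mod int (p ^ k)) \<or> [int s0 ^ 2 = - int v] (mod int (p ^ k))"
    using exists_sqrt_up_to_sign[OF p k, of v] by (auto simp: v_def)
  obtain s where s: "[s = s0] (mod p ^ k)" "coprime s (2 * q)"
    using exists_coprime_lift[of "p ^ k" s0 "2 * q"] s0(1) prime_gt_0_nat[OF p(1)] q by auto
  have "odd s" using s(2) by simp
  have s2: "[int s ^ 2 = int s0 ^ 2] (mod int (p ^ k))"
    using s(1) by (intro cong_pow) (simp only: cong_int_iff)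
  have "[m ^ totient (p ^ k) = 1] (mod p ^ k)" using co by (intro euler_theorem) simp
  moreover have "totient (p ^ k) > 0" using prime_gt_0_nat[OF p(1)] by simp
  then have "m ^ (totient (p ^ k) - 1) * m = m ^ totient (p ^ k)" by (rule power_minus_mult)
  then have "v * m = n * m ^ totient (p ^ k)" by (simp only: v_def mult.assoc)
  ultimately have "[v * m = n * 1] (mod p ^ k)" by (simp only: cong_scalar_left)
  then have "[int (v * m) = int (n * 1)] (mod int (p ^ k))" by (simp only: cong_int_iff)
  then have vm: "[int v * int m = int n] (mod int (p ^ k))" by simp
  obtain \<sigma> :: int where \<sigma>: "\<sigma> = 1 \<or> \<sigma> = - 1" "[int s ^ 2 = \<sigma> * int v] (mod int (p ^ k))"
    using s0(2)
  proof
    assume "[int s0 ^ 2 = int v] (mod int (p ^ k))"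
    then show thesis using cong_trans[OF s2] by (intro that[of 1]) simp_all
  next
    assume "[int s0 ^ 2 = - int v] (mod int (p ^ k))"
    then show thesis using cong_trans[OF s2] by (intro that[of "- 1"]) simp_all
  qed
  have "[int s ^ 2 * int m = \<sigma> * int v * int m] (mod int (p ^ k))"
    using \<sigma>(2) by (rule cong_scalar_right)
  also have "[\<sigma> * int v * int m = \<sigma> * int n] (mod int (p ^ k))"
    using cong_scalar_left[OF vm, of \<sigma>] by (simp add: mult.assoc)
  finally have "int (p ^ k) dvd int s ^ 2 * int m - \<sigma> * int n" by (simp add: cong_iff_dvd_diff)
  \<comment> \<open>\<open>J\<close> has period \<open>2 * q\<close>, so the congruence is needed
    modulo \<open>2 * p ^ k\<close>. The factor 2 is the parity hypothesis on \<open>m - n\<close>,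
    since \<open>s\<close> is odd.\<close>
  moreover have "2 dvd int s ^ 2 * int m - \<sigma> * int n"
    using \<sigma>(1) mn(3) \<open>odd s\<close> by (elim disjE) (simp_all add: even_diff_iff)
  moreover have "odd p" using p(2) by presburger
  then have "coprime (int (p ^ k)) 2" by simp
  ultimately have "int (p ^ k) * 2 dvd int s ^ 2 * int m - \<sigma> * int n" by (rule divides_mult)
  then have "int (p ^ k) * 2 * int r dvd (int s ^ 2 * int m - \<sigma> * int n) * int r" by (rule mult_dvd_mono) simp
  then have "[int (s * s) * int (m * r) = \<sigma> * int (n * r)] (mod (2 * int q))"
    by (simp add: cong_iff_dvd_diff r algebra_simps power2_eq_square)
  then have "J (int (s * s) * int (m * r)) = J (\<sigma> * int (n * r))" by (rule J_cong)
  also have "\<dots> = J (int (n * r))" using \<sigma>(1) J_even[of "int (n * r)"] by auto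
  finally have "J (int (s * s) * int (m * r)) = J (int (n * r))" .
  moreover have "chi (s * s) = 1" using chi_mult[OF s(2), of s] chi_square[OF s(2)] by simp
  moreover have "chi (s * s) * J (int (s * s) * int (m * r)) = J (int (m * r))"
    using s(2) by (intro J_twist) simp
  ultimately show ?thesis by (simp add: r_def)
qed

end

section \<open>Profiles with trivial character\<close>

locale trivial_character_profile = cyclic_profile +
  assumes trivial: "\<And>u. coprime u (2 * q) \<Longrightarrow> chi u = 1"
begin

text \<open>Modulo \<open>2 * q\<close>, any \<open>n\<close> is its gcd with \<open>2 * q\<close>
  times a unit, and a trivial character ignores the unit.\<close>

lemma coef_gcd: "n > 0 \<Longrightarrow> coef n = coef (gcd n (2 * q))"
proof -
  assume n: "n > 0"
  define g where "g = gcd n (2 * q)"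
  have g: "g > 0" using n by (simp add: g_def)
  obtain n' M' where nM: "n = n' * g" "2 * q = M' * g" "coprime n' M'"
    using gcd_coprime_exists[of n "2 * q"] g unfolding g_def by auto
  have "M' > 0" using nM(2) q by (cases "M' = 0") auto
  then obtain u where u: "[u = n'] (mod M')" "coprime u (2 * q)"
    using exists_coprime_lift[OF _ nM(3), of "2 * q"] q by auto
  have "[u * g = n' * g] (mod M' * g)" using u(1) by (simp add: cong_def mult_mod_left)
  then have "coef (u * g) = coef n" using nM by (intro coef_cong) simp
  then show ?thesis using coef_twist[OF u(2), of g] trivial[OF u(2)] by (simp add: g_def)
qed

definition divs :: "nat set" where "divs = {d. d dvd 2 * q}"

lemma finite_divs: "finite divs" unfolding divs_def using q by (intro finite_divisors_nat) simp

lemma divs_pos: "d \<in> divs \<Longrightarrow> d > 0" unfolding divs_def using q by (cases "d = 0") auto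

text \<open>The Moebius transform of \<open>coef\<close>. The range up to \<open>2 * q\<close>
  contains all divisors of \<open>2 * q\<close>, at which \<open>coef\<close> is determined.\<close>

definition h :: "nat \<Rightarrow> real" where
  "h = (SOME h. \<forall>n. 0 < n \<and> n \<le> 2 * q \<longrightarrow> coef n = (\<Sum>d | d dvd n. h d))"

lemma h: "0 < n \<Longrightarrow> n \<le> 2 * q \<Longrightarrow> coef n = (\<Sum>d | d dvd n. h d)"
  using someI_ex[OF divisor_sum_inversion[of "2 * q" coef]] unfolding h_def by blast

lemma h1: "h 1 = coef 1" using h[of 1] q by simp

lemma coef_divs: "coef n = (\<Sum>d\<in>divs. h d * (if d dvd n then 1 else 0))"
proof -
  have pos: "coef n = (\<Sum>d\<in>divs. h d * (if d dvd n then 1 else 0))" if n: "n > 0" for n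
  proof -
    have "coef n = (\<Sum>d | d dvd gcd n (2 * q). h d)"
      unfolding coef_gcd[OF n] using n q by (intro h) (auto intro!: dvd_imp_le)
    also have "{d. d dvd gcd n (2 * q)} = {d\<in>divs. d dvd n}" by (auto simp: divs_def)
    also have "(\<Sum>d\<in>{d\<in>divs. d dvd n}. h d) = (\<Sum>d\<in>divs. if d dvd n then h d else 0)"
      by (rule sum.inter_filter[OF finite_divs])
    also have "\<dots> = (\<Sum>d\<in>divs. h d * (if d dvd n then 1 else 0))" by (rule sum.cong) auto
    finally show ?thesis .
  qed
  show ?thesis
  proof (cases "n > 0")
    case False
    have "coef 0 = coef (2 * q)" by (rule coef_cong) (simp add: cong_def)
    also have "\<dots> = (\<Sum>d\<in>divs. h d * (if d dvd 2 * q then 1 else 0))" using q by (intro pos) simp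
    also have "\<dots> = (\<Sum>d\<in>divs. h d * (if d dvd 0 then 1 else 0))" by (rule sum.cong) (auto simp: divs_def)
    finally show ?thesis using False by simp
  qed (rule pos)
qed

text \<open>The grid index \<open>2 * q div s\<close> is the point \<open>2 / s\<close>. There the
  cosines over the multiples of \<open>d\<close> below \<open>2 * q\<close> add up to their number
  \<open>2 * q / d\<close> if \<open>s\<close> divides \<open>d\<close>, and cancel
  otherwise.\<close>

lemma J_divs:
  assumes s: "s dvd 2 * q"
  shows "J (int (2 * q div s)) = (\<Sum>d\<in>divs. if s dvd d then h d / real d else 0)"
proof -
  define M where "M = 2 * q"
  have M: "M > 0" using q by (simp add: M_def)
  define a where "a = M div s"
  have sa: "M = s * a" using s by (simp add: a_def M_def)
  have s0: "s > 0" using sa M by (cases "s = 0") auto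
  have inner: "(\<Sum>n<M. (if d dvd n then 1 else 0) * cos (pi * real n * of_int (int a) / real q)) = (if s dvd d then real M / real d else 0)"
    if d: "d \<in> divs" for d
  proof -
    have d0: "d > 0" using divs_pos[OF d] .
    define N where "N = M div d"
    have N: "M = d * N" using d by (simp add: N_def divs_def M_def)
    have N0: "N > 0" using N M by (cases "N = 0") auto
    have "(\<Sum>n<M. (if d dvd n then 1 else 0) * cos (pi * real n * of_int (int a) / real q))
      = (\<Sum>n\<in>{n\<in>{..<M}. d dvd n}. cos (pi * real n * of_int (int a) / real q))"
      by (subst sum.inter_filter) (auto intro!: sum.cong)
    also have "\<dots> = (\<Sum>i<N. cos (2 * pi * real i * of_int (int a) / real N))"
    proof (rule sum.reindex_bij_witness[of _ "\<lambda>i. d * i" "\<lambda>n. n div d"])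
      fix n assume n: "n \<in> {n\<in>{..<M}. d dvd n}"
      then obtain i where i: "n = d * i" by auto
      have q2: "real q = real d * real N / 2" using N M_def by (metis nonzero_mult_div_cancel_left of_nat_mult of_nat_numeral zero_neq_numeral)
      show "cos (2 * pi * real (n div d) * of_int (int a) / real N) = cos (pi * real n * of_int (int a) / real q)"
        unfolding i q2 using d0 by (simp add: field_simps)
      show "d * (n div d) = n" using i d0 by simp
      show "n div d \<in> {..<N}" using n i d0 N by simp
    qed (use d0 N in auto)
    also have "\<dots> = (if int N dvd int a then real N else 0)" by (rule sum_cos_multiples[OF N0])
    also have "int N dvd int a \<longleftrightarrow> s dvd d"
    proof -
      have "N dvd a \<longleftrightarrow> (s * d) * N dvd (s * d) * a" using s0 d0 by simp
      also have "\<dots> \<longleftrightarrow> s * M dvd d * M"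
      proof -
        have e: "(s * d) * N = s * M" "(s * d) * a = d * M"
          by (subst N, simp only: mult.assoc) (subst sa, simp only: mult_ac)
        show ?thesis unfolding e by (rule refl)
      qed
      also have "s * M dvd d * M \<longleftrightarrow> s dvd d" using M by simp
      finally show ?thesis by simp
    qed
    also have "real N = real M / real d" using N d0 by simp
    finally show ?thesis .
  qed
  have "real M * J (int a) = (\<Sum>n<M. coef n * cos (pi * real n * of_int (int a) / real q))"
    unfolding M_def by (rule coef_inversion[symmetric])
  also have "\<dots> = (\<Sum>n<M. \<Sum>d\<in>divs. h d * ((if d dvd n then 1 else 0) * cos (pi * real n * of_int (int a) / real q)))"
    by (subst coef_divs) (simp only: sum_distrib_right mult.assoc)
  also have "\<dots> = (\<Sum>d\<in>divs. h d * (\<Sum>n<M. (if d dvd n then 1 else 0) * cos (pi * real n * of_int (int a) / real q)))"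
    by (subst sum.swap) (simp only: sum_distrib_left)
  also have "\<dots> = (\<Sum>d\<in>divs. real M * (if s dvd d then h d / real d else 0))"
  proof (rule sum.cong[OF refl])
    fix d assume d: "d \<in> divs"
    show "h d * (\<Sum>n<M. (if d dvd n then 1 else 0) * cos (pi * real n * of_int (int a) / real q)) =
      real M * (if s dvd d then h d / real d else 0)"
      unfolding inner[OF d] by simp
  qed
  finally have "real M * J (int a) = real M * (\<Sum>d\<in>divs. if s dvd d then h d / real d else 0)"
    by (simp only: sum_distrib_left)
  then show ?thesis using M by (simp add: a_def M_def)
qed

lemma J_zero_divs: "J 0 = (\<Sum>d\<in>divs. h d / real d)"
  using J_divs[of 1] J_cong[of "2 * int q" 0] by (simp add: cong_def)

definition primes_dvd :: "nat set" where "primes_dvd = prime_factors (2 * q)"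

text \<open>At \<open>t = z / p\<close> the Euler sums of all divisor indicators share the factors
  \<open>1 / (1 - z p / of_nat p)\<close>; this polynomial is what remains of the nonvanishing Euler
  sum of \<open>coef\<close>.\<close>

lemma divs_polynomial_nonzero:
  fixes z :: "nat \<Rightarrow> complex"
  assumes z: "\<And>p. p \<in> primes_dvd \<Longrightarrow> norm (z p) < 1"
  shows "(\<Sum>d\<in>divs. of_real (h d / real d) * (\<Prod>p\<in>primes_dvd. z p ^ multiplicity p d)) \<noteq> 0"
proof
  assume zero: "(\<Sum>d\<in>divs. of_real (h d / real d) * (\<Prod>p\<in>primes_dvd. z p ^ multiplicity p d)) = 0"
  define xs where "xs = map (\<lambda>p. (p, z p / of_nat p)) (sorted_list_of_set primes_dvd)"
  have fin: "finite primes_dvd" by (simp add: primes_dvd_def)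
  have pr: "prime p" if "p \<in> primes_dvd" for p using that by (auto simp: primes_dvd_def)
  have set_xs: "set xs = (\<lambda>p. (p, z p / of_nat p)) ` primes_dvd" using fin by (simp add: xs_def)
  have adm: "admissible xs"
    unfolding admissible_def set_xs using fin pr z
    by (auto simp: xs_def comp_def norm_divide divide_strict_right_mono prime_gt_0_nat)
  have single: "euler_sum (\<lambda>n. if d dvd n then 1 else 0) xs 1 =
     of_real (1 / real d) * (\<Prod>p\<in>primes_dvd. z p ^ multiplicity p d) * (\<Prod>p\<in>primes_dvd. 1 / (1 - z p / of_nat p))" if d: "d \<in> divs" for d
  proof -
    have d0: "d > 0" using divs_pos[OF d] .
    have sub: "prime_factors d \<subseteq> primes_dvd" unfolding primes_dvd_def
      using d q by (intro dvd_prime_factors) (auto simp: divs_def)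
    have "(\<Prod>p\<in>primes_dvd. p ^ multiplicity p d) = (\<Prod>p\<in>prime_factors d. p ^ multiplicity p d)"
      using fin sub pr d0
      by (intro prod.mono_neutral_right) (auto simp: prime_factors_dvd not_dvd_imp_multiplicity_0)
    also have "\<dots> = d" using prod_prime_factors[of d] d0 by simp
    finally have dprod: "(\<Prod>p\<in>primes_dvd. of_nat p ^ multiplicity p d) = complex_of_nat d"
      by (metis (no_types, lifting) of_nat_power of_nat_prod prod.cong)
    have inj: "inj_on (\<lambda>p. (p, z p / of_nat p)) primes_dvd" by (auto simp: inj_on_def)
    have "euler_sum (\<lambda>n. if d dvd n then 1 else 0) xs 1 = (\<Prod>(p, t)\<in>set xs. t ^ multiplicity p d / (1 - t))"
      using euler_sum_divisibility[OF adm d0] sub by (simp add: set_xs image_image)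
    also have "\<dots> = (\<Prod>p\<in>primes_dvd. z p ^ multiplicity p d / of_nat p ^ multiplicity p d * (1 / (1 - z p / of_nat p)))"
      unfolding set_xs by (subst prod.reindex[OF inj]) (simp add: power_divide)
    also have "\<dots> = (\<Prod>p\<in>primes_dvd. z p ^ multiplicity p d) / (\<Prod>p\<in>primes_dvd. of_nat p ^ multiplicity p d) * (\<Prod>p\<in>primes_dvd. 1 / (1 - z p / of_nat p))"
      by (simp only: prod.distrib prod_dividef)
    finally show ?thesis unfolding dprod by simp
  qed
  have "(\<lambda>n. complex_of_real (coef n)) = (\<lambda>n. \<Sum>d\<in>divs. of_real (h d) * (if d dvd n then 1 else 0))"
    by (subst coef_divs) (auto simp: fun_eq_iff intro!: sum.cong)
  then have "euler_sum (\<lambda>n. of_real (coef n)) xs 1 = (\<Sum>d\<in>divs. of_real (h d) * euler_sum (\<lambda>n. if d dvd n then 1 else 0) xs 1)"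
    using euler_sum_linear[OF adm finite_divs, of "\<lambda>d n. if d dvd n then 1 else 0" "\<lambda>d. of_real (h d)" 1] by simp
  also have "\<dots> = (\<Sum>d\<in>divs. of_real (h d / real d) * (\<Prod>p\<in>primes_dvd. z p ^ multiplicity p d)) * (\<Prod>p\<in>primes_dvd. 1 / (1 - z p / of_nat p))"
    unfolding sum_distrib_right
  proof (rule sum.cong[OF refl])
    fix d assume d: "d \<in> divs"
    show "of_real (h d) * euler_sum (\<lambda>n. if d dvd n then 1 else 0) xs 1 =
      of_real (h d / real d) * (\<Prod>p\<in>primes_dvd. z p ^ multiplicity p d) * (\<Prod>p\<in>primes_dvd. 1 / (1 - z p / of_nat p))"
      unfolding single[OF d] by simp
  qed
  finally show False using nz[OF adm] zero by simp
qed

lemma finite_primes_dvd: "finite primes_dvd" by (simp add: primes_dvd_def)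

lemma divs_multiplicity_pos:
  assumes "p \<in> primes_dvd" "d \<in> divs"
  shows "multiplicity p d = 0 \<longleftrightarrow> \<not> p dvd d"
proof (rule multiplicity_eq_zero_iff)
  have "prime p" using assms(1) by (auto simp: primes_dvd_def)
  then show "\<not> is_unit p" using not_prime_unit by blast
  show "d \<noteq> 0" using divs_pos[OF assms(2)] by simp
qed

text \<open>The sum is a boundary value of a polynomial without zeros in the open polydisc:
  variable 0 at the primes of \<open>P\<close> and \<open>r \<rightarrow> 1\<close> at the others. The bound
  by \<open>2 ^ N\<close>, uniform in \<open>r\<close>, keeps the limit from vanishing.\<close>
lemma prime_sieve_positive:
  assumes pos: "J 0 > 0" and P: "P \<subseteq> primes_dvd"
  shows "(\<Sum>d\<in>{d\<in>divs. \<forall>p\<in>P. \<not> p dvd d}. h d / real d) > 0"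
proof -
  have finP: "finite P" using P finite_primes_dvd finite_subset by blast
  define \<alpha> where "\<alpha> = (\<lambda>d. \<Sum>p\<in>P. multiplicity p d)"
  define \<beta> where "\<beta> = (\<lambda>d. \<Sum>p\<in>primes_dvd - P. multiplicity p d)"
  \<comment> \<open>A degree bound for the variable \<open>w\<close> that does not depend on
    \<open>r\<close>.\<close>
  define N where "N = (\<Sum>d\<in>divs. \<alpha> d)"
  define S where "S = (\<lambda>r. \<Sum>d\<in>divs. h d / real d * r ^ \<beta> d)"
  define Z where "Z = (\<lambda>r. \<Sum>d\<in>{d\<in>divs. \<alpha> d = 0}. h d / real d * r ^ \<beta> d)"
  have le: "S r / 2 ^ N \<le> Z r" if r: "0 \<le> r" "r < 1" "S r > 0" for r
    unfolding S_def Z_def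
  proof (rule nonvanishing_constant_term_ge[OF finite_divs])
    show "\<alpha> d \<le> N" if "d \<in> divs" for d
      unfolding N_def using that finite_divs by (intro member_le_sum) auto
    show "0 < (\<Sum>d\<in>divs. h d / real d * r ^ \<beta> d)" using r by (simp add: S_def)
    fix w :: complex assume w: "norm w < 1"
    define z where "z = (\<lambda>p. if p \<in> P then w else of_real r)"
    have "(\<Prod>p\<in>primes_dvd. z p ^ multiplicity p d) = w ^ \<alpha> d * of_real r ^ \<beta> d" for d
    proof -
      have "(\<Prod>p\<in>primes_dvd. z p ^ multiplicity p d) = (\<Prod>p\<in>primes_dvd - P. z p ^ multiplicity p d) * (\<Prod>p\<in>P. z p ^ multiplicity p d)"
        using P finite_primes_dvd by (rule prod.subset_diff)
      also have "(\<Prod>p\<in>P. z p ^ multiplicity p d) = w ^ \<alpha> d" by (simp add: z_def \<alpha>_def power_sum)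
      also have "(\<Prod>p\<in>primes_dvd - P. z p ^ multiplicity p d) = of_real r ^ \<beta> d" by (simp add: z_def \<beta>_def power_sum)
      finally show ?thesis by simp
    qed
    moreover have "(\<Sum>d\<in>divs. of_real (h d / real d) * (\<Prod>p\<in>primes_dvd. z p ^ multiplicity p d)) \<noteq> 0"
      by (rule divs_polynomial_nonzero) (use w r in \<open>auto simp: z_def\<close>)
    ultimately show "(\<Sum>d\<in>divs. complex_of_real (h d / real d * r ^ \<beta> d) * w ^ \<alpha> d) \<noteq> 0"
      by (simp add: mult_ac)
  qed
  have S1: "S 1 > 0" using pos J_zero_divs by (simp add: S_def)
  have cS: "(S \<longlongrightarrow> S 1) (at_left 1)" and cZ: "(Z \<longlongrightarrow> Z 1) (at_left 1)"
    unfolding S_def Z_def by (intro tendsto_intros)+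
  have "eventually (\<lambda>r. S r > 0) (at_left 1)" using cS S1 by (rule order_tendstoD)
  moreover have "eventually (\<lambda>r::real. r \<in> {0<..<1}) (at_left 1)" by (rule eventually_at_left_real) simp
  ultimately have "eventually (\<lambda>r. S r / 2 ^ N \<le> Z r) (at_left 1)"
    by eventually_elim (use le in auto)
  then have "S 1 / 2 ^ N \<le> Z 1"
    using tendsto_le[OF _ cZ tendsto_divide[OF cS tendsto_const]] by simp
  moreover have "S 1 / 2 ^ N > 0" using S1 by simp
  ultimately have "Z 1 > 0" by linarith
  moreover have "\<alpha> d = 0 \<longleftrightarrow> (\<forall>p\<in>P. \<not> p dvd d)" if "d \<in> divs" for d
  proof -
    have "\<alpha> d = 0 \<longleftrightarrow> (\<forall>p\<in>P. multiplicity p d = 0)" using finP by (simp add: \<alpha>_def)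
    also have "\<dots> \<longleftrightarrow> (\<forall>p\<in>P. \<not> p dvd d)" using P divs_multiplicity_pos[OF _ that] by blast
    finally show ?thesis .
  qed
  then have "{d\<in>divs. \<alpha> d = 0} = {d\<in>divs. \<forall>p\<in>P. \<not> p dvd d}" by auto
  ultimately show ?thesis by (simp add: Z_def)
qed

text \<open>Variable 0 at \<open>p\<close> and a common \<open>w\<close> elsewhere give a polynomial
  without zeros in the disc, equal to \<open>E\<close> at \<open>w = 1\<close> and to
  \<open>h 1 = coef 1\<close> at \<open>w = 0\<close>; so the signs agree. As 1 is a boundary point,
  \<open>E = 0\<close> is allowed.\<close>

lemma prime_sieve_sign:
  assumes p: "p \<in> primes_dvd"
  defines "E \<equiv> (\<Sum>d\<in>{d\<in>divs. \<not> p dvd d}. h d / real d)"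
  shows "E * coef 1 \<ge> 0"
proof -
  define D where "D = {d\<in>divs. \<not> p dvd d}"
  have D: "finite D" using finite_divs by (simp add: D_def)
  define e where "e = (\<lambda>d. \<Sum>r\<in>primes_dvd. multiplicity r d)"
  define N where "N = (\<Sum>d\<in>D. e d)"
  have eN: "e d \<le> N" if "d \<in> D" for d unfolding N_def using that D by (intro member_le_sum) auto
  have e0: "{d\<in>D. e d = 0} = {1}"
  proof -
    have unique: "d = 1" if d: "d \<in> D" "e d = 0" for d
    proof (rule ccontr)
      assume "d \<noteq> 1"
      then obtain r where r: "prime r" "r dvd d" using prime_factor_nat by blast
      have dd: "d \<in> divs" using d by (simp add: D_def)
      have "r \<in> primes_dvd" using r dd q by (auto simp: primes_dvd_def divs_def prime_factors_dvd dest: dvd_trans)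
      then have "multiplicity r d = 0" using d(2) finite_primes_dvd by (simp add: e_def)
      then show False using divs_multiplicity_pos[OF \<open>r \<in> primes_dvd\<close> dd] r by simp
    qed
    have "prime p" using p by (auto simp: primes_dvd_def)
    then have "\<not> p dvd 1" by (metis not_prime_unit)
    then have "1 \<in> D" "e 1 = 0" by (simp_all add: D_def divs_def e_def)
    then have "{1} \<subseteq> {d\<in>D. e d = 0}" by (simp only: insert_subset empty_subsetI mem_Collect_eq simp_thms)
    moreover have "{d\<in>D. e d = 0} \<subseteq> {1}"
    proof
      fix d assume "d \<in> {d\<in>D. e d = 0}"
      then show "d \<in> {1}" using unique[of d] by blast
    qed
    ultimately show ?thesis by (rule equalityI[rotated])
  qed
  have nzD: "(\<Sum>d\<in>D. of_real (h d / real d) * w ^ e d) \<noteq> 0" if w: "norm w < 1" for w :: complex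
  proof -
    define z where "z = (\<lambda>r. if r = p then 0 else w)"
    have "(\<Prod>r\<in>primes_dvd. z r ^ multiplicity r d) = (if p dvd d then 0 else w ^ e d)" if d: "d \<in> divs" for d
    proof (cases "p dvd d")
      case True
      then have "z p ^ multiplicity p d = 0" using divs_multiplicity_pos[OF p d] by (simp add: z_def)
      then show ?thesis using p finite_primes_dvd True by (auto intro!: prod_zero)
    next
      case False
      then have "multiplicity p d = 0" using divs_multiplicity_pos[OF p d] by simp
      then have "(\<Prod>r\<in>primes_dvd. z r ^ multiplicity r d) = (\<Prod>r\<in>primes_dvd. w ^ multiplicity r d)"
        by (intro prod.cong) (auto simp: z_def)
      then show ?thesis using False by (simp add: e_def power_sum)
    qed
    then have "(\<Sum>d\<in>divs. of_real (h d / real d) * (\<Prod>r\<in>primes_dvd. z r ^ multiplicity r d))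
       = (\<Sum>d\<in>divs. if \<not> p dvd d then of_real (h d / real d) * w ^ e d else 0)"
      by (intro sum.cong) auto
    also have "\<dots> = (\<Sum>d\<in>D. of_real (h d / real d) * w ^ e d)"
      unfolding D_def by (rule sum.inter_filter[OF finite_divs, symmetric])
    finally show ?thesis using divs_polynomial_nonzero[of z] w by (auto simp: z_def)
  qed
  have E: "E = (\<Sum>d\<in>D. h d / real d)" by (simp add: E_def D_def)
  consider "E > 0" | "E = 0" | "E < 0" by linarith
  then show ?thesis
  proof cases
    case 1
    have "(\<Sum>d\<in>D. h d / real d) / 2 ^ N \<le> (\<Sum>d\<in>{d\<in>D. e d = 0}. h d / real d)"
      by (rule nonvanishing_constant_term_ge[OF D eN nzD]) (use 1 E in auto)
    then have "E / 2 ^ N \<le> coef 1" unfolding e0 using h1 E by simp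
    moreover have "E / 2 ^ N > 0" using 1 by simp
    ultimately have "coef 1 > 0" by linarith
    then show ?thesis using 1 by simp
  next
    case 3
    have "(\<Sum>d\<in>D. - (h d / real d)) / 2 ^ N \<le> (\<Sum>d\<in>{d\<in>D. e d = 0}. - (h d / real d))"
    proof (rule nonvanishing_constant_term_ge[OF D eN])
      show "(\<Sum>d\<in>D. complex_of_real (- (h d / real d)) * w ^ e d) \<noteq> 0" if "norm w < 1" for w
        using nzD[OF that] by (simp add: sum_negf)
      show "0 < (\<Sum>d\<in>D. - (h d / real d))" using 3 E by (simp add: sum_negf)
    qed
    then have "- E / 2 ^ N \<le> - coef 1" unfolding e0 using h1 E by (simp add: sum_negf)
    moreover have "- E / 2 ^ N > 0" by (rule divide_pos_pos) (use 3 in auto)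
    ultimately have "coef 1 < 0" by linarith
    then show ?thesis using 3 by (simp add: mult_nonpos_nonpos)
  qed simp
qed

text \<open>Expand the product over \<open>P\<close> of 1 minus the indicator of
  \<open>p dvd d\<close>; by \<open>J_divs\<close> the term of \<open>S\<close> is a jump at
  \<open>2 / \<Prod>S\<close>.\<close>

lemma prime_sieve_inclusion_exclusion:
  assumes "P \<subseteq> primes_dvd"
  shows "(\<Sum>S\<in>Pow P. (-1) ^ card S * J (int (2 * q div \<Prod>S))) = (\<Sum>d\<in>{d\<in>divs. \<forall>p\<in>P. \<not> p dvd d}. h d / real d)"
proof -
  have fin: "finite P" using assms finite_primes_dvd finite_subset by blast
  have pr: "prime p" "p dvd 2 * q" if "p \<in> P" for p using assms that by (auto simp: primes_dvd_def)
  have prod_dvd: "\<Prod>S dvd d \<longleftrightarrow> (\<forall>p\<in>S. p dvd d)" if S: "S \<subseteq> P" for S d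
  proof
    assume "\<Prod>S dvd d"
    then show "\<forall>p\<in>S. p dvd d" using finite_subset[OF S fin] dvd_prodI[of S _ "\<lambda>x. x"] dvd_trans by blast
  next
    assume "\<forall>p\<in>S. p dvd d"
    then show "\<Prod>S dvd d" using S pr by (intro prod_primes_dvd finite_subset[OF S fin]) auto
  qed
  have ind: "(\<Sum>S\<in>Pow P. (-1) ^ card S * (if \<Prod>S dvd d then 1 else 0)) = (if \<forall>p\<in>P. \<not> p dvd d then 1 else (0::real))" for d
  proof -
    have "(\<Prod>p\<in>P. (- (if p dvd d then 1 else 0)) + (1::real)) = (\<Sum>S\<in>Pow P. (\<Prod>p\<in>S. - (if p dvd d then 1 else 0)) * (\<Prod>p\<in>P - S. 1))"
      by (rule prod_add[OF fin])
    also have "\<dots> = (\<Sum>S\<in>Pow P. (-1) ^ card S * (if \<Prod>S dvd d then 1 else 0))"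
    proof (rule sum.cong[OF refl])
      fix S assume "S \<in> Pow P"
      then have S: "S \<subseteq> P" "finite S" using fin finite_subset by auto
      have "(\<Prod>p\<in>S. - (if p dvd d then 1 else (0::real))) = (-1) ^ card S * (\<Prod>p\<in>S. if p dvd d then 1 else 0)"
        by (rule prod_uminus)
      also have "(\<Prod>p\<in>S. if p dvd d then 1 else (0::real)) = (if \<Prod>S dvd d then 1 else 0)"
        unfolding prod_dvd[OF S(1)] using S(2) by (auto intro!: prod_zero)
      finally show "(\<Prod>p\<in>S. - (if p dvd d then 1 else 0)) * (\<Prod>p\<in>P - S. 1) = (-1) ^ card S * (if \<Prod>S dvd d then 1 else (0::real))" by simp
    qed
    also have "(\<Prod>p\<in>P. (- (if p dvd d then 1 else 0)) + (1::real)) = (if \<forall>p\<in>P. \<not> p dvd d then 1 else 0)"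
      using fin by (auto intro!: prod_zero prod.neutral)
    finally show ?thesis by simp
  qed
  have "(\<Sum>S\<in>Pow P. (-1) ^ card S * J (int (2 * q div \<Prod>S)))
    = (\<Sum>S\<in>Pow P. \<Sum>d\<in>divs. h d / real d * ((-1) ^ card S * (if \<Prod>S dvd d then 1 else 0)))"
  proof (rule sum.cong[OF refl])
    fix S assume S: "S \<in> Pow P"
    have "\<Prod>S dvd 2 * q" using prod_dvd[of S "2 * q"] S pr by auto
    then show "(-1) ^ card S * J (int (2 * q div \<Prod>S)) = (\<Sum>d\<in>divs. h d / real d * ((-1) ^ card S * (if \<Prod>S dvd d then 1 else 0)))"
      by (subst J_divs) (auto simp: sum_distrib_left intro!: sum.cong)
  qed
  also have "\<dots> = (\<Sum>d\<in>divs. h d / real d * (\<Sum>S\<in>Pow P. (-1) ^ card S * (if \<Prod>S dvd d then 1 else 0)))"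
    by (subst sum.swap) (simp only: sum_distrib_left)
  also have "\<dots> = (\<Sum>d\<in>divs. if \<forall>p\<in>P. \<not> p dvd d then h d / real d else 0)"
    unfolding ind by (rule sum.cong) auto
  also have "\<dots> = (\<Sum>d\<in>{d\<in>divs. \<forall>p\<in>P. \<not> p dvd d}. h d / real d)"
    by (rule sum.inter_filter[OF finite_divs, symmetric])
  finally show ?thesis .
qed

end

section \<open>Sign conditions on the jumps\<close>

context cyclic_profile
begin

text \<open>Every unit fixes the index 0, so \<open>chi u * J 0 = J 0\<close>.\<close>

lemma trivial_character_of_J_zero:
  assumes "J 0 \<noteq> 0"
  shows "trivial_character_profile q c"
proof
  fix u assume "coprime u (2 * q)"
  then show "chi u = 1" using J_twist[of u 0] assms by simp
qed

text \<open>A unit congruent to 1 modulo \<open>r\<close> fixes the index \<open>2 * q div r\<close>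
  modulo \<open>2 * q\<close>, so a nonzero jump there forces its character to be 1. By the Chinese
  remainder theorem each unit is a product of one that is 1 modulo the full power of
  \<open>p\<close> and one that is 1 modulo the cofactor, which \<open>p'\<close> divides.\<close>

lemma trivial_character_of_two_primes:
  assumes p: "prime p" "prime p'" "p \<noteq> p'" "p dvd q" "p' dvd q"
    and J: "J (int (2 * q div p)) \<noteq> 0" "J (int (2 * q div p')) \<noteq> 0"
  shows "trivial_character_profile q c"
proof
  have one: "chi u = 1" if u: "coprime u (2 * q)" "[u = 1] (mod r)" and r: "r dvd q" "J (int (2 * q div r)) \<noteq> 0" for u r
  proof -
    obtain a where a: "q = r * a" using r(1) by blast
    have r0: "r > 0" using a q by (cases "r = 0") auto
    have "int r dvd int u - 1" using u(2) by (metis cong_iff_dvd_diff cong_int_iff of_nat_1)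
    then have "int r * int (2 * a) dvd (int u - 1) * int (2 * a)" by (rule mult_dvd_mono) simp
    moreover have "2 * q div r = 2 * a" using a r0 by simp
    ultimately have "[int u * int (2 * q div r) = int (2 * q div r)] (mod (2 * int q))"
      using a by (simp add: cong_iff_dvd_diff algebra_simps)
    then show ?thesis using J_twist[OF u(1), of "int (2 * q div r)"] J_cong r(2) by simp
  qed
  fix u assume u: "coprime u (2 * q)"
  have q2: "2 * q \<noteq> 0" using q by simp
  define b where "b = multiplicity p (2 * q)"
  obtain M' where M': "2 * q = p ^ b * M'" "\<not> p dvd M'"
    using multiplicity_decompose'[of "2 * q" p, OF q2] not_prime_unit p(1) unfolding b_def by blast
  have "p dvd 2 * q" using p(4) by simp
  then have b: "b > 0" using M' by (cases "b = 0") auto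
  have co: "coprime (p ^ b) M'" using M'(2) p(1) by (simp add: prime_imp_coprime)
  have "p' dvd p ^ b * M'" using p(5) M'(1) by (metis dvd_mult)
  then have p'M: "p' dvd M'" using p(1,2,3)
    by (metis prime_dvd_mult_iff prime_dvd_power primes_dvd_imp_eq)
  obtain u1 where u1: "[u1 = 1] (mod p ^ b)" "[u1 = u] (mod M')" using binary_chinese_remainder_nat[OF co] by blast
  obtain u2 where u2: "[u2 = u] (mod p ^ b)" "[u2 = 1] (mod M')" using binary_chinese_remainder_nat[OF co] by blast
  have cu: "coprime u (p ^ b)" "coprime u M'" using u unfolding M'(1) by auto
  have c1: "coprime u1 (2 * q)" "coprime u2 (2 * q)"
    using u1 u2 cu unfolding M'(1) by (metis cong_imp_coprime cong_sym coprime_1_left coprime_mult_right_iff)+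
  have "[u1 * u2 = 1 * u] (mod p ^ b)" "[u1 * u2 = u * 1] (mod M')"
    using u1 u2 by (intro cong_mult; simp)+
  then have "[u1 * u2 = u] (mod p ^ b * M')"
    using co by (intro coprime_cong_mult_nat) simp_all
  then have "chi u = chi (u1 * u2)" using chi_cong[of "u1 * u2" u] M'(1) by simp
  also have "\<dots> = chi u1 * chi u2" by (rule chi_mult[OF c1(1)])
  also have "chi u1 = 1"
    using one[OF c1(1) _ p(4) J(1)] u1(1) b cong_dvd_modulus_nat[OF u1(1), of p] by (simp add: dvd_power)
  also have "chi u2 = 1"
    using one[OF c1(2) _ p(5) J(2)] cong_dvd_modulus_nat[OF u2(2) p'M] by simp
  finally show "chi u = 1" by simp
qed

lemma J_sieve_positive:
  assumes "J 0 > 0" "finite P" "\<And>p. p \<in> P \<Longrightarrow> prime p \<and> p dvd q"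
  shows "(\<Sum>S\<in>Pow P. (-1) ^ card S * J (int (2 * q div \<Prod>S))) > 0"
proof -
  interpret trivial_character_profile q c using assms(1) by (intro trivial_character_of_J_zero) simp
  have P: "P \<subseteq> primes_dvd" using assms(3) q by (auto simp: primes_dvd_def prime_factors_dvd)
  show ?thesis unfolding prime_sieve_inclusion_exclusion[OF P] by (rule prime_sieve_positive[OF assms(1) P])
qed

text \<open>If both jumps are nonzero, the character is trivial. As \<open>J 0 = 0\<close>, the
  sieve by a single prime is minus the jump, so both jumps have sign opposite to
  \<open>coef 1\<close>.\<close>

lemma J_primes_same_sign:
  assumes "J 0 = 0" and p: "prime p" "prime p'" "p \<noteq> p'" "p dvd q" "p' dvd q"
  shows "J (int (2 * q div p)) * J (int (2 * q div p')) \<ge> 0"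
proof (cases "J (int (2 * q div p)) = 0 \<or> J (int (2 * q div p')) = 0")
  case False
  then interpret trivial_character_profile q c by (intro trivial_character_of_two_primes[OF p]) auto
  have neg: "J (int (2 * q div r)) * coef 1 \<le> 0" if r: "prime r" "r dvd q" for r
  proof -
    have mem: "r \<in> primes_dvd" using r q by (auto simp: primes_dvd_def prime_factors_dvd)
    have "Pow {r} = {{}, {r}}" by auto
    then have "J (int (2 * q)) - J (int (2 * q div r)) = (\<Sum>d\<in>{d\<in>divs. \<not> r dvd d}. h d / real d)"
      using prime_sieve_inclusion_exclusion[of "{r}"] mem by simp
    moreover have "J (int (2 * q)) = 0" using J_cong[of "2 * int q" 0] assms(1) by (simp add: cong_def)
    ultimately have X: "J (int (2 * q div r)) = - (\<Sum>d\<in>{d\<in>divs. \<not> r dvd d}. h d / real d)" by simp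
    show ?thesis unfolding X using prime_sieve_sign[OF mem] by simp
  qed
  have "(J (int (2 * q div p)) * coef 1) * (J (int (2 * q div p')) * coef 1) \<ge> 0"
    using neg[OF p(1,4)] neg[OF p(2,5)] by (rule mult_nonpos_nonpos)
  then have "(J (int (2 * q div p)) * J (int (2 * q div p'))) * (coef 1)\<^sup>2 \<ge> 0"
    by (simp add: power2_eq_square mult_ac)
  then show ?thesis using coef1 by (simp add: zero_le_mult_iff)
qed auto

end

lemma cyclic_profile_exists:
  assumes "step_rat \<phi>" "complete_dilates \<phi>" "Q > 0"
  obtains q c where "cyclic_profile q c" "Q dvd q" "2 * rlim0 \<phi> = odd_profile.J c 0"
    "\<And>j. j > 0 \<Longrightarrow> j \<le> 2 * q \<Longrightarrow> jump \<phi> (real j / real q) = odd_profile.J c (int j)"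
    "\<And>s. s dvd q \<Longrightarrow> jump \<phi> (2 / real s) = odd_profile.J c (int (2 * q div s))"
proof (rule step_rat_profile[OF assms])
  fix q c
  assume *: "odd_profile q c" "Q dvd q" "\<And>j. j > 0 \<Longrightarrow> j \<le> 2 * q \<Longrightarrow> jump \<phi> (real j / real q) = odd_profile.J c (int j)"
    "2 * rlim0 \<phi> = odd_profile.J c 0"
    "\<And>xs. admissible xs \<Longrightarrow> euler_sum (\<lambda>n. of_real (odd_profile.coef q c n)) xs 1 \<noteq> 0"
  have "cyclic_profile q c"
    by (intro cyclic_profile.intro cyclic_profile_axioms.intro *)
  moreover have "jump \<phi> (2 / real s) = odd_profile.J c (int (2 * q div s))" if s: "s dvd q" for s
  proof -
    interpret odd_profile q c by (rule *)
    obtain a where a: "q = s * a" using s by blast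
    have s0: "s > 0" using a q by (cases "s = 0") auto
    have a0: "a > 0" using a q by (cases "a = 0") auto
    have e: "2 * q div s = 2 * a" using a s0 by simp
    have "a \<le> q" using a s0 by simp
    have "2 / real s = real (2 * a) / real q" using a s0 a0 by (simp add: field_simps)
    then show ?thesis using *(3)[of "2 * a"] \<open>a \<le> q\<close> a0 by (simp add: e)
  qed
  ultimately show thesis using * by (intro that) auto
qed

theorem theorem1p6:
  fixes \<phi> :: "real \<Rightarrow> real"
  assumes "step_rat \<phi>" and "complete_dilates \<phi>"
  shows "(rlim0 \<phi> > 0 \<longrightarrow>
           (\<forall>P :: nat set. finite P \<and> (\<forall>p\<in>P. prime p) \<longrightarrow>
              2 * rlim0 \<phi> >
                (\<Sum>S\<in>{S. S \<subseteq> P \<and> S \<noteq> {}}.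
                   (-1) ^ (card S + 1) * jump \<phi> (2 / real (\<Prod>S)))))
       \<and> (rlim0 \<phi> = 0 \<longrightarrow>
           (\<forall>p::nat. prime p \<longrightarrow> jump \<phi> (2 / real p) \<ge> 0) \<or>
           (\<forall>p::nat. prime p \<longrightarrow> jump \<phi> (2 / real p) \<le> 0))
       \<and> (\<forall>(p::nat) (k::nat) (m::nat) (n::nat).
           prime p \<and> p mod 4 = 3 \<and> k > 0 \<and>
           1 \<le> m \<and> m \<le> p ^ k - 1 \<and> 1 \<le> n \<and> n \<le> p ^ k - 1 \<and>
           \<not> p dvd m * n \<and> even (int m - int n) \<longrightarrow>
           jump \<phi> (real m / real (p ^ k)) = jump \<phi> (real n / real (p ^ k)))"
proof (intro conjI impI allI; (elim conjE)?)
  fix P :: "nat set"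
  assume r: "rlim0 \<phi> > 0" and P: "finite P" "\<forall>p\<in>P. prime p"
  \<comment> \<open>\<open>q\<close> will be a multiple of this product, so that all the points
    \<open>2 / \<Prod>S\<close> lie on the grid.\<close>
  have "\<Prod>P > 0" using P(2) by (intro prod_pos) (auto simp: prime_gt_0_nat)
  then obtain q c where cp: "cyclic_profile q c" and Q: "\<Prod>P dvd q" and r0: "2 * rlim0 \<phi> = odd_profile.J c 0"
    and j: "\<And>s. s dvd q \<Longrightarrow> jump \<phi> (2 / real s) = odd_profile.J c (int (2 * q div s))"
    by (rule cyclic_profile_exists[OF assms]) (rule that)
  interpret cyclic_profile q c by (rule cp)
  have jmp: "jump \<phi> (2 / real (\<Prod>S)) = J (int (2 * q div \<Prod>S))" if "S \<subseteq> P" for S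
  proof -
    have "\<Prod>S dvd \<Prod>P" using P(1) that by (rule prod_dvd_prod_subset)
    then show ?thesis using Q dvd_trans by (intro j) blast
  qed
  have "0 < (\<Sum>S\<in>Pow P. (-1) ^ card S * J (int (2 * q div \<Prod>S)))"
  proof (rule J_sieve_positive)
    show "prime p \<and> p dvd q" if "p \<in> P" for p
      using P that Q dvd_trans[OF dvd_prodI[of P p "\<lambda>x. x"]] by auto
  qed (use r r0 P in auto)
  \<comment> \<open>The empty set contributes the jump at 2, by periodicity the jump
    \<open>2 * rlim0 \<phi>\<close> at 0.\<close>
  also have "Pow P = insert {} {S. S \<subseteq> P \<and> S \<noteq> {}}" by auto
  also have "(\<Sum>S\<in>insert {} {S. S \<subseteq> P \<and> S \<noteq> {}}. (-1) ^ card S * J (int (2 * q div \<Prod>S)))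
     = J (int (2 * q)) + (\<Sum>S\<in>{S. S \<subseteq> P \<and> S \<noteq> {}}. (-1) ^ card S * J (int (2 * q div \<Prod>S)))"
    using P(1) by (subst sum.insert) auto
  also have "J (int (2 * q)) = 2 * rlim0 \<phi>"
    using J_cong[of "2 * int q" 0] r0 by (simp add: cong_def)
  also have "(\<Sum>S\<in>{S. S \<subseteq> P \<and> S \<noteq> {}}. (-1) ^ card S * J (int (2 * q div \<Prod>S)))
     = - (\<Sum>S\<in>{S. S \<subseteq> P \<and> S \<noteq> {}}. (-1) ^ (card S + 1) * jump \<phi> (2 / real (\<Prod>S)))"
    unfolding sum_negf[symmetric] by (rule sum.cong[OF refl]) (simp add: jmp del: of_nat_prod)
  finally show "(\<Sum>S\<in>{S. S \<subseteq> P \<and> S \<noteq> {}}. (-1) ^ (card S + 1) * jump \<phi> (2 / real (\<Prod>S))) < 2 * rlim0 \<phi>"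
    by linarith
next
  assume r: "rlim0 \<phi> = 0"
  \<comment> \<open>\<open>q\<close> has to be divisible by the primes involved, so only two of them
    are compared at a time.\<close>
  have pair: "jump \<phi> (2 / real p) * jump \<phi> (2 / real p') \<ge> 0" if p: "prime p" "prime p'" for p p' :: nat
  proof (cases "p = p'")
    case False
    have "p * p' > 0" using p prime_gt_0_nat by simp
    then obtain q c where cp: "cyclic_profile q c" and Q: "p * p' dvd q" and r0: "2 * rlim0 \<phi> = odd_profile.J c 0"
      and j: "\<And>s. s dvd q \<Longrightarrow> jump \<phi> (2 / real s) = odd_profile.J c (int (2 * q div s))"
      by (rule cyclic_profile_exists[OF assms]) (rule that)
    interpret cyclic_profile q c by (rule cp)
    have d: "p dvd q" "p' dvd q" using Q dvd_mult_left dvd_mult_right by blast+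
    show ?thesis unfolding j[OF d(1)] j[OF d(2)]
      by (rule J_primes_same_sign) (use r r0 p False d in auto)
  qed simp
  show "(\<forall>p::nat. prime p \<longrightarrow> jump \<phi> (2 / real p) \<ge> 0) \<or> (\<forall>p::nat. prime p \<longrightarrow> jump \<phi> (2 / real p) \<le> 0)"
  proof (rule ccontr)
    assume "\<not> ?thesis"
    then obtain p p' :: nat where "prime p" "jump \<phi> (2 / real p) < 0" "prime p'" "jump \<phi> (2 / real p') > 0"
      by (auto simp: not_le)
    then show False using pair[of p p'] mult_neg_pos[of "jump \<phi> (2 / real p)" "jump \<phi> (2 / real p')"] by linarith
  qed
next
  fix p k m n :: nat
  assume p: "prime p" "p mod 4 = 3" "k > 0" and mn: "1 \<le> m" "m \<le> p ^ k - 1" "1 \<le> n" "n \<le> p ^ k - 1"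
    "\<not> p dvd m * n" "even (int m - int n)"
  have "p ^ k > 0" using prime_gt_0_nat[OF p(1)] by simp
  then obtain q c where cp: "cyclic_profile q c" and Q: "p ^ k dvd q"
    and j: "\<And>j. j > 0 \<Longrightarrow> j \<le> 2 * q \<Longrightarrow> jump \<phi> (real j / real q) = odd_profile.J c (int j)"
    by (rule cyclic_profile_exists[OF assms]) (rule that)
  interpret cyclic_profile q c by (rule cp)
  obtain a where a: "q = p ^ k * a" using Q by blast
  have a0: "a > 0" using a q by (cases "a = 0") auto
  have qa: "q div p ^ k = a" using a \<open>p ^ k > 0\<close> by simp
  have jmp: "jump \<phi> (real l / real (p ^ k)) = J (int (l * (q div p ^ k)))" if l: "1 \<le> l" "l \<le> p ^ k - 1" for l
  proof -
    have eq: "real l / real (p ^ k) = real (l * a) / real q" using a a0 by simp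
    have "l * a \<le> p ^ k * a" using l by (intro mult_le_mono1) simp
    then have "l * a \<le> 2 * q" using a by linarith
    then have "jump \<phi> (real (l * a) / real q) = J (int (l * a))" using j[of "l * a"] l a0 by simp
    then show ?thesis unfolding eq qa .
  qed
  show "jump \<phi> (real m / real (p ^ k)) = jump \<phi> (real n / real (p ^ k))"
    unfolding jmp[OF mn(1,2)] jmp[OF mn(3,4)]
    by (rule J_3_mod_4[OF p Q]) (use mn p in \<open>auto simp: prime_dvd_mult_iff\<close>)
qed

end
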